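(* Let $n\ge2$. For each nontrivial monomial polyhedron $\mathcal U_B\subset\mathbb C^n$, the operator $P^+_{\mathcal U_B}$ is of restricted type $(p,p)$ (with respect to Lebesgue measure on $\mathcal U_B$) for every $p\in(p_*,2]$.
   Context: Monomial polyhedron: for an integer matrix $B\in\mathbb Z^{n\times n}$ with entry $b^j_k$ in row $j$, column $k$, set $\mathcal U_B=\{z\in\mathbb C^n:\ \prod_{k=1}^n|z_k|^{b^j_k}<1\text{ for }1\le j\le n\}$ (a point is in the set only if all the powers are defined; $0^0=1$). It is called a monomial polyhedron if it is a bounded domain (connected open set) in $\mathbb C^n$, $n\ge2$. It is nontrivial if it is not the unit polydisc $\mathbb D^n$. The rows of $B$ are ordered so that $\det B>0$ (permuting rows does not change $\mathcal U_B$). Let $\Delta=\operatorname{adj}B=(\det B)B^{-1}$ (an integer matrix with nonnegative entries and nonzero determinant), with columns $\delta_1,\dots,\delta_n$, and let $a_j=\delta_j/\gcd(\delta_j)$, where $\gcd(\delta_j)$ is the gcd of the entries of $\delta_j$. Let $\mathbf 1=(1,\dots,1)\in\mathbb Z^{1\times n}$, so $\mathbf 1a_j$ is the sum of the entries of $a_j$, and let $p_*=\max_j\frac{2\,\mathbf 1a_j}{\mathbf 1a_j+1}$. For a domain $\Omega\subset\mathbb C^n$ with Bergman kernel $K_\Omega$ (the reproducing kernel of the space of square-integrable holomorphic functions on $\Omega$), $P^+_\Omega f(z)=\int_\Omega|K_\Omega(z,\zeta)|f(\zeta)\,dV(\zeta)$ whenever the integral converges. A linear operator $T$ is of restricted type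 $(p,p)$ if there is $C>0$ with $\|T(1_E)\|_{L^p}\le C\|1_E\|_{L^p}$ for all measurable $E$ of finite measure, $1_E$ being the indicator function. *)

theory Defs
  imports "HOL-Analysis.Analysis"
begin

section \<open>Monomial polyhedra\<close>

text \<open>
  Row \<open>j\<close>, column \<open>k\<close> of the exponent matrix is \<open>B $ j $ k\<close>. The first conjunct says that all the
  powers are defined; it is needed since \<open>0 powi m = 0\<close> for negative \<open>m\<close>. The convention
  \<open>0 powi 0 = 1\<close> is that of the library.
\<close>
definition monomial_region :: "int ^ 'n ^ 'n \<Rightarrow> (complex ^ 'n::finite) set" where
  "monomial_region B =
     {z. (\<forall>j k. B $ j $ k < 0 \<longrightarrow> z $ k \<noteq> 0) \<and>
         (\<forall>j. (\<Prod>k\<in>UNIV. cmod (z $ k) powi (B $ j $ k)) < 1)}"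

definition domain_Cn :: "(complex ^ 'n::finite) set \<Rightarrow> bool" where
  "domain_Cn \<Omega> \<longleftrightarrow> \<Omega> \<noteq> {} \<and> open \<Omega> \<and> connected \<Omega>"

definition monomial_polyhedron :: "int ^ 'n ^ 'n::finite \<Rightarrow> bool" where
  "monomial_polyhedron B \<longleftrightarrow>
     CARD('n) \<ge> 2 \<and> domain_Cn (monomial_region B) \<and> bounded (monomial_region B)"

definition unit_polydisc :: "(complex ^ 'n::finite) set" where
  "unit_polydisc = {z. \<forall>k. cmod (z $ k) < 1}"

text \<open>
  The determinant of \<open>A\<close> with row \<open>j\<close> replaced by the \<open>i\<close>-th unit row vector is the \<open>(j, i)\<close>
  cofactor of \<open>A\<close>; an index type need not be ordered, so there is no sign \<open>(-1) ^ (i + j)\<close> to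
  write.
\<close>
definition adjugate :: "'a::comm_ring_1 ^ 'n ^ 'n \<Rightarrow> 'a ^ 'n ^ 'n::finite" where
  "adjugate A = (\<chi> i j. det (\<chi> r. if r = j then axis i 1 else A $ r))"

lemma matrix_mul_adjugate:
  fixes A :: "'a::comm_ring_1 ^ 'n ^ 'n::finite"
  shows "A ** adjugate A = mat (det A)"
proof -
  have "(\<Sum>i\<in>UNIV. A $ k $ i * det (\<chi> r. if r = j then axis i 1 else A $ r)) =
        (if k = j then det A else 0)" for k j
  proof -
    have "(\<Sum>i\<in>UNIV. A $ k $ i * det (\<chi> r. if r = j then axis i 1 else A $ r)) =
          (\<Sum>i\<in>UNIV. det (\<chi> r. if r = j then A $ k $ i *s axis i 1 else A $ r))"
      by (intro sum.cong refl) (rule det_row_mul [symmetric])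
    also have "\<dots> = det (\<chi> r. if r = j then (\<Sum>i\<in>UNIV. A $ k $ i *s axis i 1) else A $ r)"
      by (rule det_linear_row_sum [symmetric]) simp
    also have "(\<Sum>i\<in>UNIV. A $ k $ i *s axis i 1) = A $ k"
      by (rule basis_expansion)
    also have "det (\<chi> r. if r = j then A $ k else A $ r) = (if k = j then det A else 0)"
    proof (cases "k = j")
      case True
      then have "(\<chi> r. if r = j then A $ k else A $ r) = A"
        by (simp add: vec_eq_iff)
      then show ?thesis using True by simp
    next
      case False
      then show ?thesis
        using det_identical_rows [of k j "\<chi> r. if r = j then A $ k else A $ r"]
        by (simp add: row_def)
    qed
    finally show ?thesis .
  qed
  then show ?thesis
    by (simp add: vec_eq_iff matrix_matrix_mult_def adjugate_def mat_def)
qed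

definition primitive_column :: "int ^ 'n ^ 'n \<Rightarrow> 'n \<Rightarrow> int ^ 'n::finite" where
  "primitive_column B j =
     (\<chi> i. adjugate B $ i $ j div Gcd (range (\<lambda>l. adjugate B $ l $ j)))"

definition p_star :: "int ^ 'n ^ 'n::finite \<Rightarrow> real" where
  "p_star B =
     (MAX j\<in>UNIV. let s = real_of_int (\<Sum>i\<in>UNIV. primitive_column B j $ i) in 2 * s / (s + 1))"

section \<open>The Bergman kernel and the absolute Bergman operator\<close>

text \<open>Complex differentiability: the Frechet derivative is complex linear.\<close>
definition holomorphic_Cn :: "(complex ^ 'n::finite \<Rightarrow> complex) \<Rightarrow> (complex ^ 'n) set \<Rightarrow> bool" where
  "holomorphic_Cn f \<Omega> \<longleftrightarrow>
     (\<forall>z\<in>\<Omega>. \<exists>D. (f has_derivative D) (at z) \<and> (\<forall>c v. D (c *s v) = c * D v))"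

definition bergman_space :: "(complex ^ 'n::finite) set \<Rightarrow> (complex ^ 'n \<Rightarrow> complex) set" where
  "bergman_space \<Omega> =
     {f. holomorphic_Cn f \<Omega> \<and> integrable (lebesgue_on \<Omega>) (\<lambda>z. (cmod (f z))\<^sup>2)}"

text \<open>
  For \<open>z \<in> \<Omega>\<close> the function \<open>bergman_kernel \<Omega> z\<close> is the conjugate of the element of the Bergman
  space that represents evaluation at \<open>z\<close>. It is set to \<open>0\<close> off \<open>\<Omega>\<close> because functions are total and
  it would not be unique otherwise.
\<close>
definition bergman_kernel ::
  "(complex ^ 'n::finite) set \<Rightarrow> complex ^ 'n \<Rightarrow> complex ^ 'n \<Rightarrow> complex" where
  "bergman_kernel \<Omega> z =
     (THE k. (\<lambda>\<zeta>. cnj (k \<zeta>)) \<in> bergman_space \<Omega> \<and> (\<forall>\<zeta>. \<zeta> \<notin> \<Omega> \<longrightarrow> k \<zeta> = 0) \<and>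
        (\<forall>f\<in>bergman_space \<Omega>. f z = (LINT \<zeta>|lebesgue_on \<Omega>. k \<zeta> * f \<zeta>)))"

definition abs_bergman_defined_at ::
  "(complex ^ 'n::finite) set \<Rightarrow> (complex ^ 'n \<Rightarrow> complex) \<Rightarrow> complex ^ 'n \<Rightarrow> bool" where
  "abs_bergman_defined_at \<Omega> f z \<longleftrightarrow>
     integrable (lebesgue_on \<Omega>) (\<lambda>\<zeta>. of_real (cmod (bergman_kernel \<Omega> z \<zeta>)) * f \<zeta>)"

text \<open>
  The value is meaningful only where \<^const>\<open>abs_bergman_defined_at\<close> holds; elsewhere the Bochner
  integral is \<open>0\<close> by convention.
\<close>
definition abs_bergman ::
  "(complex ^ 'n::finite) set \<Rightarrow> (complex ^ 'n \<Rightarrow> complex) \<Rightarrow> complex ^ 'n \<Rightarrow> complex" where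
  "abs_bergman \<Omega> f z =
     (LINT \<zeta>|lebesgue_on \<Omega>. of_real (cmod (bergman_kernel \<Omega> z \<zeta>)) * f \<zeta>)"

section \<open>Operators of restricted type\<close>

definition Lp_space :: "real \<Rightarrow> 'a measure \<Rightarrow> ('a \<Rightarrow> complex) set" where
  "Lp_space p M = {f \<in> borel_measurable M. integrable M (\<lambda>x. cmod (f x) powr p)}"

definition Lp_norm :: "real \<Rightarrow> 'a measure \<Rightarrow> ('a \<Rightarrow> complex) \<Rightarrow> real" where
  "Lp_norm p M f = (LINT x|M. cmod (f x) powr p) powr (1 / p)"

text \<open>
  The operator is given by a total map \<open>T\<close> and the predicate \<open>D\<close>, where \<open>D f x\<close> says that \<open>T f\<close> is
  defined at \<open>x\<close>. Membership in \<^const>\<open>Lp_space\<close> is explicit because \<^const>\<open>Lp_norm\<close> is \<open>0\<close>, not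
  infinite, on functions outside it.
\<close>
definition restricted_type ::
  "real \<Rightarrow> 'a measure \<Rightarrow> (('a \<Rightarrow> complex) \<Rightarrow> 'a \<Rightarrow> bool) \<Rightarrow>
     (('a \<Rightarrow> complex) \<Rightarrow> 'a \<Rightarrow> complex) \<Rightarrow> bool" where
  "restricted_type p M D T \<longleftrightarrow>
     (\<exists>C>0. \<forall>E\<in>sets M. emeasure M E < \<infinity> \<longrightarrow>
        (AE x in M. D (indicator E) x) \<and> T (indicator E) \<in> Lp_space p M \<and>
        Lp_norm p M (T (indicator E)) \<le> C * Lp_norm p M (indicator E))"

end

theory Submission
  imports Defs "HOL-Complex_Analysis.Conformal_Mappings" "HOL-Real_Asymp.Real_Asymp"
begin

text \<open>
  Write \<open>B A = diag d\<close>, where the columns of \<open>A\<close> are the primitive columns \<open>a\<^sub>j\<close>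
  of the adjugate of \<open>B\<close>. Boundedness of the region forces \<open>A \<ge> 0\<close>, and the monomial map
  \<open>\<Phi>(y) = y\<^bsup>A\<^esup>\<close> maps the punctured polydisc, where \<open>0 < \<bar>y\<^sub>j\<bar> < 1\<close> for all \<open>j\<close>, onto the
  points of the region with no zero coordinate. Up to the constant \<open>det A\<close> its Jacobian is
  \<open>\<Prod>\<^sub>j y\<^sub>j ^ (s\<^sub>j - 1)\<close>, where \<open>s\<^sub>j\<close> is the sum of the entries
  of \<open>a\<^sub>j\<close>. Both sides of the change of variables formula are invariant
  under the torus; so it suffices to compare radial functions, for which it is the linear
  substitution \<open>x' = A x\<close> in the coordinates \<open>- ln \<bar>z\<^sub>k\<bar>\<^sup>2\<close> (\<open>change_of_variables\<close>).

  If \<open>f\<close> is square-integrable and holomorphic on the region then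
  \<open>F = (f \<circ> \<Phi>) \<cdot> jac\<close> is so on the punctured polydisc; its singularities on the coordinate
  hyperplanes are removable, and the Bergman kernel of the polydisc reproduces it
  (\<open>reproducing\<close>). The product \<open>\<Prod> 1 / (1 - u\<^sub>j)\<^sup>2\<close>, where \<open>u\<^sub>j = x\<^sub>j cnj y\<^sub>j\<close>, splits according to
  the residues modulo \<open>d\<^sub>j\<close> of the exponents of \<open>u\<^sub>j\<close>. As \<open>f \<circ> \<Phi>\<close> is invariant under the finite deck
  group of \<open>\<Phi>\<close>, only residues in the lattice \<open>\<int>\<^sup>n A\<close> contribute. Their sum is a rational function of
  \<open>\<Phi>(x)\<close> and \<open>\<Phi>(y)\<close>, which therefore is the Bergman kernel \<open>K\<close> of the region
  (\<open>kernel_reproducing\<close>, \<open>bergman_kernel_eq\<close>). The closed form shows that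
  \<open>\<bar>jac x\<bar> \<bar>jac y\<bar> \<bar>K(\<Phi>(x), \<Phi>(y))\<bar>\<close> is at most a constant times \<open>\<Prod> 1 / \<bar>1 - u\<^sub>j ^ d\<^sub>j\<bar>\<^sup>2\<close>
  (\<open>kernel_bound\<close>).

  Pulled back by \<open>\<Phi>\<close>, the \<open>L\<^sup>p\<close> bound for the absolute Bergman operator becomes an
  \<open>L\<^sup>p\<close> bound for the operator with kernel \<open>\<Prod> 1 / \<bar>1 - u\<^sub>j ^ d\<^sub>j\<bar>\<^sup>2\<close> with respect to the weight
  \<open>\<bar>jac y\<bar> powr (2 - p)\<close>, that is \<open>\<Prod> \<bar>y\<^sub>j\<bar> powr ((s\<^sub>j - 1) (2 - p))\<close>. Kernel and weight are products,
  and Schur's test applies with the test function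
  \<open>\<Prod> \<bar>y\<^sub>j\<bar> powr (- u\<^sub>j) \<cdot> (1 - \<bar>y\<^sub>j\<bar>\<^sup>2) powr (- 1/2)\<close>, where \<open>u\<^sub>j = (s\<^sub>j - 1) (2 - p) / (p - 1)\<close>
  (\<open>polydisc_kernel_weighted_bound\<close>). The integrals that it needs are those of Forelli and Rudin, and
  they converge at the origin exactly if \<open>u\<^sub>j < 2\<close>, which says \<open>p > 2 s\<^sub>j / (s\<^sub>j + 1)\<close>.
\<close>

section \<open>Lebesgue measure on spaces of vectors\<close>

text \<open>
  Lebesgue measure is defined by a product over the standard basis. This regroups such products by
  the coordinates of a vector.
\<close>
lemma prod_Basis_vec:
  fixes h :: "'a::euclidean_space ^ 'n::finite \<Rightarrow> 'b::comm_monoid_mult"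
  shows "(\<Prod>b\<in>Basis. h b) = (\<Prod>i\<in>UNIV. \<Prod>u\<in>Basis. h (axis i u))"
proof -
  have "(\<Prod>b\<in>Basis. h b) = (\<Prod>b\<in>(\<lambda>(i, u). axis i u) ` (UNIV \<times> Basis). h b)"
    by (rule prod.cong) (auto simp: Basis_vec_def)
  also have "\<dots> = (\<Prod>(i, u)\<in>UNIV \<times> Basis. h (axis i u))"
    by (subst prod.reindex) (auto simp: inj_on_def axis_eq_axis nonzero_Basis case_prod_unfold)
  also have "\<dots> = (\<Prod>i\<in>UNIV. \<Prod>u\<in>Basis. h (axis i u))"
    by (rule prod.cartesian_product [symmetric])
  finally show ?thesis .
qed

lemma measurable_vec_lambda_PiM [measurable]:
  "(\<lambda>f. \<chi> i. f i) \<in> PiM UNIV (\<lambda>_::'n::finite. borel :: 'a::euclidean_space measure) \<rightarrow>\<^sub>M borel"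
proof (subst borel_measurable_euclidean_space, intro ballI)
  fix b :: "'a^'n" assume "b \<in> Basis"
  then obtain i u where b: "b = axis i u" "u \<in> Basis" by (auto simp: Basis_vec_def)
  show "(\<lambda>f. (\<chi> i. f i) \<bullet> b) \<in> borel_measurable (PiM UNIV (\<lambda>_::'n. borel :: 'a measure))"
    by (simp add: b inner_axis)
qed

lemma measurable_vec_nth_borel [measurable]:
  "(\<lambda>x. x $ i) \<in> (borel :: ('a::euclidean_space ^ 'n::finite) measure) \<rightarrow>\<^sub>M borel"
  by (intro borel_measurable_continuous_onI continuous_intros)

lemma borel_measurable_vec_lambda [measurable]:
  fixes f :: "'n::finite \<Rightarrow> 'c \<Rightarrow> 'a::euclidean_space"
  assumes [measurable]: "\<And>i. f i \<in> borel_measurable M"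
  shows "(\<lambda>x. \<chi> i. f i x) \<in> borel_measurable M"
proof (subst borel_measurable_euclidean_space, intro ballI)
  fix b :: "'a^'n" assume "b \<in> Basis"
  then obtain i u where b: "b = axis i u" "u \<in> Basis" by (auto simp: Basis_vec_def)
  show "(\<lambda>x. (\<chi> i. f i x) \<bullet> b) \<in> borel_measurable M"
    by (simp add: b inner_axis)
qed

text \<open>
  Boxes in \<open>'a ^ 'n\<close> are products of boxes in \<open>'a\<close>. With this identity the theorem of Fubini for
  finite products applies to vectors.
\<close>
lemma lborel_vec_eq_PiM:
  "(lborel :: ('a::euclidean_space ^ 'n::finite) measure) =
     distr (PiM UNIV (\<lambda>_. lborel)) borel (\<lambda>f. \<chi> i. f i)"
proof (rule lborel_eqI)
  interpret product_sigma_finite "\<lambda>_::'n. lborel :: 'a measure" ..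
  interpret finite_product_sigma_finite "\<lambda>_::'n. lborel :: 'a measure" UNIV by standard simp
  have [measurable_cong]: "sets (PiM UNIV (\<lambda>_::'n. lborel :: 'a measure)) = sets (PiM UNIV (\<lambda>_. borel))"
    by (intro sets_PiM_cong) auto
  fix l u :: "'a^'n" assume le: "\<And>b. b \<in> Basis \<Longrightarrow> l \<bullet> b \<le> u \<bullet> b"
  have le': "l $ i \<bullet> b \<le> u $ i \<bullet> b" if "b \<in> Basis" for i b
    using le[of "axis i b"] that by (simp add: inner_axis axis_in_Basis_iff)
  have "(\<lambda>f. \<chi> i. f i) -` box l u \<inter> space (PiM UNIV (\<lambda>_. lborel)) = (PiE UNIV (\<lambda>i. box (l$i) (u$i)))"
    by (auto simp: box_def Basis_vec_def inner_axis space_PiM PiE_def Pi_def)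
  then have "emeasure (distr (PiM UNIV (\<lambda>_. lborel)) borel (\<lambda>f. \<chi> i. f i)) (box l u)
     = (\<Prod>i\<in>UNIV. emeasure lborel (box (l$i) (u$i)))"
    by (subst emeasure_distr) (simp_all add: emeasure_PiM)
  also have "\<dots> = (\<Prod>i\<in>UNIV. \<Prod>b\<in>Basis. ennreal ((u$i - l$i) \<bullet> b))"
    using le' by (simp add: emeasure_lborel_box prod_ennreal inner_diff_left)
  also have "\<dots> = (\<Prod>b\<in>Basis. ennreal ((u - l) \<bullet> b))"
    by (simp add: prod_Basis_vec inner_axis)
  finally show "emeasure (distr (PiM UNIV (\<lambda>_. lborel)) borel (\<lambda>f. \<chi> i. f i)) (box l u)
     = ennreal (\<Prod>b\<in>Basis. (u - l) \<bullet> b)"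
    using le by (simp add: prod_ennreal inner_diff_left)
qed simp

lemma nn_integral_lborel_vec_prod:
  fixes f :: "'n::finite \<Rightarrow> 'a::euclidean_space \<Rightarrow> ennreal"
  assumes [measurable]: "\<And>i. f i \<in> borel_measurable borel"
  shows "(\<integral>\<^sup>+x. (\<Prod>i\<in>UNIV. f i (x $ i)) \<partial>lborel) = (\<Prod>i\<in>UNIV. \<integral>\<^sup>+x. f i x \<partial>lborel)"
proof -
  interpret product_sigma_finite "\<lambda>_::'n. lborel :: 'a measure" ..
  have [measurable_cong]: "sets (PiM UNIV (\<lambda>_::'n. lborel :: 'a measure)) = sets (PiM UNIV (\<lambda>_. borel))"
    by (intro sets_PiM_cong) auto
  show ?thesis
    by (subst lborel_vec_eq_PiM, subst nn_integral_distr) (simp_all add: product_nn_integral_prod)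
qed

lemma sigma_finite_density_lborel:
  assumes "g \<in> borel_measurable borel" "\<And>x. g x < \<infinity>"
  shows "sigma_finite_measure (density (lborel :: 'a::euclidean_space measure) g)"
  using assms sigma_finite_lborel
  by (subst sigma_finite_measure.sigma_finite_iff_density_finite) (auto simp: less_top)

lemma PiM_density_lborel:
  fixes g :: "'n::finite \<Rightarrow> 'b::euclidean_space \<Rightarrow> ennreal"
  assumes g [measurable]: "\<And>i. g i \<in> borel_measurable borel"
    and fin: "\<And>i x. g i x < \<infinity>"
  shows "PiM UNIV (\<lambda>i. density lborel (g i)) =
    distr (density lborel (\<lambda>x. \<Prod>i\<in>UNIV. g i (x $ i))) (PiM UNIV (\<lambda>i. density lborel (g i))) (\<lambda>x i. x $ i)"
proof -
  define N where "N i = density lborel (g i)" for i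
  interpret N: product_sigma_finite N
    using sigma_finite_density_lborel[OF g fin] by (auto simp: product_sigma_finite_def N_def)
  have sN [measurable_cong]: "sets (N i) = sets borel" for i by (simp add: N_def)
  let ?Q2 = "distr (density lborel (\<lambda>x. \<Prod>i\<in>UNIV. g i (x $ i))) (PiM UNIV N) (\<lambda>x i. x $ i)"
  have m2 [measurable]: "(\<lambda>x i. x $ i) \<in> (borel :: ('b^'n) measure) \<rightarrow>\<^sub>M PiM UNIV N"
    by (rule measurable_PiM_single') (auto simp: space_PiM N_def)
  have "emeasure ?Q2 (Pi\<^sub>E UNIV A) = (\<Prod>i\<in>UNIV. N i (A i))" if A: "\<And>i. A i \<in> sets (N i)" for A
  proof -
    have [measurable]: "A i \<in> sets borel" for i using A sN by auto
    have PA [measurable]: "Pi\<^sub>E UNIV A \<in> sets (PiM UNIV N)" using A by auto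
    have "emeasure ?Q2 (Pi\<^sub>E UNIV A) = (\<integral>\<^sup>+z. (\<Prod>i\<in>UNIV. g i (z$i)) * indicator (Pi\<^sub>E UNIV A) (\<lambda>i. z $ i) \<partial>lborel)"
      using PA by (subst nn_integral_indicator[symmetric], simp)
         (simp add: nn_integral_distr nn_integral_density del: nn_integral_indicator)
    also have "\<dots> = (\<integral>\<^sup>+z. (\<Prod>i\<in>UNIV. g i (z$i) * indicator (A i) (z $ i)) \<partial>lborel)"
      unfolding prod.distrib
      by (intro nn_integral_cong arg_cong2[where f="(*)"] refl)
         (auto simp: indicator_def PiE_def Pi_def intro!: prod.neutral)
    also have "\<dots> = (\<Prod>i\<in>UNIV. \<integral>\<^sup>+x. g i x * indicator (A i) x \<partial>lborel)"
      by (rule nn_integral_lborel_vec_prod) measurable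
    finally show ?thesis by (simp add: N_def emeasure_density)
  qed
  then have Q2: "?Q2 = PiM UNIV N"
    by (intro N.PiM_eqI) auto
  then show ?thesis unfolding N_def by simp
qed

text \<open>
  Weights of product form are handled as product measures; in the sequel the weight is the indicator
  of a polydisc or the density of a push-forward.
\<close>
lemma density_lborel_eq_PiM:
  fixes g :: "'n::finite \<Rightarrow> 'b::euclidean_space \<Rightarrow> ennreal"
  assumes g [measurable]: "\<And>i. g i \<in> borel_measurable borel"
    and fin: "\<And>i x. g i x < \<infinity>"
  shows "density lborel (\<lambda>x. \<Prod>i\<in>UNIV. g i (x $ i)) =
    distr (PiM UNIV (\<lambda>i. density lborel (g i))) borel (\<lambda>f. \<chi> i. f i)"
proof -
  let ?N = "\<lambda>i. density lborel (g i)"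
  have [measurable_cong]: "sets (PiM UNIV ?N) = sets (PiM UNIV (\<lambda>_::'n. borel :: 'b measure))"
    by (intro sets_PiM_cong) auto
  have m2 [measurable]: "(\<lambda>x i. x $ i) \<in> (borel :: ('b^'n) measure) \<rightarrow>\<^sub>M PiM UNIV ?N"
    by (rule measurable_PiM_single') (auto simp: space_PiM)
  have "distr (PiM UNIV ?N) borel (\<lambda>f. \<chi> i. f i) = distr (density lborel (\<lambda>x. \<Prod>i\<in>UNIV. g i (x $ i))) borel (\<lambda>x. x)"
    by (subst PiM_density_lborel[OF g fin], subst distr_distr) (auto simp: comp_def)
  also have "\<dots> = density lborel (\<lambda>x. \<Prod>i\<in>UNIV. g i (x $ i))"
    by (intro distr_id2) simp
  finally show ?thesis ..
qed

text \<open>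
  Every substitution below that acts on the coordinates one at a time (rotations, affine maps, passing
  to logarithms of moduli) reduces to one variable by this lemma.
\<close>
lemma distr_lborel_componentwise:
  fixes f :: "'n::finite \<Rightarrow> 'a::euclidean_space \<Rightarrow> 'b::euclidean_space" and g :: "'n \<Rightarrow> 'b \<Rightarrow> ennreal"
  assumes f [measurable]: "\<And>i. f i \<in> borel_measurable borel"
    and g [measurable]: "\<And>i. g i \<in> borel_measurable borel"
    and fin: "\<And>i x. g i x < \<infinity>"
    and eq: "\<And>i. distr lborel borel (f i) = density lborel (g i)"
  shows "distr lborel borel (\<lambda>z. \<chi> i. f i (z $ i)) = density lborel (\<lambda>x. \<Prod>i\<in>UNIV. g i (x $ i))"
proof -
  define N where "N i = density lborel (g i)" for i
  interpret N: product_sigma_finite N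
    using sigma_finite_density_lborel[OF g fin] by (auto simp: product_sigma_finite_def N_def)
  have sN [measurable_cong]: "sets (N i) = sets borel" for i by (simp add: N_def)
  have sP [measurable_cong]: "sets (PiM UNIV N) = sets (PiM UNIV (\<lambda>_::'n. borel :: 'b measure))"
    by (intro sets_PiM_cong) (auto simp: sN)
  let ?Q1 = "distr lborel (PiM UNIV N) (\<lambda>z i. f i (z $ i))"
  have m1 [measurable]: "(\<lambda>z i. f i (z $ i)) \<in> borel \<rightarrow>\<^sub>M PiM UNIV N"
    by (rule measurable_PiM_single') (auto simp: space_PiM N_def intro!: measurable_compose[OF _ f])
  have "emeasure ?Q1 (Pi\<^sub>E UNIV A) = (\<Prod>i\<in>UNIV. N i (A i))" if A: "\<And>i. A i \<in> sets (N i)" for A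
  proof -
    have [measurable]: "A i \<in> sets borel" for i using A sN by auto
    have PA: "Pi\<^sub>E UNIV A \<in> sets (PiM UNIV N)" using A by auto
    have "emeasure ?Q1 (Pi\<^sub>E UNIV A) = (\<integral>\<^sup>+z. (\<Prod>i\<in>UNIV. indicator (A i) (f i (z $ i))) \<partial>lborel)"
      using PA by (subst nn_integral_indicator[symmetric], simp, subst nn_integral_distr)
         (auto simp: indicator_def PiE_def Pi_def intro!: nn_integral_cong)
    also have "\<dots> = (\<Prod>i\<in>UNIV. \<integral>\<^sup>+x. indicator (A i) (f i x) \<partial>lborel)"
      by (rule nn_integral_lborel_vec_prod) measurable
    also have "\<dots> = (\<Prod>i\<in>UNIV. emeasure (distr lborel borel (f i)) (A i))"
      by (intro prod.cong refl, subst nn_integral_indicator[symmetric])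
         (simp_all add: nn_integral_distr del: nn_integral_indicator)
    finally show ?thesis by (simp add: eq N_def)
  qed
  then have Q1: "?Q1 = PiM UNIV N"
    by (intro N.PiM_eqI) auto
  have "distr lborel borel (\<lambda>z. \<chi> i. f i (z $ i)) = distr ?Q1 borel (\<lambda>x. \<chi> i. x i)"
    by (subst distr_distr) (auto simp: comp_def)
  also have "\<dots> = density lborel (\<lambda>x. \<Prod>i\<in>UNIV. g i (x $ i))"
    unfolding Q1 unfolding N_def by (rule density_lborel_eq_PiM[OF g fin, symmetric])
  finally show ?thesis .
qed

section \<open>Linear changes of variables\<close>

text \<open>
  By Fubini the coordinate \<open>m\<close> is integrated first, and there the shear is a translation.
\<close>
lemma nn_integral_lborel_shear:
  fixes h :: "real ^ 'n::finite \<Rightarrow> ennreal"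
  assumes [measurable]: "h \<in> borel_measurable borel" and mn: "m \<noteq> n"
  shows "(\<integral>\<^sup>+x. h (\<chi> i. if i = m then x $ m + x $ n else x $ i) \<partial>lborel) = (\<integral>\<^sup>+x. h x \<partial>lborel)"
proof -
  let ?M = "\<lambda>_::'n. lborel :: real measure"
  let ?J = "UNIV - {m}"
  interpret product_sigma_finite ?M ..
  have [measurable_cong]: "sets (PiM UNIV ?M) = sets (PiM UNIV (\<lambda>_. borel))"
    by (intro sets_PiM_cong) auto
  have U: "UNIV = insert m ?J" by auto
  have [measurable]: "(\<lambda>x::'n \<Rightarrow> real. \<chi> i. if i = m then x m + x n else x i) \<in> PiM UNIV ?M \<rightarrow>\<^sub>M borel"
    by (rule borel_measurable_vec_lambda) simp
  have ins: "integral\<^sup>N (PiM UNIV ?M) F = (\<integral>\<^sup>+ x. (\<integral>\<^sup>+ y. F (x(m := y)) \<partial>lborel) \<partial>PiM ?J ?M)"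
    if "F \<in> borel_measurable (PiM UNIV ?M)" for F
    using product_nn_integral_insert[of ?J m F] that U by simp
  have "(\<integral>\<^sup>+x. h (\<chi> i. if i = m then x $ m + x $ n else x $ i) \<partial>lborel)
      = (\<integral>\<^sup>+x. h (\<chi> i. if i = m then x m + x n else x i) \<partial>PiM UNIV ?M)"
    by (subst lborel_vec_eq_PiM, subst nn_integral_distr) (simp_all cong: if_cong)
  also have "\<dots> = (\<integral>\<^sup>+x. (\<integral>\<^sup>+y. h (\<chi> i. if i = m then y + x n else x i) \<partial>lborel) \<partial>PiM ?J ?M)"
    using mn by (subst ins) (simp_all cong: if_cong)
  also have "\<dots> = (\<integral>\<^sup>+x. (\<integral>\<^sup>+y. h (\<chi> i. if i = m then y else x i) \<partial>lborel) \<partial>PiM ?J ?M)"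
  proof (rule nn_integral_cong)
    fix x :: "'n \<Rightarrow> real"
    have "(\<integral>\<^sup>+y. h (\<chi> i. if i = m then y else x i) \<partial>lborel) =
        ennreal \<bar>1\<bar> * (\<integral>\<^sup>+y. h (\<chi> i. if i = m then x n + 1 * y else x i) \<partial>lborel)"
      by (rule nn_integral_real_affine) measurable
    then show "(\<integral>\<^sup>+y. h (\<chi> i. if i = m then y + x n else x i) \<partial>lborel) = (\<integral>\<^sup>+y. h (\<chi> i. if i = m then y else x i) \<partial>lborel)"
      by (simp add: add.commute cong: if_cong)
  qed
  also have "\<dots> = (\<integral>\<^sup>+x. h (\<chi> i. x i) \<partial>PiM UNIV ?M)"
    by (subst ins) (simp_all add: fun_upd_def)
  also have "\<dots> = (\<integral>\<^sup>+x. h x \<partial>lborel)"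
    by (subst lborel_vec_eq_PiM, subst nn_integral_distr) simp_all
  finally show ?thesis .
qed

lemma distr_lborel_permute:
  assumes tt: "\<And>i. \<tau> (\<tau> i) = i"
  shows "distr lborel borel (\<lambda>x::real^'n::finite. \<chi> i. x $ \<tau> i) = lborel"
proof (rule lborel_eqI[symmetric])
  fix l u :: "real^'n" assume le: "\<And>b. b \<in> Basis \<Longrightarrow> l \<bullet> b \<le> u \<bullet> b"
  have le': "l $ i \<le> u $ i" for i
    using le[of "axis i 1"] by (simp add: inner_axis axis_in_Basis_iff)
  have bij: "bij \<tau>" by (rule o_bij[of \<tau>]) (auto simp: tt)
  have eq: "(\<lambda>x. \<chi> i. x $ \<tau> i) -` box l u = box (\<chi> i. l $ \<tau> i) (\<chi> i. u $ \<tau> i)"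
  proof (intro set_eqI iffI)
    fix x assume "x \<in> (\<lambda>x. \<chi> i. x $ \<tau> i) -` box l u"
    then have "l $ \<tau> i < x $ \<tau> (\<tau> i) \<and> x $ \<tau> (\<tau> i) < u $ \<tau> i" for i
      unfolding vimage_def mem_box_cart by auto
    then show "x \<in> box (\<chi> i. l $ \<tau> i) (\<chi> i. u $ \<tau> i)" by (simp add: mem_box_cart tt)
  next
    fix x assume "x \<in> box (\<chi> i. l $ \<tau> i) (\<chi> i. u $ \<tau> i)"
    then have "l $ \<tau> (\<tau> i) < x $ \<tau> i \<and> x $ \<tau> i < u $ \<tau> (\<tau> i)" for i
      unfolding mem_box_cart by auto
    then show "x \<in> (\<lambda>x. \<chi> i. x $ \<tau> i) -` box l u" by (simp add: mem_box_cart tt)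
  qed
  have "emeasure lborel (box (\<chi> i. l $ \<tau> i) (\<chi> i. u $ \<tau> i)) = ennreal (\<Prod>b\<in>Basis. ((\<chi> i. u $ \<tau> i) - (\<chi> i. l $ \<tau> i)) \<bullet> b)"
    using le' by (subst emeasure_lborel_box) (auto simp: Basis_vec_def inner_axis)
  also have "(\<Prod>b\<in>Basis. ((\<chi> i. u $ \<tau> i) - (\<chi> i. l $ \<tau> i)) \<bullet> b) = (\<Prod>i\<in>UNIV. u $ \<tau> i - l $ \<tau> i)"
    by (simp add: prod_Basis_vec inner_axis)
  also have "\<dots> = (\<Prod>i\<in>UNIV. u $ i - l $ i)"
    using prod.reindex_bij_betw[OF bij, of "\<lambda>i. u $ i - l $ i"] by simp
  also have "\<dots> = (\<Prod>b\<in>Basis. (u - l) \<bullet> b)"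
    by (simp add: prod_Basis_vec inner_axis)
  finally show "emeasure (distr lborel borel (\<lambda>x::real^'n. \<chi> i. x $ \<tau> i)) (box l u) = ennreal (\<Prod>b\<in>Basis. (u - l) \<bullet> b)"
    by (simp add: emeasure_distr eq)
qed simp

lemma borel_measurable_matrix_vector_mult [measurable]:
  "(*v) (A :: real ^ 'n ^ 'm::finite) \<in> borel_measurable borel"
  by (intro borel_measurable_continuous_onI linear_continuous_on matrix_vector_mul_bounded_linear)

text \<open>
  The formula is multiplicative in \<open>A\<close>, and every matrix is a product of matrices that are diagonal,
  interchange two coordinates, are shears, or have a zero row.
\<close>
lemma nn_integral_lborel_matrix:
  fixes A :: "real ^ 'n ^ 'n::finite" and h :: "real ^ 'n \<Rightarrow> ennreal"
  assumes "det A \<noteq> 0" "h \<in> borel_measurable borel"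
  shows "(\<integral>\<^sup>+x. h (A *v x) \<partial>lborel) = ennreal (1 / \<bar>det A\<bar>) * (\<integral>\<^sup>+x. h x \<partial>lborel)"
proof -
  define P where "P A \<longleftrightarrow> (det A \<noteq> 0 \<longrightarrow> (\<forall>h\<in>borel_measurable borel.
      (\<integral>\<^sup>+x. h (A *v x) \<partial>lborel) = ennreal (1 / \<bar>det A\<bar>) * (\<integral>\<^sup>+x. h x \<partial>lborel)))" for A :: "real^'n^'n"
  have "P A"
  proof (rule induct_matrix_elementary_alt)
    fix A B :: "real^'n^'n" assume P: "P A" "P B"
    show "P (A ** B)" unfolding P_def
    proof (intro impI ballI)
      assume det: "det (A ** B) \<noteq> 0"
      fix h :: "real^'n \<Rightarrow> ennreal" assume [measurable]: "h \<in> borel_measurable borel"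
      have "(\<integral>\<^sup>+x. h ((A ** B) *v x) \<partial>lborel) = (\<integral>\<^sup>+x. h (A *v (B *v x)) \<partial>lborel)"
        by (simp add: matrix_vector_mul_assoc)
      also have "\<dots> = ennreal (1 / \<bar>det B\<bar>) * (\<integral>\<^sup>+x. h (A *v x) \<partial>lborel)"
      proof -
        have "(\<lambda>x. h (A *v x)) \<in> borel_measurable borel" by measurable
        from P(2)[unfolded P_def, rule_format, OF _ this] det show ?thesis by (simp add: det_mul)
      qed
      also have "(\<integral>\<^sup>+x. h (A *v x) \<partial>lborel) = ennreal (1 / \<bar>det A\<bar>) * (\<integral>\<^sup>+x. h x \<partial>lborel)"
        using P(1) det unfolding P_def det_mul by auto
      also have "ennreal (1 / \<bar>det B\<bar>) * (ennreal (1 / \<bar>det A\<bar>) * (\<integral>\<^sup>+x. h x \<partial>lborel))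
          = ennreal (1 / \<bar>det B\<bar> * (1 / \<bar>det A\<bar>)) * (\<integral>\<^sup>+x. h x \<partial>lborel)"
        by (subst ennreal_mult') (simp_all add: mult.assoc)
      also have "1 / \<bar>det B\<bar> * (1 / \<bar>det A\<bar>) = 1 / \<bar>det (A ** B)\<bar>"
        by (simp add: det_mul abs_mult)
      finally show "(\<integral>\<^sup>+x. h ((A ** B) *v x) \<partial>lborel) = ennreal (1 / \<bar>det (A ** B)\<bar>) * (\<integral>\<^sup>+x. h x \<partial>lborel)" .
    qed
  next
    fix A :: "real^'n^'n" and i assume "row i A = 0"
    then show "P A" by (simp add: P_def det_zero_row(2))
  next
    fix A :: "real^'n^'n" assume diag: "\<And>i j. i \<noteq> j \<Longrightarrow> A $ i $ j = 0"
    show "P A" unfolding P_def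
    proof (intro impI ballI)
      assume det: "det A \<noteq> 0"
      have detA: "det A = (\<Prod>i\<in>UNIV. A $ i $ i)" using diag by (rule det_diagonal)
      have nz: "A $ i $ i \<noteq> 0" for i using det by (simp add: detA)
      fix h :: "real^'n \<Rightarrow> ennreal" assume [measurable]: "h \<in> borel_measurable borel"
      have Av: "A *v x = (\<chi> i. A $ i $ i * x $ i)" for x
      proof -
        have "(\<Sum>j\<in>UNIV. A $ i $ j * x $ j) = (\<Sum>j\<in>UNIV. if j = i then A $ i $ i * x $ i else 0)" for i
          by (intro sum.cong) (auto simp: diag)
        then show ?thesis by (simp add: matrix_vector_mult_def)
      qed
      have "distr lborel borel (\<lambda>z. \<chi> i. A $ i $ i * z $ i) = density lborel (\<lambda>x. \<Prod>i\<in>UNIV. ennreal (1 / \<bar>A $ i $ i\<bar>))"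
        by (rule distr_lborel_componentwise)
           (use nz in \<open>simp_all add: lborel_distr_mult' lborel_distr_mult inverse_eq_divide[symmetric]\<close>)
      then have "(\<integral>\<^sup>+x. h x \<partial>distr lborel borel (\<lambda>z. \<chi> i. A $ i $ i * z $ i)) = (\<integral>\<^sup>+x. h x \<partial>density lborel (\<lambda>x. \<Prod>i\<in>UNIV. ennreal (1 / \<bar>A $ i $ i\<bar>)))"
        by simp
      then show "(\<integral>\<^sup>+x. h (A *v x) \<partial>lborel) = ennreal (1 / \<bar>det A\<bar>) * (\<integral>\<^sup>+x. h x \<partial>lborel)"
        by (simp add: nn_integral_distr nn_integral_density Av nn_integral_cmult prod_ennreal detA abs_prod prod_dividef)
    qed
  next
    fix m n :: 'n assume "m \<noteq> n"
    let ?\<tau> = "Transposition.transpose m n"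
    let ?A = "\<chi> i j. mat 1 $ i $ ?\<tau> j :: real^'n^'n"
    have "det ?A = of_int (sign ?\<tau>) * det (mat 1 :: real^'n^'n)"
      by (rule det_permute_columns) (simp add: permutes_swap_id)
    then have det: "\<bar>det ?A\<bar> = 1" by (simp add: sign_def)
    have Av: "?A *v x = (\<chi> i. x $ ?\<tau> i)" for x
    proof -
      have "(\<Sum>j\<in>UNIV. (mat 1 :: real^'n^'n) $ i $ ?\<tau> j * x $ j) = (\<Sum>j\<in>UNIV. if j = ?\<tau> i then x $ ?\<tau> i else 0)" for i
        by (intro sum.cong) (auto simp: mat_def)
      then show ?thesis by (simp add: matrix_vector_mult_def)
    qed
    show "P ?A" unfolding P_def
    proof (intro impI ballI)
      fix h :: "real^'n \<Rightarrow> ennreal" assume [measurable]: "h \<in> borel_measurable borel"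
      have "(\<integral>\<^sup>+x. h x \<partial>lborel) = (\<integral>\<^sup>+x. h x \<partial>distr lborel borel (\<lambda>x::real^'n. \<chi> i. x $ ?\<tau> i))"
        by (simp add: distr_lborel_permute)
      also have "\<dots> = (\<integral>\<^sup>+x. h (?A *v x) \<partial>lborel)"
        by (simp add: nn_integral_distr Av)
      finally show "(\<integral>\<^sup>+x. h (?A *v x) \<partial>lborel) = ennreal (1 / \<bar>det ?A\<bar>) * (\<integral>\<^sup>+x. h x \<partial>lborel)"
        unfolding det by simp
    qed
  next
    fix m n :: 'n assume mn: "m \<noteq> n"
    let ?A = "\<chi> i j. of_bool (i = m \<and> j = n \<or> i = j) :: real^'n^'n"
    have "?A = (\<chi> k. if k = m then row m (mat 1) + 1 *s row n (mat 1) else row k (mat 1))"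
      using mn by (auto simp: vec_eq_iff row_def mat_def)
    then have det: "det ?A = 1"
      using det_row_operation[OF mn, of "mat 1 :: real^'n^'n" 1] by simp
    have Av: "?A *v x = (\<chi> i. if i = m then x $ m + x $ n else x $ i)" for x
    proof -
      have "(\<Sum>j\<in>UNIV. of_bool (i = m \<and> j = n \<or> i = j) * x $ j) = 
         (\<Sum>j\<in>UNIV. (if j = i then x $ i else 0) + (if j = n then if i = m then x $ n else 0 else 0))" for i
        using mn by (intro sum.cong) auto
      then show ?thesis by (simp add: matrix_vector_mult_def sum.distrib vec_eq_iff)
    qed
    show "P ?A" unfolding P_def det Av
      by (auto simp: nn_integral_lborel_shear[OF _ mn])
  qed
  then show ?thesis using assms by (auto simp: P_def)
qed

lemma distr_lborel_matrix:
  fixes A :: "real ^ 'n ^ 'n::finite"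
  assumes det: "det A \<noteq> 0"
  shows "distr lborel borel ((*v) A) = density lborel (\<lambda>_. ennreal (1 / \<bar>det A\<bar>))"
proof (rule measure_eqI)
  fix X assume "X \<in> sets (distr lborel borel ((*v) A))"
  then have [measurable]: "X \<in> sets borel" by simp
  have "emeasure (distr lborel borel ((*v) A)) X = (\<integral>\<^sup>+x. indicator X (A *v x) \<partial>lborel)"
    by (subst nn_integral_indicator[symmetric]) (simp_all add: nn_integral_distr del: nn_integral_indicator)
  then show "emeasure (distr lborel borel ((*v) A)) X = emeasure (density lborel (\<lambda>_. ennreal (1 / \<bar>det A\<bar>))) X"
    using nn_integral_lborel_matrix[OF det, of "indicator X"]
    by (simp add: emeasure_density nn_integral_cmult)
qed simp

text \<open>
  The plane of complex numbers is identified with \<open>real ^ 2\<close>, where multiplication by a unimodular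
  number is a matrix of determinant \<open>1\<close>.
\<close>
lemma distr_lborel_complex_of_vec:
  "distr lborel borel (\<lambda>v::real^2. Complex (v $ 1) (v $ 2)) = lborel"
proof (rule lborel_eqI[symmetric])
  have [measurable]: "(\<lambda>v::real^2. Complex (v $ 1) (v $ 2)) \<in> borel_measurable borel"
    unfolding Complex_eq by measurable
  fix l u :: complex assume le: "\<And>b. b \<in> Basis \<Longrightarrow> l \<bullet> b \<le> u \<bullet> b"
  have eq: "(\<lambda>v::real^2. Complex (v $ 1) (v $ 2)) -` box l u = box (vector [Re l, Im l]) (vector [Re u, Im u])"
    by (auto simp: box_def Basis_vec_def Basis_complex_def inner_axis forall_2)
  have le': "(vector [Re l, Im l] :: real^2) \<bullet> b \<le> vector [Re u, Im u] \<bullet> b" if b: "b \<in> Basis" for b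
  proof -
    obtain i where i: "b = axis i 1" using b by (auto simp: Basis_vec_def Basis_real_def)
    show ?thesis using le[of 1] le[of \<i>] exhaust_2[of i]
      by (elim disjE) (simp_all add: i inner_axis Basis_complex_def)
  qed
  have "emeasure lborel (box (vector [Re l, Im l]) (vector [Re u, Im u] :: real^2)) 
        = ennreal (\<Prod>b\<in>Basis. (u - l) \<bullet> b)"
    using le' by (simp add: emeasure_lborel_box prod_Basis_vec inner_axis Basis_complex_def UNIV_2)
  then show "emeasure (distr lborel borel (\<lambda>v::real^2. Complex (v $ 1) (v $ 2))) (box l u) =
        ennreal (\<Prod>b\<in>Basis. (u - l) \<bullet> b)"
    by (simp add: emeasure_distr eq)
qed simp

lemma distr_lborel_rotation:
  assumes "cmod c = 1"
  shows "distr lborel borel (\<lambda>z. c * z) = lborel"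
proof -
  let ?\<psi> = "\<lambda>v::real^2. Complex (v $ 1) (v $ 2)"
  have [measurable]: "?\<psi> \<in> borel_measurable borel"
    unfolding Complex_eq by measurable
  define A :: "real^2^2" where "A = vector [vector [Re c, - Im c], vector [Im c, Re c]]"
  have det: "det A = 1"
    using assms by (simp add: A_def det_2 cmod_def power2_eq_square)
  have eq: "c * ?\<psi> v = ?\<psi> (A *v v)" for v
    by (simp add: A_def matrix_vector_mult_def sum_2 complex_eq_iff)
  have "distr lborel borel (\<lambda>z. c * z) = distr (distr lborel borel ?\<psi>) borel (\<lambda>z. c * z)"
    by (simp add: distr_lborel_complex_of_vec)
  also have "\<dots> = distr (distr lborel borel ((*v) A)) borel ?\<psi>"
    by (subst (1 2) distr_distr) (simp_all add: comp_def eq)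
  also have "distr lborel borel ((*v) A) = lborel"
    by (simp add: distr_lborel_matrix det density_1)
  finally show ?thesis by (simp add: distr_lborel_complex_of_vec)
qed

section \<open>Radial functions in the plane\<close>

lemma emeasure_lborel_ball_complex: "r \<ge> 0 \<Longrightarrow> emeasure lborel (ball (0::complex) r) = ennreal (pi * r\<^sup>2)"
  using emeasure_ball[of r "0::complex"] unit_ball_vol_even[of 1] by simp

text \<open>
  The disc \<open>{z. a < - ln \<bar>z\<bar>\<^sup>2}\<close> has area \<open>\<pi> exp (- a)\<close>, and these sets determine the
  push-forward. The sign makes the measures of the half-lines \<open>{a<..}\<close> finite.
\<close>
lemma distr_lborel_minus_ln_norm:
  "distr lborel borel (\<lambda>z::complex. - ln ((cmod z)\<^sup>2)) = density lborel (\<lambda>x. ennreal (pi * exp (- x)))"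
proof (rule measure_eqI_lessThan)
  fix a :: real
  have "emeasure (distr lborel borel (\<lambda>z::complex. - ln ((cmod z)\<^sup>2))) {a<..}
     = emeasure lborel {z::complex. a < - ln ((cmod z)\<^sup>2)}"
    by (simp add: emeasure_distr vimage_def)
  also have "\<dots> = emeasure lborel (ball (0::complex) (exp (- a / 2)))"
  proof (rule emeasure_eq_AE)
    have "z \<in> {z. a < - ln ((cmod z)\<^sup>2)} \<longleftrightarrow> z \<in> ball 0 (exp (- a / 2))" if "z \<noteq> 0" for z :: complex
    proof -
      have "a < - ln ((cmod z)\<^sup>2) \<longleftrightarrow> ln (cmod z) < - a / 2"
        using that by (simp add: ln_realpow) linarith
      also have "\<dots> \<longleftrightarrow> cmod z < exp (- a / 2)"
        using that by (metis exp_less_cancel_iff exp_ln zero_less_norm_iff)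
      finally show ?thesis by (simp add: dist_norm)
    qed
    then show "AE z in lborel. z \<in> {z. a < - ln ((cmod z)\<^sup>2)} \<longleftrightarrow> z \<in> ball (0::complex) (exp (- a / 2))"
      using AE_lborel_singleton[of "0::complex"] by auto
  qed (auto intro!: measurable_sets_Collect)
  also have "\<dots> = ennreal (pi * exp (- a))"
    by (subst emeasure_lborel_ball_complex) (auto simp: exp_double[symmetric])
  finally have 1: "emeasure (distr lborel borel (\<lambda>z::complex. - ln ((cmod z)\<^sup>2))) {a<..} = ennreal (pi * exp (- a))" .
  have "emeasure (density lborel (\<lambda>x. ennreal (pi * exp (- x)))) {a<..} = 
      (\<integral>\<^sup>+x. ennreal (pi * exp (- x)) * indicator {a<..} x \<partial>lborel)"
    by (simp add: emeasure_density)
  also have "\<dots> = (\<integral>\<^sup>+x. ennreal (pi * exp (- x)) * indicator {a..} x \<partial>lborel)"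
    by (intro nn_integral_cong_AE eventually_mono[OF AE_lborel_singleton[of a]])
       (auto split: split_indicator)
  also have "\<dots> = ennreal (0 - (- pi * exp (- a)))"
  proof (rule nn_integral_FTC_atLeast)
    show "((\<lambda>x. - pi * exp (- x)) \<longlongrightarrow> 0) at_top"
      by real_asymp
  qed (auto intro!: derivative_eq_intros)
  finally have 2: "emeasure (density lborel (\<lambda>x. ennreal (pi * exp (- x)))) {a<..} = ennreal (pi * exp (- a))"
    by simp
  show "emeasure (distr lborel borel (\<lambda>z::complex. - ln ((cmod z)\<^sup>2))) {a<..}
    = emeasure (density lborel (\<lambda>x. ennreal (pi * exp (- x)))) {a<..}"
    using 1 2 by simp
  show "emeasure (distr lborel borel (\<lambda>z::complex. - ln ((cmod z)\<^sup>2))) {a<..} < \<infinity>"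
    using 1 by simp
qed auto

text \<open>
  The squared modulus is uniformly distributed on the disc, since the area of a disc of radius
  \<open>r\<close> is \<open>\<pi> r\<^sup>2\<close>.
\<close>
lemma nn_integral_disc_radial:
  fixes g :: "real \<Rightarrow> ennreal"
  assumes [measurable]: "g \<in> borel_measurable borel"
  shows "(\<integral>\<^sup>+(z::complex). indicator {z. cmod z < 1} z * g ((cmod z)\<^sup>2) \<partial>lborel)
       = ennreal pi * (\<integral>\<^sup>+t. indicator {0<..<1} t * g t \<partial>lborel)"
proof -
  have 1: "distr (density lborel (indicator {z::complex. cmod z < 1})) borel (\<lambda>z. (cmod z)\<^sup>2) =
      density lborel (\<lambda>t. ennreal pi * indicator {0<..<1} t)" (is "?M = ?N")
  proof (rule measure_eqI_lessThan)
    fix a :: real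
    define b where "b = max 0 (min a 1)"
    have b: "0 \<le> b" "b \<le> 1" by (auto simp: b_def)
    have "emeasure ?M {a<..} = emeasure lborel {z::complex. cmod z < 1 \<and> a < (cmod z)\<^sup>2}"
      by (simp add: emeasure_distr emeasure_density indicator_inter_arith[symmetric] vimage_def Int_def)
    also have "\<dots> = emeasure lborel (ball (0::complex) 1 - cball 0 (sqrt b))"
    proof (rule emeasure_eq_AE)
      have "z \<in> {z. cmod z < 1 \<and> a < (cmod z)\<^sup>2} \<longleftrightarrow> z \<in> ball 0 1 - cball 0 (sqrt b)" if "z \<noteq> 0" for z :: complex
      proof (cases "cmod z < 1")
        case True
        then have "(cmod z)\<^sup>2 < 1" by (simp add: power_less_one_iff)
        moreover have "0 < (cmod z)\<^sup>2" using that by simp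
        moreover have "sqrt b < cmod z \<longleftrightarrow> b < (cmod z)\<^sup>2"
          by (metis b(1) norm_ge_zero real_less_lsqrt real_less_rsqrt real_sqrt_abs real_sqrt_less_iff abs_of_nonneg)
        ultimately show ?thesis using True by (auto simp: b_def)
      qed auto
      then show "AE z in lborel. z \<in> {z. cmod z < 1 \<and> a < (cmod z)\<^sup>2} \<longleftrightarrow> z \<in> ball (0::complex) 1 - cball 0 (sqrt b)"
        using AE_lborel_singleton[of "0::complex"] by auto
    qed (auto intro!: measurable_sets_Collect)
    also have "\<dots> = ennreal pi - ennreal (pi * b)"
    proof -
      have "emeasure lborel (cball (0::complex) (sqrt b)) = ennreal (pi * b)"
        using emeasure_cball[of "sqrt b" "0::complex"] unit_ball_vol_even[of 1] b by simp
      moreover have "cball (0::complex) 1 \<inter> ball 0 1 = ball 0 1" by auto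
      moreover have [simp]: "ball (0::complex) 1 - cball 0 1 = {}" by auto
      moreover have "cball (0::complex) (sqrt b) \<subseteq> ball 0 1" if "b \<noteq> 1"
        using b that real_sqrt_lt_1_iff[of b] by (auto simp: dist_norm simp del: real_sqrt_lt_1_iff intro: le_less_trans)
      ultimately show ?thesis
        by (cases "b = 1") (use emeasure_lborel_ball_complex[of 1] b in \<open>simp_all add: emeasure_Diff\<close>)
    qed
    finally have M: "emeasure ?M {a<..} = ennreal (pi - pi * b)"
      using b by (simp add: ennreal_minus)
    have "emeasure ?N {a<..} = ennreal pi * emeasure lborel ({0<..<1} \<inter> {a<..})"
      by (simp add: emeasure_density mult.assoc nn_integral_cmult indicator_inter_arith[symmetric])
    also have "{0<..<1} \<inter> {a<..} = {b<..<1}" by (auto simp: b_def)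
    also have "ennreal pi * emeasure lborel {b<..<1} = ennreal (pi - pi * b)"
      using b by (simp add: ennreal_mult'[symmetric] algebra_simps)
    finally have N: "emeasure ?N {a<..} = ennreal (pi - pi * b)" .
    show "emeasure ?M {a<..} = emeasure ?N {a<..}" "emeasure ?M {a<..} < \<infinity>"
      using M N by simp_all
  qed auto
  have "(\<integral>\<^sup>+(z::complex). indicator {z. cmod z < 1} z * g ((cmod z)\<^sup>2) \<partial>lborel) = (\<integral>\<^sup>+t. g t \<partial>?M)"
    by (simp add: nn_integral_distr nn_integral_density)
  also have "\<dots> = (\<integral>\<^sup>+t. g t \<partial>?N)" by (simp only: 1)
  also have "\<dots> = ennreal pi * (\<integral>\<^sup>+t. indicator {0<..<1} t * g t \<partial>lborel)"
    by (simp add: nn_integral_density mult.assoc nn_integral_cmult)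
  finally show ?thesis .
qed

section \<open>Laurent monomials and the torus action\<close>

definition laurent_monomial :: "complex ^ 'n::finite \<Rightarrow> int ^ 'n \<Rightarrow> complex" where
  "laurent_monomial z \<alpha> = (\<Prod>k\<in>UNIV. z $ k powi (\<alpha> $ k))"

definition complex_torus :: "(complex ^ 'n::finite) set" where
  "complex_torus = {z. \<forall>k. z $ k \<noteq> 0}"

definition punctured_polydisc :: "(complex ^ 'n::finite) set" where
  "punctured_polydisc = {z. \<forall>k. z $ k \<noteq> 0 \<and> cmod (z $ k) < 1}"

text \<open>
  The torus acts through the arguments of a point \<open>v\<close> with nonzero coordinates. Averaging over the
  torus can then be expressed by Lebesgue measure on the polydisc.
\<close>
definition torus_rotate :: "complex ^ 'n \<Rightarrow> complex ^ 'n \<Rightarrow> complex ^ 'n::finite" where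
  "torus_rotate v w = (\<chi> k. sgn (v $ k) * w $ k)"

text \<open>
  Logarithmic coordinates of the moduli. The punctured polydisc is the positive orthant, and
  monomial maps become linear.
\<close>
definition log_moduli :: "complex ^ 'n \<Rightarrow> real ^ 'n::finite" where
  "log_moduli z = (\<chi> k. - ln ((cmod (z $ k))\<^sup>2))"

lemma measurable_power_int [measurable]:
  fixes f :: "'a \<Rightarrow> complex"
  assumes [measurable]: "f \<in> borel_measurable M"
  shows "(\<lambda>x. f x powi n) \<in> borel_measurable M"
  unfolding power_int_def by (cases "0 \<le> n") simp_all

lemma measurable_laurent_monomial [measurable]:
  "f \<in> borel_measurable M \<Longrightarrow> (\<lambda>x. laurent_monomial (f x) \<alpha>) \<in> borel_measurable M"
  unfolding laurent_monomial_def by measurable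

lemma measurable_torus_rotate [measurable]:
  assumes [measurable]: "f \<in> borel_measurable M" "g \<in> borel_measurable M"
  shows "(\<lambda>x. torus_rotate (f x) (g x)) \<in> borel_measurable M"
proof -
  have [measurable]: "(sgn :: complex \<Rightarrow> complex) \<in> borel_measurable borel"
    unfolding complex_sgn_def[abs_def] sgn_div_norm by measurable
  show ?thesis unfolding torus_rotate_def by measurable
qed

lemma measurable_log_moduli [measurable]: "log_moduli \<in> borel_measurable borel"
  unfolding log_moduli_def[abs_def] by measurable

lemma measurable_complex_torus [measurable]: "complex_torus \<in> sets borel"
proof -
  have "{z \<in> space borel. \<forall>k. z $ k \<noteq> 0} \<in> sets (borel :: (complex ^ 'n) measure)"
    by measurable
  then show ?thesis by (simp add: complex_torus_def)
qed

lemma measurable_punctured_polydisc [measurable]: "punctured_polydisc \<in> sets borel"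
proof -
  have "{z \<in> space borel. \<forall>k. z $ k \<noteq> 0 \<and> cmod (z $ k) < 1} \<in> sets (borel :: (complex ^ 'n) measure)"
    by measurable
  then show ?thesis by (simp add: punctured_polydisc_def)
qed

lemma laurent_monomial_mult_vec:
  "laurent_monomial (\<chi> k. z $ k * w $ k) \<alpha> = laurent_monomial z \<alpha> * laurent_monomial w \<alpha>"
  by (simp add: laurent_monomial_def power_int_mult_distrib prod.distrib)

lemma laurent_monomial_cnj: "laurent_monomial (\<chi> k. cnj (z $ k)) \<alpha> = cnj (laurent_monomial z \<alpha>)"
  by (simp add: laurent_monomial_def)

lemma laurent_monomial_nonzero: "z \<in> complex_torus \<Longrightarrow> laurent_monomial z \<alpha> \<noteq> 0"
  by (simp add: laurent_monomial_def complex_torus_def power_int_eq_0_iff)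

lemma cmod_laurent_monomial: "cmod (laurent_monomial z \<alpha>) = (\<Prod>k\<in>UNIV. cmod (z $ k) powi \<alpha> $ k)"
  by (simp add: laurent_monomial_def prod_norm[symmetric] norm_power_int)

lemma exp_powi: "exp (x::'a::{real_normed_field,banach}) powi n = exp (of_int n * x)"
  by (simp add: exp_power_int)

lemma cmod_laurent_monomial_exp:
  assumes "z \<in> complex_torus"
  shows "cmod (laurent_monomial z \<alpha>) = exp (- (\<Sum>k\<in>UNIV. of_int (\<alpha> $ k) * log_moduli z $ k) / 2)"
proof -
  have "cmod (z $ k) powi \<alpha> $ k = exp (- (of_int (\<alpha> $ k) * log_moduli z $ k) / 2)" for k
  proof -
    have "cmod (z $ k) = exp (- log_moduli z $ k / 2)"
      using assms by (simp add: log_moduli_def complex_torus_def ln_realpow)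
    then show ?thesis by (simp add: exp_power_int)
  qed
  then show ?thesis
    by (simp add: cmod_laurent_monomial exp_sum[symmetric] sum_negf sum_divide_distrib[symmetric])
qed

text \<open>
  Points with a zero coordinate can be ignored in all integrals.
\<close>
lemma AE_complex_torus: "AE z in lborel. z \<in> (complex_torus :: (complex ^ 'n::finite) set)"
proof -
  have "AE z in (lborel :: (complex ^ 'n) measure). z $ k \<noteq> 0" for k
  proof -
    have "emeasure lborel {z :: complex ^ 'n. z $ k = 0} = (\<integral>\<^sup>+z. indicator {z :: complex ^ 'n. z $ k = 0} z \<partial>lborel)"
      by (rule nn_integral_indicator[symmetric]) simp
    also have "\<dots> = (\<integral>\<^sup>+(z :: complex ^ 'n). (\<Prod>i\<in>UNIV. if i = k then indicator {0} (z $ i) else 1) \<partial>lborel)"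
      by (rule arg_cong[where f="nn_integral lborel"]) (simp add: fun_eq_iff indicator_def)
    also have "\<dots> = (\<Prod>i\<in>UNIV. \<integral>\<^sup>+z. (if i = k then indicator {0::complex} z else 1) \<partial>lborel)"
      by (rule nn_integral_lborel_vec_prod[of "\<lambda>i z. if i = k then indicator {0::complex} z else 1"]) measurable
    also have "\<dots> = 0" by (rule prod_zero) (auto intro!: bexI[of _ k] exI[of _ k])
    finally have "{z :: complex ^ 'n. z $ k = 0} \<in> null_sets lborel" by auto
    then show ?thesis by (rule AE_I') auto
  qed
  then show ?thesis unfolding complex_torus_def by (simp add: AE_all_countable)
qed

lemma distr_torus_rotate:
  assumes "v \<in> complex_torus"
  shows "distr lborel borel (torus_rotate v) = lborel"
proof -
  have "distr lborel borel (\<lambda>w. \<chi> i. sgn (v $ i) * w $ i) = density lborel (\<lambda>x. \<Prod>i\<in>(UNIV::'a set). 1)"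
    using assms by (intro distr_lborel_componentwise)
      (simp_all add: distr_lborel_rotation complex_torus_def norm_sgn density_1)
  then show ?thesis by (simp add: torus_rotate_def[abs_def] density_1)
qed

lemma distr_unimodular:
  assumes "\<And>k. cmod (c $ k) = 1"
  shows "distr lborel borel (\<lambda>w. \<chi> k. c $ k * w $ k) = (lborel :: (complex ^ 'n::finite) measure)"
proof -
  have "distr lborel borel (\<lambda>w. \<chi> i. c $ i * w $ i) = density lborel (\<lambda>x. \<Prod>i\<in>(UNIV::'n set). 1)"
    using assms by (intro distr_lborel_componentwise)
      (simp_all add: distr_lborel_rotation complex_torus_def norm_sgn density_1)
  then show ?thesis by (simp add: density_1)
qed

lemma nn_integral_unimodular:
  assumes "\<And>k. cmod (c $ k) = 1" and [measurable]: "H \<in> borel_measurable borel"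
  shows "(\<integral>\<^sup>+w. H (\<chi> k. c $ k * w $ k) \<partial>lborel) = (\<integral>\<^sup>+w. H w \<partial>(lborel :: (complex ^ 'n::finite) measure))"
proof -
  have "(\<integral>\<^sup>+w. H w \<partial>lborel) = (\<integral>\<^sup>+w. H w \<partial>distr lborel borel (\<lambda>w. \<chi> k. c $ k * w $ k))"
    by (simp add: distr_unimodular[OF assms(1)])
  then show ?thesis by (simp add: nn_integral_distr)
qed

lemma nn_integral_log_moduli:
  assumes [measurable]: "h \<in> borel_measurable borel"
  shows "(\<integral>\<^sup>+z. h (log_moduli z) \<partial>lborel) =
     (\<integral>\<^sup>+x. ennreal (pi ^ CARD('n) * exp (- (\<Sum>k\<in>UNIV. x $ k))) * h x \<partial>(lborel :: (real ^ 'n::finite) measure))"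
proof -
  have "distr lborel borel (\<lambda>z. \<chi> k. - ln ((cmod (z $ k))\<^sup>2)) = 
      density lborel (\<lambda>x. \<Prod>k\<in>(UNIV::'n set). ennreal (pi * exp (- x $ k)))"
    by (rule distr_lborel_componentwise) (simp_all add: distr_lborel_minus_ln_norm)
  then have "distr lborel borel log_moduli = density lborel (\<lambda>x::real^'n. ennreal (pi ^ CARD('n) * exp (- (\<Sum>k\<in>UNIV. x $ k))))"
    by (simp add: log_moduli_def[abs_def] prod_ennreal prod.distrib exp_sum sum_negf[symmetric])
  then have "(\<integral>\<^sup>+x. h x \<partial>distr lborel borel log_moduli) = (\<integral>\<^sup>+x. h x \<partial>density lborel (\<lambda>x::real^'n. ennreal (pi ^ CARD('n) * exp (- (\<Sum>k\<in>UNIV. x $ k)))))"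
    by simp
  then show ?thesis by (simp add: nn_integral_distr nn_integral_density)
qed

lemma emeasure_punctured_polydisc:
  "emeasure lborel (punctured_polydisc :: (complex ^ 'n::finite) set) = ennreal (pi ^ CARD('n))"
proof -
  have "emeasure lborel (punctured_polydisc :: (complex ^ 'n) set) = 
     (\<integral>\<^sup>+z. indicator punctured_polydisc z \<partial>(lborel :: (complex ^ 'n) measure))"
    by simp
  also have "\<dots> = (\<integral>\<^sup>+z. (\<Prod>i\<in>UNIV. indicator (ball 0 1 - {0}) (z $ i)) \<partial>(lborel :: (complex ^ 'n) measure))"
    by (intro nn_integral_cong) (auto simp: indicator_def punctured_polydisc_def)
  also have "\<dots> = (\<Prod>i\<in>(UNIV::'n set). \<integral>\<^sup>+z. indicator (ball 0 1 - {0::complex}) z \<partial>lborel)"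
    by (rule nn_integral_lborel_vec_prod, rule borel_measurable_indicator) auto
  also have "(\<integral>\<^sup>+z. indicator (ball 0 1 - {0::complex}) z \<partial>lborel) = ennreal pi"
    using emeasure_lborel_ball_complex[of 1] by (simp add: emeasure_Diff)
  finally show ?thesis by (simp add: ennreal_power)
qed


section \<open>The monomial covering of a region\<close>

lemma prod_power_int:
  fixes x :: "'a::field"
  assumes "x \<noteq> 0" "finite S"
  shows "(\<Prod>k\<in>S. x powi f k) = x powi (\<Sum>k\<in>S. f k)"
  using assms(2,1) by induction (simp_all add: power_int_add)

lemma prod_power_int_distrib:
  fixes f :: "'b \<Rightarrow> 'a::field"
  assumes "finite S"
  shows "(\<Prod>k\<in>S. f k) powi m = (\<Prod>k\<in>S. f k powi m)"
  using assms by induction (simp_all add: power_int_mult_distrib)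

lemma punctured_subset_torus: "y \<in> punctured_polydisc \<Longrightarrow> y \<in> complex_torus"
  by (simp add: punctured_polydisc_def complex_torus_def)

lemma power_int_less_one_iff:
  assumes "0 < d'" "c \<noteq> 0"
  shows "cmod c powi d' < 1 \<longleftrightarrow> cmod c < 1"
proof -
  obtain m where "d' = int m" "m > 0" using assms(1) by (metis zero_less_imp_eq_int)
  then show ?thesis using assms(2) by (simp add: power_less_one_iff)
qed

text \<open>
  The columns of \<open>A\<close> are the exponents of a monomial map onto the region defined by \<open>B\<close>. It suffices
  that the product \<open>B A\<close> is diagonal; in the application \<open>d j\<close> is \<open>det B\<close> divided by the gcd of
  the \<open>j\<close>-th column of the adjugate.
\<close>
locale monomial_cover =
  fixes B A :: "int ^ 'n ^ 'n::finite" and d :: "'n \<Rightarrow> int"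
  assumes d_pos: "d j > 0"
    and A_nonneg: "A $ i $ j \<ge> 0"
    and BA: "B ** A = (\<chi> i j. if i = j then d i else 0)"
begin

definition column_sum :: "'n \<Rightarrow> int" where
  "column_sum j = (\<Sum>i\<in>UNIV. A $ i $ j)"

definition cover :: "complex ^ 'n \<Rightarrow> complex ^ 'n" where
  "cover y = (\<chi> k. laurent_monomial y (A $ k))"

text \<open>
  A right inverse of \<open>cover\<close>, defined with principal logarithms.
\<close>
definition lift :: "complex ^ 'n \<Rightarrow> complex ^ 'n" where
  "lift z = (\<chi> j. exp (\<Sum>k\<in>UNIV. of_int (B $ j $ k) * Ln (z $ k) / of_int (d j)))"

definition region :: "(complex ^ 'n) set" where
  "region = monomial_region B \<inter> complex_torus"

text \<open>
  The Jacobian determinant of \<open>cover\<close>, divided by the constant \<open>det A\<close>.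
\<close>
definition jac :: "complex ^ 'n \<Rightarrow> complex" where
  "jac y = laurent_monomial y (\<chi> j. column_sum j - 1)"

definition real_A :: "real ^ 'n ^ 'n" where
  "real_A = (\<chi> i j. of_int (A $ i $ j))"

lemma BA_entry: "(\<Sum>k\<in>UNIV. B $ i $ k * A $ k $ j) = (if i = j then d i else 0)"
  using arg_cong[OF BA, of "\<lambda>M. M $ i $ j"] by (simp add: matrix_matrix_mult_def)

text \<open>
  For square matrices a left inverse is a right inverse. This form of the hypothesis \<open>B A = diag d\<close>
  gives the surjectivity of \<open>cover\<close> and the deck transformations.
\<close>
lemma AB_matrix: "real_A ** (\<chi> j k. of_int (B $ j $ k) / of_int (d j)) = mat 1"
proof -
  have "(\<chi> j k. of_int (B $ j $ k) / of_int (d j)) ** real_A = mat 1"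
  proof -
    have "(\<Sum>k\<in>UNIV. of_int (B $ i $ k) / of_int (d i) * real_of_int (A $ k $ j)) = (if i = j then 1 else 0)" for i j
    proof -
      have "(\<Sum>k\<in>UNIV. of_int (B $ i $ k) / of_int (d i) * real_of_int (A $ k $ j)) = 
          real_of_int (\<Sum>k\<in>UNIV. B $ i $ k * A $ k $ j) / of_int (d i)"
        by (simp add: sum_divide_distrib)
      then show ?thesis using d_pos[of i] unfolding BA_entry by auto
    qed
    then show ?thesis by (simp add: matrix_matrix_mult_def real_A_def mat_def vec_eq_iff)
  qed
  then show ?thesis by (simp add: matrix_left_right_inverse)
qed

lemma AB_entry: "(\<Sum>j\<in>UNIV. of_int (A $ i $ j) * (of_int (B $ j $ k) / of_int (d j))) = (if i = k then 1 else 0 :: real)"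
  using arg_cong[OF AB_matrix, of "\<lambda>M. M $ i $ k"] by (simp add: matrix_matrix_mult_def real_A_def mat_def)

lemma AB_entry_complex:
  "(\<Sum>j\<in>UNIV. of_int (A $ i $ j) * (of_int (B $ j $ k) / of_int (d j))) = (if i = k then 1 else 0 :: complex)"
  using arg_cong[OF AB_entry, of complex_of_real i k] by (simp split: if_splits)

lemma det_real_A: "det real_A \<noteq> 0"
  using AB_matrix invertible_det_nz[of real_A] invertible_right_inverse[of real_A] by auto

text \<open>
  A zero column of \<open>A\<close> would make the corresponding column of \<open>diag d\<close> vanish.
\<close>
lemma column_sum_pos: "column_sum j \<ge> 1"
proof -
  have "\<exists>i. A $ i $ j \<noteq> 0"
  proof (rule ccontr)
    assume "\<not> ?thesis"
    then have "(\<Sum>k\<in>UNIV. B $ j $ k * A $ k $ j) = 0" by simp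
    then show False using BA_entry[of j j] d_pos[of j] by simp
  qed
  then obtain i where "A $ i $ j \<noteq> 0" by auto
  then have "1 \<le> A $ i $ j" using A_nonneg[of i j] by simp
  also have "\<dots> \<le> column_sum j" unfolding column_sum_def
    by (rule member_le_sum) (use A_nonneg in auto)
  finally show ?thesis .
qed

lemma laurent_monomial_cover:
  assumes "y \<in> complex_torus"
  shows "laurent_monomial (cover y) \<alpha> = laurent_monomial y (\<chi> j. \<Sum>k\<in>UNIV. \<alpha> $ k * A $ k $ j)"
proof -
  have "laurent_monomial (cover y) \<alpha> = (\<Prod>k\<in>UNIV. \<Prod>j\<in>UNIV. y $ j powi (\<alpha> $ k * A $ k $ j))"
    by (simp add: laurent_monomial_def cover_def prod_power_int_distrib power_int_mult[symmetric] mult.commute)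
  also have "\<dots> = (\<Prod>j\<in>UNIV. \<Prod>k\<in>UNIV. y $ j powi (\<alpha> $ k * A $ k $ j))"
    by (rule prod.swap)
  also have "\<dots> = (\<Prod>j\<in>UNIV. y $ j powi (\<Sum>k\<in>UNIV. \<alpha> $ k * A $ k $ j))"
    using assms by (intro prod.cong refl prod_power_int) (auto simp: complex_torus_def)
  finally show ?thesis by (simp add: laurent_monomial_def)
qed

lemma laurent_monomial_cover_row:
  assumes "y \<in> complex_torus"
  shows "laurent_monomial (cover y) (B $ j) = y $ j powi d j"
proof -
  have "laurent_monomial (cover y) (B $ j) = (\<Prod>i\<in>UNIV. y $ i powi (if i = j then d j else 0))"
    unfolding laurent_monomial_cover[OF assms] BA_entry
    by (auto simp: laurent_monomial_def intro!: prod.cong)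
  also have "\<dots> = (\<Prod>i\<in>UNIV. if i = j then y $ j powi d j else 1)"
    by (intro prod.cong) auto
  finally show ?thesis by simp
qed

lemma region_iff: "z \<in> region \<longleftrightarrow> z \<in> complex_torus \<and> (\<forall>j. cmod (laurent_monomial z (B $ j)) < 1)"
  by (auto simp: region_def monomial_region_def complex_torus_def cmod_laurent_monomial)

lemma cover_in_torus: "y \<in> complex_torus \<Longrightarrow> cover y \<in> complex_torus"
  by (simp add: cover_def complex_torus_def laurent_monomial_nonzero)

lemma cover_in_region_iff:
  assumes "y \<in> complex_torus"
  shows "cover y \<in> region \<longleftrightarrow> y \<in> punctured_polydisc"
  using assms cover_in_torus[OF assms] unfolding region_iff laurent_monomial_cover_row[OF assms]
  by (auto simp: norm_power_int power_int_less_one_iff d_pos complex_torus_def punctured_polydisc_def)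

lemma lift_in_torus: "lift z \<in> complex_torus"
  by (simp add: lift_def complex_torus_def)

lemma cover_lift:
  assumes "z \<in> complex_torus"
  shows "cover (lift z) = z"
proof -
  have "laurent_monomial (lift z) (A $ i) = z $ i" for i
  proof -
    have "laurent_monomial (lift z) (A $ i) = exp (\<Sum>j\<in>UNIV. of_int (A $ i $ j) * (\<Sum>k\<in>UNIV. of_int (B $ j $ k) * Ln (z $ k) / of_int (d j)))"
      unfolding laurent_monomial_def lift_def vec_lambda_beta exp_powi by (rule exp_sum[symmetric]) simp
    also have "(\<Sum>j\<in>UNIV. of_int (A $ i $ j) * (\<Sum>k\<in>UNIV. of_int (B $ j $ k) * Ln (z $ k) / of_int (d j))) = 
       (\<Sum>k\<in>UNIV. (\<Sum>j\<in>UNIV. of_int (A $ i $ j) * (of_int (B $ j $ k) / of_int (d j))) * Ln (z $ k))"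
      unfolding sum_distrib_left sum_distrib_right by (subst sum.swap) (simp add: mult_ac)
    also have "\<dots> = (\<Sum>k\<in>UNIV. if i = k then Ln (z $ k) else 0)"
      unfolding AB_entry_complex by (intro sum.cong) auto
    finally show ?thesis using assms by (simp add: complex_torus_def)
  qed
  then show ?thesis by (simp add: cover_def vec_eq_iff)
qed

text \<open>
  Surjectivity follows from \<open>cover_lift\<close>; that \<open>lift z\<close> lies in the polydisc is the condition that
  defines the region, since the \<open>j\<close>-th monomial of the region pulls back to a power of \<open>y $ j\<close>.
\<close>
lemma cover_surj:
  assumes "z \<in> region"
  obtains y where "y \<in> punctured_polydisc" "cover y = z"
proof -
  have z: "z \<in> complex_torus" using assms by (simp add: region_iff)
  show ?thesis using assms cover_in_region_iff[OF lift_in_torus, of z]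
    by (intro that[of "lift z"]) (simp_all add: cover_lift[OF z])
qed

lemma cover_mult: "cover (\<chi> k. c $ k * y $ k) = (\<chi> k. cover c $ k * cover y $ k)"
  by (simp add: cover_def laurent_monomial_mult_vec)

text \<open>
  Hence every rotation of the region lifts to a rotation of the polydisc.
\<close>
lemma cmod_lift_unimodular:
  assumes "\<And>k. cmod (v $ k) = 1"
  shows "cmod (lift v $ j) = 1"
proof -
  have "Re (Ln (v $ k)) = 0" for k
    using assms[of k] by (subst Re_Ln) (auto simp: norm_eq_zero)
  then have "Re (\<Sum>k\<in>UNIV. of_int (B $ j $ k) * Ln (v $ k) / of_int (d j)) = 0"
  proof -
    have "of_int (B $ j $ k) * Ln (v $ k) / of_int (d j) = of_real (of_int (B $ j $ k) / of_int (d j)) * Ln (v $ k)" for k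
      by simp
    then show ?thesis using \<open>\<And>k. Re (Ln (v $ k)) = 0\<close> by (simp del: of_real_divide of_real_of_int_eq)
  qed
  then show ?thesis by (simp add: lift_def)
qed

lemma measurable_cover [measurable]: "cover \<in> borel_measurable borel"
  unfolding cover_def[abs_def] by measurable

lemma measurable_jac [measurable]: "jac \<in> borel_measurable borel"
  unfolding jac_def[abs_def] by measurable

lemma measurable_region [measurable]: "region \<in> sets borel"
proof -
  have "{z \<in> space borel. z \<in> complex_torus \<and> (\<forall>j. cmod (laurent_monomial z (B $ j)) < 1)} \<in> sets (borel :: (complex^'n) measure)"
    by measurable
  then show ?thesis by (simp add: region_iff[symmetric])
qed

lemma log_moduli_cover:
  assumes "y \<in> complex_torus"
  shows "log_moduli (cover y) = real_A *v log_moduli y"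
proof -
  have "log_moduli (cover y) $ i = (\<Sum>j\<in>UNIV. of_int (A $ i $ j) * log_moduli y $ j)" for i
  proof -
    have "log_moduli (cover y) $ i = - ln ((cmod (laurent_monomial y (A $ i)))\<^sup>2)"
      by (simp add: log_moduli_def cover_def)
    then show ?thesis
      by (simp add: cmod_laurent_monomial_exp[OF assms] exp_double[symmetric])
  qed
  then show ?thesis by (simp add: vec_eq_iff real_A_def matrix_vector_mult_def)
qed

lemma region_iff_log_moduli:
  assumes "z \<in> complex_torus"
  shows "z \<in> region \<longleftrightarrow> (\<forall>j. 0 < (\<Sum>k\<in>UNIV. of_int (B $ j $ k) * log_moduli z $ k))"
  using assms by (simp add: region_iff cmod_laurent_monomial_exp)

lemma row_real_A: "(\<Sum>k\<in>UNIV. of_int (B $ j $ k) * (real_A *v x) $ k) = of_int (d j) * x $ j"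
proof -
  have "(\<Sum>k\<in>UNIV. of_int (B $ j $ k) * (real_A *v x) $ k) = 
      (\<Sum>i\<in>UNIV. of_int (\<Sum>k\<in>UNIV. B $ j $ k * A $ k $ i) * x $ i)"
    unfolding matrix_vector_mult_def real_A_def vec_lambda_beta of_int_sum sum_distrib_left sum_distrib_right
    by (subst sum.swap) (simp add: mult_ac)
  also have "\<dots> = (\<Sum>i\<in>UNIV. if j = i then of_int (d j) * x $ j else 0)"
    unfolding BA_entry by (intro sum.cong) auto
  finally show ?thesis by simp
qed

lemma sum_real_A: "(\<Sum>k\<in>UNIV. (real_A *v x) $ k) = (\<Sum>j\<in>UNIV. of_int (column_sum j) * x $ j)"
  unfolding matrix_vector_mult_def real_A_def vec_lambda_beta column_sum_def of_int_sum sum_distrib_right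
  by (subst sum.swap) simp

lemma cmod_jac_exp:
  assumes "y \<in> complex_torus"
  shows "(cmod (jac y))\<^sup>2 = exp (- (\<Sum>j\<in>UNIV. of_int (column_sum j - 1) * log_moduli y $ j))"
  using assms by (simp add: jac_def cmod_laurent_monomial_exp exp_double[symmetric])

section \<open>Change of variables for the covering\<close>

text \<open>
  In logarithmic coordinates \<open>cover\<close> is the linear map \<open>A\<close>, and \<open>B A = diag d\<close> shows that it carries
  the positive orthant onto the image of the region. The weights match because
  \<open>\<Sum>\<^sub>k (A x)\<^sub>k = \<Sum>\<^sub>j s\<^sub>j x\<^sub>j\<close>.
\<close>
lemma change_of_variables_radial:
  assumes [measurable]: "h \<in> borel_measurable borel"
  shows "(\<integral>\<^sup>+z. indicator region z * h (log_moduli z) \<partial>lborel) =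
     ennreal \<bar>det real_A\<bar> * (\<integral>\<^sup>+y. indicator punctured_polydisc y * (ennreal ((cmod (jac y))\<^sup>2) * h (log_moduli (cover y))) \<partial>lborel)"
proof -
  define P where "P = {x. \<forall>j. 0 < (\<Sum>k\<in>UNIV. of_int (B $ j $ k) * x $ k :: real)}"
  define Q where "Q = {x::real^'n. \<forall>j. 0 < x $ j}"
  have "{x \<in> space borel. \<forall>j. 0 < (\<Sum>k\<in>UNIV. of_int (B $ j $ k) * x $ k :: real)} \<in> sets (borel :: (real^'n) measure)"
    by measurable
  then have P [measurable]: "P \<in> sets borel" by (simp add: P_def)
  have "{x \<in> space borel. \<forall>j. 0 < x $ j} \<in> sets (borel :: (real^'n) measure)"
    by measurable
  then have Q [measurable]: "Q \<in> sets borel" by (simp add: Q_def)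
  have PQ: "real_A *v x \<in> P \<longleftrightarrow> x \<in> Q" for x
  proof -
    have "0 < of_int (d j) * x $ j \<longleftrightarrow> 0 < x $ j" for j
      using d_pos[of j] by (simp add: zero_less_mult_iff)
    then show ?thesis by (simp add: P_def Q_def row_real_A)
  qed
  define g where "g x = ennreal (pi ^ CARD('n) * exp (- (\<Sum>k\<in>UNIV. x $ k))) * (indicator P x * h x)" for x :: "real^'n"
  have [measurable]: "g \<in> borel_measurable borel" unfolding g_def[abs_def] by measurable
  have "(\<integral>\<^sup>+z. indicator region z * h (log_moduli z) \<partial>lborel) = (\<integral>\<^sup>+z. indicator P (log_moduli z) * h (log_moduli z) \<partial>lborel)"
    by (intro nn_integral_cong_AE eventually_mono[OF AE_complex_torus])
       (simp add: indicator_def region_iff_log_moduli P_def)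
  also have "\<dots> = (\<integral>\<^sup>+x. g x \<partial>lborel)"
    unfolding g_def by (rule nn_integral_log_moduli) measurable
  also have "\<dots> = ennreal \<bar>det real_A\<bar> * (ennreal (1 / \<bar>det real_A\<bar>) * (\<integral>\<^sup>+x. g x \<partial>lborel))"
    using det_real_A by (simp add: mult.assoc[symmetric] ennreal_mult'[symmetric])
  also have "ennreal (1 / \<bar>det real_A\<bar>) * (\<integral>\<^sup>+x. g x \<partial>lborel) = (\<integral>\<^sup>+x. g (real_A *v x) \<partial>lborel)"
    by (rule nn_integral_lborel_matrix[symmetric, OF det_real_A]) measurable
  also have "\<dots> = (\<integral>\<^sup>+x. ennreal (pi ^ CARD('n) * exp (- (\<Sum>k\<in>UNIV. x $ k))) * 
        (indicator Q x * (ennreal (exp (- (\<Sum>j\<in>UNIV. of_int (column_sum j - 1) * x $ j))) * h (real_A *v x))) \<partial>lborel)"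
  proof (intro nn_integral_cong)
    fix x :: "real^'n"
    have "exp (- (\<Sum>k\<in>UNIV. (real_A *v x) $ k)) = exp (- (\<Sum>k\<in>UNIV. x $ k)) * exp (- (\<Sum>j\<in>UNIV. of_int (column_sum j - 1) * x $ j))"
      unfolding exp_add[symmetric] sum_real_A
      by (simp add: sum_negf[symmetric] sum.distrib[symmetric] algebra_simps)
    then show "g (real_A *v x) = ennreal (pi ^ CARD('n) * exp (- (\<Sum>k\<in>UNIV. x $ k))) * 
        (indicator Q x * (ennreal (exp (- (\<Sum>j\<in>UNIV. of_int (column_sum j - 1) * x $ j))) * h (real_A *v x)))"
      by (simp add: g_def PQ[unfolded indicator_def] indicator_def ennreal_mult mult_ac)
  qed
  also have "\<dots> = (\<integral>\<^sup>+y. indicator Q (log_moduli y) * (ennreal (exp (- (\<Sum>j\<in>UNIV. of_int (column_sum j - 1) * log_moduli y $ j))) * h (real_A *v log_moduli y)) \<partial>lborel)"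
    by (subst nn_integral_log_moduli[of "\<lambda>x. indicator Q x * (ennreal (exp (- (\<Sum>j\<in>UNIV. of_int (column_sum j - 1) * x $ j))) * h (real_A *v x))"]) simp_all
  also have "\<dots> = (\<integral>\<^sup>+y. indicator punctured_polydisc y * (ennreal ((cmod (jac y))\<^sup>2) * h (log_moduli (cover y))) \<partial>lborel)"
  proof (intro nn_integral_cong_AE eventually_mono[OF AE_complex_torus])
    fix y :: "complex^'n" assume y: "y \<in> complex_torus"
    have "0 < log_moduli y $ k \<longleftrightarrow> cmod (y $ k) < 1" for k
    proof -
      have "cmod (y $ k) > 0" using y by (simp add: complex_torus_def)
      then show ?thesis by (simp add: log_moduli_def ln_realpow)
    qed
    then have "log_moduli y \<in> Q \<longleftrightarrow> y \<in> punctured_polydisc"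
      using y by (simp add: Q_def punctured_polydisc_def complex_torus_def)
    then show "indicator Q (log_moduli y) * (ennreal (exp (- (\<Sum>j\<in>UNIV. of_int (column_sum j - 1) * log_moduli y $ j))) * h (real_A *v log_moduli y)) 
      = indicator punctured_polydisc y * (ennreal ((cmod (jac y))\<^sup>2) * h (log_moduli (cover y)))"
      by (simp add: indicator_def cmod_jac_exp[OF y] log_moduli_cover[OF y])
  qed
  finally show ?thesis .
qed

text \<open>
  The map \<open>cover\<close> is not injective: its degree is \<open>\<bar>det A\<bar>\<close>, which accounts for the first power of
  \<open>det A\<close> although the square of the Jacobian occurs. The proof does not count preimages. Both
  sides are unchanged if \<open>H\<close> is rotated, because rotations of the region lift to rotations of
  the polydisc. So \<open>H\<close> can be replaced by its average over the torus, which depends on the moduli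
  only.
\<close>
lemma change_of_variables:
  assumes H [measurable]: "H \<in> borel_measurable borel"
  shows "(\<integral>\<^sup>+z. indicator region z * H z \<partial>lborel) =
     ennreal \<bar>det real_A\<bar> * (\<integral>\<^sup>+y. indicator punctured_polydisc y * (ennreal ((cmod (jac y))\<^sup>2) * H (cover y)) \<partial>lborel)"
proof -
  let ?D = "punctured_polydisc :: (complex ^ 'n) set"
  let ?L = "\<integral>\<^sup>+z. indicator region z * H z \<partial>lborel"
  let ?R = "\<integral>\<^sup>+y. indicator ?D y * (ennreal ((cmod (jac y))\<^sup>2) * H (cover y)) \<partial>lborel"
  \<comment> \<open>the average over the torus, with the rotation taken from a point \<open>v\<close> of the polydisc\<close>
  define Hm where "Hm w = (\<integral>\<^sup>+v. indicator ?D v * H (torus_rotate v w) \<partial>lborel)" for w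
  have [measurable]: "Hm \<in> borel_measurable borel"
    unfolding Hm_def[abs_def] by measurable
  define h where "h x = Hm (\<chi> k. of_real (exp (- x $ k / 2)))" for x :: "real^'n"
  have [measurable]: "h \<in> borel_measurable borel"
    unfolding h_def[abs_def] by measurable
  have pos: "emeasure lborel ?D \<noteq> 0" "emeasure lborel ?D \<noteq> \<infinity>"
    by (simp_all add: emeasure_punctured_polydisc)
  have Hm: "Hm w = h (log_moduli w)" if w: "w \<in> complex_torus" for w
  proof -
    \<comment> \<open>rotating \<open>v\<close> by the arguments of \<open>w\<close> moves these from \<open>w\<close> into the integration variable\<close>
    define c where "c = (\<chi> k. sgn (w $ k))"
    have c: "cmod (c $ k) = 1" for k using w by (simp add: c_def complex_torus_def norm_sgn)
    have e: "exp (- log_moduli w $ k / 2) = cmod (w $ k)" for k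
      using w by (simp add: log_moduli_def complex_torus_def ln_realpow)
    have "h (log_moduli w) = (\<integral>\<^sup>+v. indicator ?D v * H (torus_rotate v (\<chi> k. of_real (cmod (w $ k)))) \<partial>lborel)"
      unfolding h_def Hm_def by (simp only: vec_lambda_beta e)
    also have "\<dots> = (\<integral>\<^sup>+v. indicator ?D (\<chi> k. c $ k * v $ k) * H (torus_rotate (\<chi> k. c $ k * v $ k) (\<chi> k. of_real (cmod (w $ k)))) \<partial>lborel)"
      by (rule nn_integral_unimodular[OF c, symmetric]) measurable
    also have "\<dots> = Hm w"
    proof -
      have "indicator ?D (\<chi> k. c $ k * v $ k) = (indicator ?D v :: ennreal)" for v
      proof -
        have "c $ k \<noteq> 0" for k using c[of k] by auto
        then show ?thesis by (simp add: indicator_def punctured_polydisc_def norm_mult c)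
      qed
      moreover have "torus_rotate (\<chi> k. c $ k * v $ k) (\<chi> k. of_real (cmod (w $ k))) = torus_rotate v w" for v
      proof -
        have "sgn (w $ k) * of_real (cmod (w $ k)) = w $ k" for k
          using w by (simp add: sgn_eq complex_torus_def)
        then have "sgn (v $ k) * (sgn (w $ k) * of_real (cmod (w $ k))) = sgn (v $ k) * w $ k" for k by simp
        then show ?thesis by (simp add: torus_rotate_def vec_eq_iff c_def sgn_mult mult_ac)
      qed
      ultimately show ?thesis by (simp add: Hm_def)
    qed
    finally show ?thesis ..
  qed
  have rot_torus: "torus_rotate v w \<in> complex_torus \<longleftrightarrow> w \<in> complex_torus" if "v \<in> complex_torus" for v w :: "complex^'n"
    using that by (auto simp: torus_rotate_def complex_torus_def sgn_zero_iff)
  have log_rot: "log_moduli (torus_rotate v w) = log_moduli w" if "v \<in> complex_torus" for v w :: "complex^'n"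
    using that by (simp add: torus_rotate_def complex_torus_def log_moduli_def norm_mult norm_sgn)
  have "emeasure lborel ?D * ?L = 
      (\<integral>\<^sup>+v. indicator ?D v * ?L \<partial>lborel)"
    by (simp add: nn_integral_multc)
  also have "\<dots> = (\<integral>\<^sup>+v. (\<integral>\<^sup>+z. indicator ?D v * (indicator region z * H (torus_rotate v z)) \<partial>lborel) \<partial>lborel)"
  proof (intro nn_integral_cong)
    fix v :: "complex^'n"
    show "indicator ?D v * ?L = 
       (\<integral>\<^sup>+z. indicator ?D v * (indicator region z * H (torus_rotate v z)) \<partial>lborel)"
    proof (cases "v \<in> ?D")
      case True
      then have v: "v \<in> complex_torus" by (rule punctured_subset_torus)
      have "?L = (\<integral>\<^sup>+z. indicator region z * H z \<partial>distr lborel borel (torus_rotate v))"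
        by (simp add: distr_torus_rotate[OF v])
      also have "\<dots> = (\<integral>\<^sup>+z. indicator region (torus_rotate v z) * H (torus_rotate v z) \<partial>lborel)"
        by (simp add: nn_integral_distr)
      also have "(\<lambda>z. indicator region (torus_rotate v z)) = (indicator region :: _ \<Rightarrow> ennreal)"
      proof
        fix z
        have "torus_rotate v z \<in> region \<longleftrightarrow> z \<in> region"
        proof (cases "z \<in> complex_torus")
          case True
          then show ?thesis
            using v by (simp add: region_iff_log_moduli rot_torus log_rot)
        next
          case False
          then have "torus_rotate v z \<notin> complex_torus" using v by (simp add: rot_torus)
          with False show ?thesis by (simp add: region_iff)
        qed
        then show "indicator region (torus_rotate v z) = (indicator region z :: ennreal)" by (simp add: indicator_def)
      qed
      finally show ?thesis using True by simp
    qed simp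
  qed
  also have "\<dots> = (\<integral>\<^sup>+z. (\<integral>\<^sup>+v. indicator ?D v * (indicator region z * H (torus_rotate v z)) \<partial>lborel) \<partial>lborel)"
    by (rule pair_sigma_finite.Fubini'[symmetric]) (auto simp: pair_sigma_finite_def sigma_finite_lborel)
  also have "\<dots> = (\<integral>\<^sup>+z. indicator region z * Hm z \<partial>lborel)"
    by (simp add: Hm_def nn_integral_cmult[symmetric] mult_ac)
  also have "\<dots> = (\<integral>\<^sup>+z. indicator region z * h (log_moduli z) \<partial>lborel)"
    by (intro nn_integral_cong) (auto simp: indicator_def Hm region_iff)
  also have "\<dots> = ennreal \<bar>det real_A\<bar> * (\<integral>\<^sup>+y. indicator ?D y * (ennreal ((cmod (jac y))\<^sup>2) * h (log_moduli (cover y))) \<partial>lborel)"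
    by (rule change_of_variables_radial) measurable
  also have "(\<integral>\<^sup>+y. indicator ?D y * (ennreal ((cmod (jac y))\<^sup>2) * h (log_moduli (cover y))) \<partial>lborel) = 
      (\<integral>\<^sup>+y. indicator ?D y * (ennreal ((cmod (jac y))\<^sup>2) * Hm (cover y)) \<partial>lborel)"
    by (intro nn_integral_cong) (auto simp: indicator_def Hm cover_in_torus punctured_subset_torus)
  also have "\<dots> = (\<integral>\<^sup>+y. (\<integral>\<^sup>+v. indicator ?D v * (indicator ?D y * (ennreal ((cmod (jac y))\<^sup>2) * H (torus_rotate v (cover y)))) \<partial>lborel) \<partial>lborel)"
    by (simp add: Hm_def nn_integral_cmult[symmetric] mult_ac)
  also have "\<dots> = (\<integral>\<^sup>+v. (\<integral>\<^sup>+y. indicator ?D v * (indicator ?D y * (ennreal ((cmod (jac y))\<^sup>2) * H (torus_rotate v (cover y)))) \<partial>lborel) \<partial>lborel)"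
    by (rule pair_sigma_finite.Fubini') (auto simp: pair_sigma_finite_def sigma_finite_lborel)
  also have "\<dots> = (\<integral>\<^sup>+v. indicator ?D v * ?R \<partial>lborel)"
  proof (intro nn_integral_cong)
    fix v :: "complex^'n"
    show "(\<integral>\<^sup>+y. indicator ?D v * (indicator ?D y * (ennreal ((cmod (jac y))\<^sup>2) * H (torus_rotate v (cover y)))) \<partial>lborel) = 
       indicator ?D v * ?R"
    proof (cases "v \<in> ?D")
      case True
      then have v: "v \<in> complex_torus" by (rule punctured_subset_torus)
      define u where "u = (\<chi> k. sgn (v $ k))"
      have u1: "cmod (u $ k) = 1" for k using v by (simp add: u_def complex_torus_def norm_sgn)
      then have u: "u \<in> complex_torus" using v by (simp add: u_def complex_torus_def sgn_zero_iff)
      define c where "c = lift u"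
      have c: "cmod (c $ k) = 1" for k unfolding c_def by (rule cmod_lift_unimodular[OF u1])
      have c0: "c $ k \<noteq> 0" for k using c[of k] by auto
      have cov: "cover (\<chi> k. c $ k * y $ k) = torus_rotate v (cover y)" for y
        by (simp add: cover_mult c_def cover_lift[OF u]) (simp add: torus_rotate_def u_def)
      have j: "cmod (jac (\<chi> k. c $ k * y $ k)) = cmod (jac y)" for y
        by (simp add: jac_def cmod_laurent_monomial norm_mult c)
      have i: "indicator ?D (\<chi> k. c $ k * y $ k) = (indicator ?D y :: ennreal)" for y
        using c0 by (simp add: indicator_def punctured_polydisc_def norm_mult c)
      have "?R = 
        (\<integral>\<^sup>+y. indicator ?D (\<chi> k. c $ k * y $ k) * (ennreal ((cmod (jac (\<chi> k. c $ k * y $ k)))\<^sup>2) * H (cover (\<chi> k. c $ k * y $ k))) \<partial>lborel)"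
        by (rule nn_integral_unimodular[OF c, symmetric]) measurable
      also have "\<dots> = (\<integral>\<^sup>+y. indicator ?D y * (ennreal ((cmod (jac y))\<^sup>2) * H (torus_rotate v (cover y))) \<partial>lborel)"
        by (simp add: cov j i)
      finally show ?thesis using True by simp
    qed simp
  qed
  also have "\<dots> = emeasure lborel ?D * ?R"
    by (simp add: nn_integral_multc)
  finally have "emeasure lborel ?D * ?L = 
     emeasure lborel ?D * (ennreal \<bar>det real_A\<bar> * ?R)"
    by (simp add: mult_ac)
  \<comment> \<open>both sides have been multiplied by the volume of the polydisc\<close>
  then show ?thesis using pos by (subst (asm) ennreal_mult_cancel_left) auto
qed

end

section \<open>The Bergman kernel of the disc\<close>

text \<open>
  The origin is removed from the disc because the functions pulled back from the region are a priori
  defined only where all coordinates are nonzero.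
\<close>
definition disc_measure :: "complex measure" where
  "disc_measure = density lborel (indicator (ball 0 1 - {0}))"

lemma borel_measurable_cnj [measurable]: "cnj \<in> borel_measurable borel"
  by (intro borel_measurable_continuous_onI continuous_intros)

lemma sets_disc_measure [simp, measurable_cong]: "sets disc_measure = sets borel"
  by (simp add: disc_measure_def)

lemma space_disc_measure [simp]: "space disc_measure = UNIV"
  by (simp add: disc_measure_def)

lemma disc_indicator_measurable [measurable]: "(indicator (ball 0 1 - {0::complex}) :: complex \<Rightarrow> ennreal) \<in> borel_measurable borel"
  by (rule borel_measurable_indicator) auto

lemma nn_integral_disc_measure:
  assumes [measurable]: "f \<in> borel_measurable borel"
  shows "(\<integral>\<^sup>+y. f y \<partial>disc_measure) = (\<integral>\<^sup>+y. indicator (ball 0 1 - {0}) y * f y \<partial>lborel)"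
  by (simp add: disc_measure_def nn_integral_density)

lemma nn_integral_disc_measure_radial:
  assumes [measurable]: "g \<in> borel_measurable borel"
  shows "(\<integral>\<^sup>+y. g ((cmod y)\<^sup>2) \<partial>disc_measure) = ennreal pi * (\<integral>\<^sup>+t. indicator {0<..<1} t * g t \<partial>lborel)"
proof -
  have "(\<integral>\<^sup>+y. g ((cmod y)\<^sup>2) \<partial>disc_measure) = (\<integral>\<^sup>+(z::complex). indicator {z. cmod z < 1} z * g ((cmod z)\<^sup>2) \<partial>lborel)"
    by (subst nn_integral_disc_measure, simp, intro nn_integral_cong_AE eventually_mono[OF AE_lborel_singleton[of 0]])
       (auto simp: indicator_def)
  then show ?thesis by (simp add: nn_integral_disc_radial)
qed

lemma emeasure_disc_measure: "emeasure disc_measure UNIV = ennreal pi"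
  using nn_integral_disc_measure_radial[of "\<lambda>_. 1"] by (simp del: nn_integral_indicator) simp

lemma finite_measure_disc_measure: "finite_measure disc_measure"
  by (rule finite_measureI) (simp add: emeasure_disc_measure)

lemma sigma_finite_disc_measure: "sigma_finite_measure disc_measure"
  using finite_measure_disc_measure by (simp add: finite_measure.axioms(1))

lemma AE_disc_measure: "AE y in disc_measure. y \<noteq> 0 \<and> cmod y < 1"
  unfolding disc_measure_def by (subst AE_density) (auto simp: indicator_def)

lemma distr_disc_measure_rotation:
  assumes c: "cmod c = 1"
  shows "distr disc_measure borel (\<lambda>z. c * z) = disc_measure"
proof (rule measure_eqI)
  fix X assume "X \<in> sets (distr disc_measure borel (\<lambda>z. c * z))"
  then have [measurable]: "X \<in> sets borel" by simp
  have "c \<noteq> 0" using c by auto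
  have "emeasure (distr disc_measure borel (\<lambda>z. c * z)) X = (\<integral>\<^sup>+y. indicator X (c * y) \<partial>disc_measure)"
    by (subst nn_integral_indicator[symmetric]) (simp_all add: nn_integral_distr del: nn_integral_indicator)
  also have "\<dots> = (\<integral>\<^sup>+y. indicator (ball 0 1 - {0}) (c * y) * indicator X (c * y) \<partial>lborel)"
    using \<open>c \<noteq> 0\<close> c by (subst nn_integral_disc_measure) (auto intro!: nn_integral_cong simp: indicator_def norm_mult)
  also have "\<dots> = (\<integral>\<^sup>+y. indicator (ball 0 1 - {0}) y * indicator X y \<partial>distr lborel borel (\<lambda>z. c * z))"
    by (subst nn_integral_distr) simp_all
  also have "\<dots> = emeasure disc_measure X"
    by (simp add: distr_lborel_rotation[OF c] disc_measure_def emeasure_density)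
  finally show "emeasure (distr disc_measure borel (\<lambda>z. c * z)) X = emeasure disc_measure X" .
qed simp

lemma integral_disc_measure_rotation:
  fixes f :: "complex \<Rightarrow> complex"
  assumes "cmod c = 1" and [measurable]: "f \<in> borel_measurable borel"
  shows "(LINT y|disc_measure. f (c * y)) = (LINT y|disc_measure. f y)"
proof -
  have "(LINT y|disc_measure. f y) = (LINT y|distr disc_measure borel (\<lambda>z. c * z). f y)"
    by (simp add: distr_disc_measure_rotation[OF assms(1)])
  then show ?thesis by (simp add: integral_distr)
qed

lemma integrable_disc_measure_bounded:
  fixes f :: "complex \<Rightarrow> 'a::{banach,second_countable_topology}"
  assumes [measurable]: "f \<in> borel_measurable borel"
    and "\<And>y. y \<noteq> 0 \<Longrightarrow> cmod y < 1 \<Longrightarrow> norm (f y) \<le> C"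
  shows "integrable disc_measure f"
  using assms(2) by (intro finite_measure.integrable_const_bound[OF finite_measure_disc_measure, of _ C]
      eventually_mono[OF AE_disc_measure]) auto

text \<open>
  Witness for the orthogonality of monomials: a rotation that changes the sign of
  \<open>y ^ k * cnj y ^ l\<close>.
\<close>
lemma cis_power_div:
  assumes "k \<noteq> (l::nat)"
  obtains c where "cmod c = 1" "c ^ k * cnj c ^ l = -1"
proof -
  define \<theta> where "\<theta> = pi / (real k - real l)"
  have "cis \<theta> ^ k * cnj (cis \<theta>) ^ l = cis (real k * \<theta>) * cis (- (real l * \<theta>))"
    unfolding complex_cnj_power[symmetric] Complex.DeMoivre cis_cnj by simp
  also have "\<dots> = cis ((real k - real l) * \<theta>)"
    by (simp add: cis_mult algebra_simps)
  also have "\<dots> = -1" using assms by (simp add: \<theta>_def)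
  finally show ?thesis by (intro that[of "cis \<theta>"]) simp_all
qed

text \<open>
  For \<open>k \<noteq> l\<close> a suitable rotation changes the sign of the integrand; for \<open>k = l\<close> the integrand is
  radial.
\<close>
lemma integral_disc_monomials:
  "(LINT y|disc_measure. y ^ k * cnj y ^ l) = (if k = l then of_real (pi / (real k + 1)) else 0)"
proof (cases "k = l")
  case False
  then obtain c where c: "cmod c = 1" "c ^ k * cnj c ^ l = -1" by (rule cis_power_div)
  have "(LINT y|disc_measure. y ^ k * cnj y ^ l) = (LINT y|disc_measure. (c * y) ^ k * cnj (c * y) ^ l)"
    by (rule integral_disc_measure_rotation[OF c(1), symmetric]) simp
  also have "\<dots> = (LINT y|disc_measure. (c ^ k * cnj c ^ l) * (y ^ k * cnj y ^ l))"
    by (simp add: power_mult_distrib mult_ac)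
  also have "\<dots> = - (LINT y|disc_measure. y ^ k * cnj y ^ l)"
    unfolding c(2) by simp
  finally have "2 * (LINT y|disc_measure. y ^ k * cnj y ^ l) = 0" by simp
  then show ?thesis using False by simp
next
  case True
  have eq: "y ^ k * cnj y ^ l = of_real (((cmod y)\<^sup>2) ^ k)" for y
    by (simp add: True power_mult_distrib[symmetric] complex_norm_square[symmetric])
  have "(LINT y|disc_measure. ((cmod y)\<^sup>2) ^ k) = enn2real (\<integral>\<^sup>+y. ennreal (((cmod y)\<^sup>2) ^ k) \<partial>disc_measure)"
    by (rule integral_eq_nn_integral) auto
  also have "(\<integral>\<^sup>+y. ennreal (((cmod y)\<^sup>2) ^ k) \<partial>disc_measure) = ennreal pi * (\<integral>\<^sup>+t. indicator {0<..<1} t * ennreal (t ^ k) \<partial>lborel)"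
    by (rule nn_integral_disc_measure_radial[of "\<lambda>t. ennreal (t ^ k)"]) simp
  also have "(\<integral>\<^sup>+t. indicator {0<..<1} t * ennreal (t ^ k) \<partial>lborel) = (\<integral>\<^sup>+t. ennreal (t ^ k) * indicator {0..1} t \<partial>lborel)"
    by (intro nn_integral_cong_AE eventually_mono[OF eventually_conj[OF AE_lborel_singleton[of 0] AE_lborel_singleton[of 1]]])
       (auto simp: indicator_def)
  also have "\<dots> = ennreal (1 ^ Suc k / real (Suc k) - 0 ^ Suc k / real (Suc k))"
    by (rule nn_integral_FTC_Icc) (auto intro!: derivative_eq_intros simp del: power_Suc)
  also have "enn2real (ennreal pi * \<dots>) = pi / (real k + 1)"
    by (simp add: ennreal_mult'[symmetric] add.commute)
  finally show ?thesis using True unfolding eq integral_complex_of_real by (simp add: add.commute)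
qed

lemma one_minus_nonzero: "cmod w < 1 \<Longrightarrow> 1 - w \<noteq> 0"
  by auto

lemma cmod_one_minus_ge: 
  assumes "cmod y \<le> 1" shows "1 - cmod x \<le> cmod (1 - x * cnj y)"
proof -
  have "cmod (x * cnj y) \<le> cmod x" using assms by (simp add: norm_mult mult_left_le)
  moreover have "1 - cmod (x * cnj y) \<le> cmod (1 - x * cnj y)"
    using norm_triangle_ineq2[of 1 "x * cnj y"] by simp
  ultimately show ?thesis by linarith
qed

text \<open>
  The kernel is expanded as \<open>1 / (1 - w)\<^sup>2 = \<Sum>\<^sub>l (l + 1) w ^ l\<close>, and orthogonality leaves the term
  \<open>l = k\<close>.
\<close>
lemma bergman_disc_monomial:
  assumes x: "cmod x < 1"
  shows "(LINT y|disc_measure. y ^ k / (1 - x * cnj y)\<^sup>2) = of_real pi * x ^ k"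
proof -
  let ?f = "\<lambda>l y. y ^ k * (of_nat (Suc l) * (x * cnj y) ^ l)"
  have bound: "norm (?f l y) \<le> real (Suc l) * cmod x ^ l" if "y \<noteq> 0" "cmod y < 1" for l y
  proof -
    have "norm (?f l y) = cmod y ^ k * (real (Suc l) * (cmod x ^ l * cmod y ^ l))"
      by (simp add: norm_mult norm_power power_mult_distrib del: of_nat_Suc)
    also have "\<dots> \<le> 1 * (real (Suc l) * (cmod x ^ l * 1))"
      using that by (intro mult_mono power_le_one) auto
    finally show ?thesis by simp
  qed
  have int: "integrable disc_measure (?f l)" for l
    using bound[of _ l] by (intro integrable_disc_measure_bounded) auto
  have sm: "summable (\<lambda>l. real (Suc l) * cmod x ^ l)"
    using geometric_deriv_sums[of "cmod x"] x by (auto simp: sums_iff)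
  have eq: "(\<Sum>l. ?f l y) = y ^ k / (1 - x * cnj y)\<^sup>2" if "y \<noteq> 0" "cmod y < 1" for y
  proof -
    have "cmod (x * cnj y) \<le> cmod x * 1"
      unfolding norm_mult using that by (intro mult_mono) auto
    then have "cmod (x * cnj y) < 1" using x by simp
    then have "(\<lambda>l. of_nat (Suc l) * (x * cnj y) ^ l) sums (1 / (1 - x * cnj y)\<^sup>2)"
      by (rule geometric_deriv_sums)
    then have "(\<lambda>l. ?f l y) sums (y ^ k * (1 / (1 - x * cnj y)\<^sup>2))"
      by (intro sums_mult)
    then show ?thesis by (simp add: sums_iff)
  qed
  have "(LINT y|disc_measure. y ^ k / (1 - x * cnj y)\<^sup>2) = (LINT y|disc_measure. (\<Sum>l. ?f l y))"
    by (rule integral_cong_AE) (use eq in \<open>auto intro!: eventually_mono[OF AE_disc_measure] simp del: of_nat_Suc\<close>)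
  also have "\<dots> = (\<Sum>l. (LINT y|disc_measure. ?f l y))"
  proof (rule integral_suminf[OF int])
    show "AE y in disc_measure. summable (\<lambda>l. norm (?f l y))"
      by (rule eventually_mono[OF AE_disc_measure], rule summable_comparison_test'[OF sm, of 0])
         (use bound in auto)
    have "(LINT y|disc_measure. norm (?f l y)) \<le> (LINT y|disc_measure. real (Suc l) * cmod x ^ l)" for l
      using bound[of _ l] int[of l] finite_measure.integrable_const[OF finite_measure_disc_measure]
      by (intro integral_mono_AE) (auto intro!: eventually_mono[OF AE_disc_measure] simp del: of_nat_Suc)
    then have le: "(LINT y|disc_measure. norm (?f l y)) \<le> measure disc_measure UNIV * (real (Suc l) * cmod x ^ l)" for l
      by (simp add: mult.assoc)
    show "summable (\<lambda>l. LINT y|disc_measure. norm (?f l y))"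
      by (rule summable_comparison_test'[OF summable_mult[OF sm, of "measure disc_measure UNIV"], of 0])
         (use le in \<open>auto simp del: of_nat_Suc\<close>)
  qed
  also have "\<dots> = (\<Sum>l. if l = k then of_real pi * x ^ k else 0)"
  proof (rule suminf_cong)
    fix l
    have "(LINT y|disc_measure. ?f l y) = (LINT y|disc_measure. (of_nat (Suc l) * x ^ l) * (y ^ k * cnj y ^ l))"
      by (simp add: power_mult_distrib mult_ac del: of_nat_Suc)
    also have "\<dots> = of_nat (Suc l) * x ^ l * (if k = l then of_real (pi / (real k + 1)) else 0)"
      by (simp add: integral_disc_monomials del: of_nat_Suc)
    finally have fin: "(LINT y|disc_measure. ?f l y) = of_nat (Suc l) * x ^ l * (if k = l then of_real (pi / (real k + 1)) else 0)" .
    show "(LINT y|disc_measure. ?f l y) = (if l = k then of_real pi * x ^ k else 0)"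
    proof (cases "k = l")
      case True
      have "complex_of_nat (Suc k) * complex_of_real (pi / (real k + 1)) = of_real (real (Suc k) * (pi / (real k + 1)))"
        by simp
      also have "real (Suc k) * (pi / (real k + 1)) = pi" by (simp add: field_simps)
      finally have e: "complex_of_nat (Suc k) * complex_of_real (pi / (real k + 1)) = of_real pi" .
      have "(LINT y|disc_measure. ?f l y) = of_nat (Suc k) * x ^ k * of_real (pi / (real k + 1))"
        unfolding fin using True by (simp only: if_True refl)
      also have "\<dots> = (of_nat (Suc k) * of_real (pi / (real k + 1))) * x ^ k"
        by (simp only: ac_simps)
      finally show ?thesis unfolding e using True by (simp only: if_True refl)
    qed (use fin in simp)
  qed
  also have "\<dots> = of_real pi * x ^ k"
    using sums_If_finite_set[of "{k}" "\<lambda>_. of_real pi * x ^ k"] by (simp add: sums_iff)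
  finally show ?thesis .
qed


lemma cmod_mult_cnj_less:
  assumes "cmod x < 1" "cmod y < 1" shows "cmod (x * cnj y) < 1"
  using assms norm_ge_zero[of x] norm_ge_zero[of y] mult_strict_mono'[of "cmod x" 1 "cmod y" 1]
  by (simp add: norm_mult)

text \<open>
  If \<open>g\<close> is holomorphic on a larger disc then its Taylor series converges uniformly on the
  unit disc, so that the formula for monomials can be summed. The integrand \<open>G\<close> need agree with \<open>g\<close>
  only off the origin; this will absorb removable singularities.
\<close>
lemma bergman_disc_reproducing:
  assumes x: "cmod x < 1" and R: "R > 1" and g: "g holomorphic_on ball 0 R"
    and G [measurable]: "G \<in> borel_measurable borel" and Gg: "\<And>y. y \<noteq> 0 \<Longrightarrow> cmod y < 1 \<Longrightarrow> G y = g y"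
  shows "(LINT y|disc_measure. G y / (1 - x * cnj y)\<^sup>2) = of_real pi * g x"
proof -
  define a where "a n = (deriv ^^ n) g 0 / fact n" for n
  have sums: "(\<lambda>n. a n * y ^ n) sums g y" if "cmod y < R" for y
    using holomorphic_power_series[OF g, of y] that by (simp add: a_def)
  \<comment> \<open>convergence at a point beyond the unit circle gives absolute convergence on it\<close>
  obtain r where r: "1 < r" "r < R" using R dense by blast
  have "summable (\<lambda>n. a n * of_real r ^ n)"
    using sums[of "of_real r"] r by (auto simp: sums_iff)
  then have sm: "summable (\<lambda>n. cmod (a n))"
    using powser_insidea[of a "of_real r" 1] r by simp
  let ?K = "\<lambda>y. (1 - x * cnj y)\<^sup>2"
  have K: "(1 - cmod x)\<^sup>2 \<le> cmod (?K y)" if "cmod y < 1" for y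
    unfolding norm_power using x that by (intro power_mono cmod_one_minus_ge) auto
  have pos: "0 < (1 - cmod x)\<^sup>2" using x by simp
  let ?f = "\<lambda>n y. a n * (y ^ n / ?K y)"
  have bound: "norm (?f n y) \<le> cmod (a n) * (1 / (1 - cmod x)\<^sup>2)" if "y \<noteq> 0" "cmod y < 1" for n y
  proof -
    have "norm (?f n y) = cmod (a n) * (cmod y ^ n / cmod (?K y))"
      by (simp add: norm_mult norm_divide norm_power)
    also have "\<dots> \<le> cmod (a n) * (1 / (1 - cmod x)\<^sup>2)"
      using that K[of y] pos by (intro mult_left_mono frac_le power_le_one) auto
    finally show ?thesis .
  qed
  have int: "integrable disc_measure (?f n)" for n
    using bound[of _ n] by (intro integrable_disc_measure_bounded) auto
  have "(LINT y|disc_measure. G y / ?K y) = (LINT y|disc_measure. (\<Sum>n. ?f n y))"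
  proof (rule integral_cong_AE)
    have "(\<Sum>n. ?f n y) = g y / ?K y" if "y \<noteq> 0" "cmod y < 1" for y
    proof -
      have "(\<lambda>n. a n * y ^ n / ?K y) sums (g y / ?K y)"
        using that R by (intro sums_divide sums) auto
      then show ?thesis by (simp add: sums_iff)
    qed
    then show eq: "AE y in disc_measure. G y / ?K y = (\<Sum>n. ?f n y)"
      by (intro eventually_mono[OF AE_disc_measure]) (auto simp: Gg)
    show "(\<lambda>y. \<Sum>n. ?f n y) \<in> borel_measurable disc_measure" by measurable
    show "(\<lambda>y. G y / ?K y) \<in> borel_measurable disc_measure" by measurable
  qed
  also have "\<dots> = (\<Sum>n. (LINT y|disc_measure. ?f n y))"
  proof (rule integral_suminf[OF int])
    show "AE y in disc_measure. summable (\<lambda>n. norm (?f n y))"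
      by (rule eventually_mono[OF AE_disc_measure], rule summable_comparison_test'[OF summable_mult2[OF sm, of "1 / (1 - cmod x)\<^sup>2"], of 0])
         (use bound in auto)
    have "(LINT y|disc_measure. norm (?f n y)) \<le> (LINT y|disc_measure. cmod (a n) * (1 / (1 - cmod x)\<^sup>2))" for n
      using bound[of _ n] int[of n] finite_measure.integrable_const[OF finite_measure_disc_measure]
      by (intro integral_mono_AE) (auto intro!: eventually_mono[OF AE_disc_measure])
    then have le: "(LINT y|disc_measure. norm (?f n y)) \<le> cmod (a n) * (1 / (1 - cmod x)\<^sup>2 * measure disc_measure UNIV)" for n
      by (simp add: mult_ac)
    show "summable (\<lambda>n. LINT y|disc_measure. norm (?f n y))"
      by (rule summable_comparison_test'[OF summable_mult2[OF sm, of "1 / (1 - cmod x)\<^sup>2 * measure disc_measure UNIV"], of 0]) (use le in auto)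
  qed
  also have "\<dots> = (\<Sum>n. of_real pi * (a n * x ^ n))"
    unfolding integral_mult_right_zero bergman_disc_monomial[OF x] by (simp add: mult_ac)
  also have "\<dots> = of_real pi * g x"
    using sums_mult[OF sums[of x], of "of_real pi"] x R by (simp add: sums_iff)
  finally show ?thesis .
qed

lemma integral_disc_radial_cnj_power:
  fixes \<psi> :: "complex \<Rightarrow> complex"
  assumes [measurable]: "\<psi> \<in> borel_measurable borel" and rad: "\<And>c y. cmod c = 1 \<Longrightarrow> \<psi> (c * y) = \<psi> y" and j: "j > 0"
  shows "(LINT y|disc_measure. \<psi> y * cnj y ^ j) = 0"
proof -
  obtain c where c: "cmod c = 1" "c ^ 0 * cnj c ^ j = -1"
    by (rule cis_power_div[of 0 j]) (use j in auto)
  have "(LINT y|disc_measure. \<psi> y * cnj y ^ j) = (LINT y|disc_measure. \<psi> (c * y) * cnj (c * y) ^ j)"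
    by (rule integral_disc_measure_rotation[OF c(1), symmetric]) simp
  also have "\<dots> = (LINT y|disc_measure. (c ^ 0 * cnj c ^ j) * (\<psi> y * cnj y ^ j))"
    unfolding rad[OF c(1)] by (simp add: power_mult_distrib mult_ac)
  also have "\<dots> = - (LINT y|disc_measure. \<psi> y * cnj y ^ j)"
    unfolding c(2) by simp
  finally have "2 * (LINT y|disc_measure. \<psi> y * cnj y ^ j) = 0" by simp
  then show ?thesis by simp
qed

text \<open>
  A radial function times \<open>(1 + w) / (1 - w) = 1 + 2 \<Sum>\<^sub>l w ^ l\<close> (\<open>l \<ge> 1\<close>) integrates like the constant
  term, because the powers of \<open>w = (x cnj y) ^ m\<close> are orthogonal to radial functions. The real part
  of this quotient is the Poisson kernel.
\<close>
lemma integral_disc_radial_poisson: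
  fixes \<psi> :: "real \<Rightarrow> real"
  assumes [measurable]: "\<psi> \<in> borel_measurable borel" and int: "integrable disc_measure (\<lambda>y. \<psi> (cmod y))"
    and x: "cmod x < 1" and m: "m > 0"
  shows "(LINT y|disc_measure. \<psi> (cmod y) * Re ((1 + (x * cnj y) ^ m) / (1 - (x * cnj y) ^ m))) = (LINT y|disc_measure. \<psi> (cmod y))"
    "integrable disc_measure (\<lambda>y. \<psi> (cmod y) * Re ((1 + (x * cnj y) ^ m) / (1 - (x * cnj y) ^ m)))"
proof -
  let ?w = "\<lambda>y. (x * cnj y) ^ m"
  let ?f = "\<lambda>l y. of_real (\<psi> (cmod y)) * ?w y ^ l"
  have w: "cmod (?w y) \<le> cmod x" if "cmod y < 1" for y
  proof -
    have le: "cmod (x * cnj y) \<le> cmod x" using that by (simp add: norm_mult mult_left_le)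
    have "cmod (?w y) = cmod (x * cnj y) ^ m" by (simp add: norm_power)
    also have "\<dots> \<le> cmod (x * cnj y) ^ 1" using m le x by (intro power_decreasing) auto
    finally show ?thesis using le by simp
  qed
  have bound: "norm (?f l y) \<le> \<bar>\<psi> (cmod y)\<bar> * cmod x ^ l" if "cmod y < 1" for l y
    unfolding norm_mult norm_power[of "?w y"] norm_of_real using w[OF that] by (intro mult_left_mono power_mono) auto
  have intC: "integrable disc_measure (\<lambda>y. complex_of_real (\<psi> (cmod y)))"
    using int by simp
  have intl: "integrable disc_measure (?f l)" for l
  proof (rule Bochner_Integration.integrable_bound[OF int])
    have "cmod (?f l y) \<le> norm (\<psi> (cmod y))" if "cmod y < 1" for y
      using bound[OF that, of l] mult_left_le[of "cmod x ^ l" "\<bar>\<psi> (cmod y)\<bar>"] x by (simp add: power_le_one)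
    then show "AE y in disc_measure. cmod (?f l y) \<le> norm (\<psi> (cmod y))"
      by (intro eventually_mono[OF AE_disc_measure]) auto
  qed simp
  have sm: "summable (\<lambda>l. cmod x ^ l)" using x by simp
  have zero: "(LINT y|disc_measure. ?f l y) = (if l = 0 then of_real (LINT y|disc_measure. \<psi> (cmod y)) else 0)" for l
  proof (cases "l = 0")
    case False
    have "(LINT y|disc_measure. ?f l y) = (LINT y|disc_measure. x ^ (m * l) * (of_real (\<psi> (cmod y)) * cnj y ^ (m * l)))"
      unfolding power_mult[symmetric] power_mult_distrib by (simp add: mult_ac)
    also have "\<dots> = x ^ (m * l) * (LINT y|disc_measure. of_real (\<psi> (cmod y)) * cnj y ^ (m * l))"
      by simp
    also have "(LINT y|disc_measure. of_real (\<psi> (cmod y)) * cnj y ^ (m * l)) = 0"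
      using False m by (intro integral_disc_radial_cnj_power) (auto simp: norm_mult)
    finally show ?thesis using False by simp
  qed simp
  have AEs: "AE y in disc_measure. summable (\<lambda>l. norm (?f l y))"
    by (rule eventually_mono[OF AE_disc_measure], rule summable_comparison_test'[OF summable_mult[OF sm], of 0])
       (use bound in auto)
  have le: "(LINT y|disc_measure. norm (?f l y)) \<le> (LINT y|disc_measure. \<bar>\<psi> (cmod y)\<bar>) * cmod x ^ l" for l
  proof -
    have "(LINT y|disc_measure. norm (?f l y)) \<le> (LINT y|disc_measure. \<bar>\<psi> (cmod y)\<bar> * cmod x ^ l)"
      using bound[of _ l] intl[of l] int
      by (intro integral_mono_AE) (auto intro!: eventually_mono[OF AE_disc_measure])
    then show ?thesis by simp
  qed
  have sms: "summable (\<lambda>l. LINT y|disc_measure. norm (?f l y))"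
    by (rule summable_comparison_test'[OF summable_mult[OF sm], of 0]) (use le in auto)
  have "(LINT y|disc_measure. (\<Sum>l. ?f l y)) = (\<Sum>l. (LINT y|disc_measure. ?f l y))"
    by (rule integral_suminf[OF intl AEs sms])
  also have "\<dots> = of_real (LINT y|disc_measure. \<psi> (cmod y))"
    unfolding zero using sums_If_finite_set[of "{0}" "\<lambda>_. complex_of_real (LINT y|disc_measure. \<psi> (cmod y))"] by (simp add: sums_iff)
  finally have S: "(LINT y|disc_measure. (\<Sum>l. ?f l y)) = of_real (LINT y|disc_measure. \<psi> (cmod y))" .
  have Si: "integrable disc_measure (\<lambda>y. \<Sum>l. ?f l y)"
    by (rule integrable_suminf[OF intl AEs sms])
  have eq: "\<psi> (cmod y) * Re ((1 + ?w y) / (1 - ?w y)) = 2 * Re (\<Sum>l. ?f l y) - \<psi> (cmod y)" if "cmod y < 1" for y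
  proof -
    have lt: "cmod (?w y) < 1" using w[OF that] x by simp
    have "(\<lambda>l. ?f l y) sums (of_real (\<psi> (cmod y)) * (1 / (1 - ?w y)))"
      by (intro sums_mult geometric_sums lt)
    then have "(\<Sum>l. ?f l y) = of_real (\<psi> (cmod y)) * (1 / (1 - ?w y))" by (simp add: sums_iff)
    have "(1 + ?w y) / (1 - ?w y) = 2 * (1 / (1 - ?w y)) - 1"
      using one_minus_nonzero[OF lt] by (simp add: field_simps)
    moreover have "Re (2 * u - 1) = 2 * Re u - 1" for u by simp
    ultimately have "Re ((1 + ?w y) / (1 - ?w y)) = 2 * Re (1 / (1 - ?w y)) - 1"
      by (simp only:)
    with \<open>(\<Sum>l. ?f l y) = _\<close> show ?thesis by (simp only: Re_complex_of_real times_complex.sel Im_complex_of_real) (simp add: algebra_simps)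
  qed
  have AEeq: "AE y in disc_measure. \<psi> (cmod y) * Re ((1 + ?w y) / (1 - ?w y)) = 2 * Re (\<Sum>l. ?f l y) - \<psi> (cmod y)"
    by (intro eventually_mono[OF AE_disc_measure]) (use eq in auto)
  have int2: "integrable disc_measure (\<lambda>y. 2 * Re (\<Sum>l. ?f l y) - \<psi> (cmod y))"
    using Si int by auto
  show "integrable disc_measure (\<lambda>y. \<psi> (cmod y) * Re ((1 + ?w y) / (1 - ?w y)))"
    using int2 AEeq by (subst integrable_cong_AE[OF _ _ AEeq]) auto
  have "(LINT y|disc_measure. \<psi> (cmod y) * Re ((1 + ?w y) / (1 - ?w y))) = (LINT y|disc_measure. 2 * Re (\<Sum>l. ?f l y) - \<psi> (cmod y))"
    by (rule integral_cong_AE[OF _ _ AEeq]) auto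
  also have "\<dots> = 2 * Re (LINT y|disc_measure. (\<Sum>l. ?f l y)) - (LINT y|disc_measure. \<psi> (cmod y))"
    using Si int by simp
  also have "\<dots> = (LINT y|disc_measure. \<psi> (cmod y))"
    unfolding S by simp
  finally show "(LINT y|disc_measure. \<psi> (cmod y) * Re ((1 + ?w y) / (1 - ?w y))) = (LINT y|disc_measure. \<psi> (cmod y))" .
qed

section \<open>The Forelli-Rudin estimate in the disc\<close>

lemma nn_integral_powr_0:
  assumes "a < 1" "c \<ge> 0"
  shows "(\<integral>\<^sup>+t. indicator {0..c} t * ennreal (t powr (-a)) \<partial>lborel) = ennreal (c powr (1 - a) / (1 - a))"
proof -
  have "((\<lambda>x. x powr (-a)) has_integral (c powr (1 - a) / (1 - a))) {0..c}"
    using has_integral_powr_from_0[of "-a" c] assms by simp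
  then have "(\<integral>\<^sup>+t. indicator {0..c} t * (t powr (-a)) \<partial>lborel) = c powr (1 - a) / (1 - a)"
    by (rule nn_integral_has_integral_lebesgue[rotated]) auto
  then show ?thesis by (simp add: ennreal_mult'' ennreal_indicator mult.commute)
qed

lemma nn_integral_powr_inf:
  assumes "v > 0" "e > (0::real)"
  shows "(\<integral>\<^sup>+t. indicator {e..} t * ennreal (t powr (- v - 1)) \<partial>lborel) = ennreal (e powr (- v) / v)"
proof -
  have "((\<lambda>x. x powr (- v - 1)) has_integral (e powr (- v) / v)) {e..}"
    using has_integral_powr_to_inf[of "- v - 1" e] assms by simp
  then have "(\<integral>\<^sup>+t. indicator {e..} t * (t powr (- v - 1)) \<partial>lborel) = e powr (- v) / v"
    by (rule nn_integral_has_integral_lebesgue[rotated]) auto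
  then show ?thesis by (simp add: ennreal_mult'' ennreal_indicator mult.commute)
qed

text \<open>
  With \<open>\<epsilon> = 1 - \<rho>\<close> the denominator satisfies \<open>1 - \<rho> t \<ge> max \<epsilon> (1 - t)\<close>. The first summand handles
  \<open>t \<le> 1/2\<close>, where only the singularity at \<open>0\<close> counts; the others handle \<open>t > 1/2\<close>, where \<open>1 - t\<close> is
  compared with \<open>\<epsilon>\<close>.
\<close>
lemma forelli_rudin_pointwise:
  fixes t a v \<rho> :: real
  assumes t: "0 < t" "t < 1" and a: "0 \<le> a" "a < 1" and v: "0 < v" "v < 1" and \<rho>: "0 \<le> \<rho>" "\<rho> < 1"
  shows "t powr (-a) * (1 - t) powr (-v) / (1 - \<rho> * t)
     \<le> 4 * (indicator {0..1} t * t powr (-a)) + 2 * (indicator {0..1 - \<rho>} (1 - t) * (1 - t) powr (-v) / (1 - \<rho>) + indicator {1 - \<rho>..} (1 - t) * (1 - t) powr (-v - 1))"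
    (is "_ \<le> 4 * _ + 2 * ?r")
proof (cases "t \<le> 1/2")
  case True
  have "(1 - t) powr (-v) \<le> (1/2) powr (-v)"
    using True v by (intro powr_mono2') auto
  also have "\<dots> = 2 powr v" by (simp add: powr_minus powr_divide)
  also have "\<dots> \<le> 2 powr 1" using v by (intro powr_mono) auto
  finally have 1: "(1 - t) powr (-v) \<le> 2" by simp
  have "\<rho> * t \<le> 1 * (1/2)" using True \<rho> t by (intro mult_mono) auto
  then have 2: "1 / (1 - \<rho> * t) \<le> 2" by (simp add: field_simps)
  have "t powr (-a) * (1 - t) powr (-v) / (1 - \<rho> * t) = t powr (-a) * ((1 - t) powr (-v) * (1 / (1 - \<rho> * t)))" by simp
  also have "\<dots> \<le> t powr (-a) * (2 * 2)"
    using 1 2 \<open>\<rho> * t \<le> 1 * (1/2)\<close> by (intro mult_left_mono mult_mono) auto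
  also have "\<dots> \<le> 4 * (indicator {0..1} t * t powr (-a)) + 2 * ?r"
    using t \<rho> by (simp add: indicator_def)
  finally show ?thesis .
next
  case False
  have "t powr (-a) \<le> (1/2) powr (-a)" using False a by (intro powr_mono2') auto
  also have "\<dots> = 2 powr a" by (simp add: powr_minus powr_divide)
  also have "\<dots> \<le> 2 powr 1" using a by (intro powr_mono) auto
  finally have 1: "t powr (-a) \<le> 2" by simp
  have "\<rho> * t \<le> \<rho>" "\<rho> * t \<le> t" using t \<rho> by (simp_all add: mult_left_le mult_left_le_one_le)
  then have le: "1 - \<rho> \<le> 1 - \<rho> * t" "1 - t \<le> 1 - \<rho> * t" by auto
  have "(1 - t) powr (-v) / (1 - \<rho> * t) \<le> ?r" (is "?l \<le> _")
  proof (cases "1 - t \<le> 1 - \<rho>")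
    case True
    have "?l \<le> (1 - t) powr (-v) / (1 - \<rho>)"
      using le t \<rho> by (intro divide_left_mono mult_pos_pos) auto
    also have "\<dots> \<le> ?r" using True t by (simp add: indicator_def)
    finally show ?thesis .
  next
    case False
    have "?l \<le> (1 - t) powr (-v) / (1 - t)"
      using le t \<rho> by (intro divide_left_mono mult_pos_pos) auto
    also have "\<dots> = (1 - t) powr (-v - 1)" using t by (simp add: powr_diff)
    also have "\<dots> \<le> ?r" using False t \<rho> by (simp add: indicator_def)
    finally show ?thesis .
  qed
  moreover have "?l \<ge> 0" using le t by auto
  ultimately have "t powr (-a) * ?l \<le> 2 * ?r"
    using 1 by (intro mult_mono) auto
  moreover have "0 \<le> 4 * (indicator {0..1} t * t powr (-a))" by simp
  ultimately show ?thesis unfolding times_divide_eq_right by linarith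
qed

lemma forelli_rudin_radial:
  fixes a v \<rho> :: real
  assumes a: "0 \<le> a" "a < 1" and v: "0 < v" "v < 1" and \<rho>: "0 \<le> \<rho>" "\<rho> < 1"
  shows "(\<integral>\<^sup>+t. indicator {0<..<1} t * ennreal (t powr (-a) * (1 - t) powr (-v) / (1 - \<rho> * t)) \<partial>lborel)
    \<le> ennreal ((4 / (1 - a) + 2 * (1 / (1 - v) + 1 / v)) * (1 - \<rho>) powr (-v))"
proof -
  let ?e = "1 - \<rho>"
  have e: "0 < ?e" "?e \<le> 1" using \<rho> by auto
  have I1: "(\<integral>\<^sup>+t. indicator {0..1} t * ennreal (t powr (-a)) \<partial>lborel) = ennreal (1 / (1 - a))"
    using nn_integral_powr_0[of a 1] a by simp
  have shift: "(\<integral>\<^sup>+t. f (1 - t) \<partial>lborel) = (\<integral>\<^sup>+t. f t \<partial>lborel)" if "f \<in> borel_measurable borel" for f :: "real \<Rightarrow> ennreal"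
    using nn_integral_real_affine[OF that, of "-1" 1] by simp
  have I2: "(\<integral>\<^sup>+t. indicator {0..?e} (1 - t) * ennreal ((1 - t) powr (-v)) \<partial>lborel) = ennreal (?e powr (1 - v) / (1 - v))"
    using shift[of "\<lambda>s. indicator {0..?e} s * ennreal (s powr (-v))"] nn_integral_powr_0[of v ?e] v e by simp
  have I3: "(\<integral>\<^sup>+t. indicator {?e..} (1 - t) * ennreal ((1 - t) powr (-v-1)) \<partial>lborel) = ennreal (?e powr (-v) / v)"
    using shift[of "\<lambda>s. indicator {?e..} s * ennreal (s powr (-v-1))"] nn_integral_powr_inf[of v ?e] v e by simp
  have "(\<integral>\<^sup>+t. indicator {0<..<1} t * ennreal (t powr (-a) * (1 - t) powr (-v) / (1 - \<rho> * t)) \<partial>lborel) \<le>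
     (\<integral>\<^sup>+t. ennreal 4 * (indicator {0..1} t * ennreal (t powr (-a))) + ennreal 2 * (ennreal (1 / ?e) * (indicator {0..?e} (1 - t) * ennreal ((1 - t) powr (-v))) + indicator {?e..} (1 - t) * ennreal ((1 - t) powr (-v - 1))) \<partial>lborel)"
  proof (intro nn_integral_mono)
    fix t :: real
    have eq: "ennreal 4 * (indicator {0..1} t * ennreal (t powr (-a))) + ennreal 2 * (ennreal (1 / ?e) * (indicator {0..?e} (1 - t) * ennreal ((1 - t) powr (-v))) + indicator {?e..} (1 - t) * ennreal ((1 - t) powr (-v - 1))) =
      ennreal (4 * (indicator {0..1} t * t powr (-a)) + 2 * (indicator {0..1 - \<rho>} (1 - t) * (1 - t) powr (-v) / (1 - \<rho>) + indicator {1 - \<rho>..} (1 - t) * (1 - t) powr (-v - 1)))"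
    proof -
      have ind: "indicator S r * ennreal z = ennreal (indicator S r * z)" for S and r z :: real
        by (simp add: indicator_def)
      have "ennreal 4 * ennreal X + ennreal 2 * (ennreal (1 / ?e) * ennreal Y + ennreal Z) = ennreal (4 * X + 2 * (Y / ?e + Z))"
        if "0 \<le> X" "0 \<le> Y" "0 \<le> Z" for X Y Z
        using that e by (simp add: ennreal_mult[symmetric] ennreal_plus[symmetric] del: ennreal_plus ennreal_numeral)
      from this[of "indicator {0..1} t * t powr (-a)" "indicator {0..1 - \<rho>} (1 - t) * (1 - t) powr (-v)" "indicator {1 - \<rho>..} (1 - t) * (1 - t) powr (-v - 1)"]
      show ?thesis unfolding ind by simp
    qed
    show "indicator {0<..<1} t * ennreal (t powr (-a) * (1 - t) powr (-v) / (1 - \<rho> * t)) \<le> 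
      ennreal 4 * (indicator {0..1} t * ennreal (t powr (-a))) + ennreal 2 * (ennreal (1 / ?e) * (indicator {0..?e} (1 - t) * ennreal ((1 - t) powr (-v))) + indicator {?e..} (1 - t) * ennreal ((1 - t) powr (-v - 1)))"
    proof (cases "0 < t \<and> t < 1")
      case True
      then have i: "indicator {0<..<1} t = (1::ennreal)" by simp
      show ?thesis unfolding eq i mult_1
        by (rule ennreal_leI, rule forelli_rudin_pointwise) (use True assms in auto)
    next
      case False
      then show ?thesis by auto
    qed
  qed
  also have "\<dots> = ennreal 4 * ennreal (1 / (1 - a)) + ennreal 2 * (ennreal (1 / ?e) * ennreal (?e powr (1 - v) / (1 - v)) + ennreal (?e powr (-v) / v))"
    unfolding I1[symmetric] I2[symmetric] I3[symmetric]
    by (subst nn_integral_add, measurable, subst (1 2) nn_integral_cmult, measurable, subst nn_integral_add, measurable, subst nn_integral_cmult, measurable)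
  also have "\<dots> = ennreal (4 * (1 / (1 - a)) + 2 * (1 / ?e * (?e powr (1 - v) / (1 - v)) + ?e powr (-v) / v))"
    using a v e by (simp add: ennreal_mult[symmetric] ennreal_plus[symmetric] del: ennreal_plus ennreal_numeral)
  also have "1 / ?e * (?e powr (1 - v) / (1 - v)) = ?e powr (-v) / (1 - v)"
    using e by (simp add: powr_diff powr_minus field_simps)
  also have "4 * (1 / (1 - a)) + 2 * (?e powr (-v) / (1 - v) + ?e powr (-v) / v) \<le> 
      4 / (1 - a) * ?e powr (-v) + 2 * (?e powr (-v) / (1 - v) + ?e powr (-v) / v)"
  proof -
    have "1 \<le> ?e powr (-v)" using e v powr_mono2'[of "-v" ?e 1] by simp
    then have "4 / (1 - a) * 1 \<le> 4 / (1 - a) * ?e powr (-v)" using a by (intro mult_left_mono) auto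
    then show ?thesis by simp
  qed
  also have "\<dots> = (4 / (1 - a) + 2 * (1 / (1 - v) + 1 / v)) * ?e powr (-v)"
    by (simp add: algebra_simps)
  finally show ?thesis by (simp add: ennreal_leI)
qed

lemma cmod_less_imp_square_less: "cmod y < 1 \<Longrightarrow> (cmod y)\<^sup>2 < 1"
  by (simp add: power_less_one_iff)

lemma poisson_kernel_formula:
  assumes "cmod w < 1"
  shows "1 / (cmod (1 - w))\<^sup>2 = Re ((1 + w) / (1 - w)) / (1 - (cmod w)\<^sup>2)"
proof -
  have nz: "1 - w \<noteq> 0" using assms by auto
  have "(1 + w) / (1 - w) = (1 + w) * cnj (1 - w) / of_real ((cmod (1 - w))\<^sup>2)"
    unfolding complex_norm_square using nz by (subst nonzero_mult_divide_mult_cancel_right) simp_all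
  then have "Re ((1 + w) / (1 - w)) = Re ((1 + w) * cnj (1 - w)) / (cmod (1 - w))\<^sup>2"
    by (simp del: of_real_power)
  also have "Re ((1 + w) * cnj (1 - w)) = 1 - (cmod w)\<^sup>2"
    by (simp add: cmod_def power2_eq_square algebra_simps)
  finally show ?thesis using cmod_less_imp_square_less[OF assms] by simp
qed

text \<open>
  The Poisson kernel gives
  \<open>1 / \<bar>1 - w\<bar>\<^sup>2 = Re ((1 + w) / (1 - w)) / (1 - \<bar>w\<bar>\<^sup>2)\<close>, whose last factor is radial in \<open>y\<close> if
  \<open>w = (x cnj y) ^ m\<close>. So the angular integration disappears and a radial integral with
  denominator \<open>1 - \<bar>x y\<bar> ^ (2 m) \<ge> 1 - \<bar>x\<bar>\<^sup>2 \<bar>y\<bar>\<^sup>2\<close> remains. The condition \<open>u < 2\<close> is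
  integrability at the origin. The constant does not depend on \<open>m\<close>.
\<close>
lemma forelli_rudin_disc:
  fixes u v :: real
  assumes u: "0 \<le> u" "u < 2" and v: "0 < v" "v < 1"
  obtains C where "C > 0" "\<And>x m. cmod x < 1 \<Longrightarrow> m > 0 \<Longrightarrow>
    (\<integral>\<^sup>+y. ennreal (cmod y powr (-u) * (1 - (cmod y)\<^sup>2) powr (-v) / (cmod (1 - (x * cnj y) ^ m))\<^sup>2) \<partial>disc_measure)
      \<le> ennreal (C * (1 - (cmod x)\<^sup>2) powr (-v))"
proof
  let ?C = "pi * (4 / (1 - u/2) + 2 * (1 / (1 - v) + 1 / v))"
  show "?C > 0" using u v by (auto intro!: mult_pos_pos add_pos_pos)
  fix x :: complex and m :: nat assume x: "cmod x < 1" and m: "m > 0"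
  have x2: "(cmod x)\<^sup>2 < 1" using cmod_less_imp_square_less[OF x] .
  let ?q = "\<lambda>y. Re ((1 + (x * cnj y) ^ m) / (1 - (x * cnj y) ^ m))"
  let ?I = "\<integral>\<^sup>+y. ennreal (cmod y powr (-u) * (1 - (cmod y)\<^sup>2) powr (-v) / (cmod (1 - (x * cnj y) ^ m))\<^sup>2) \<partial>disc_measure"
  \<comment> \<open>the radial factors of the integrand; \<open>\<phi>\<close> is a majorant in terms of \<open>t = r\<^sup>2\<close>\<close>
  define \<psi> where "\<psi> r = r powr (-u) * (1 - r\<^sup>2) powr (-v) / (1 - (cmod x * r) ^ (2 * m))" for r :: real
  define \<phi> where "\<phi> t = t powr (-(u/2)) * (1 - t) powr (-v) / (1 - (cmod x)\<^sup>2 * t)" for t :: real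
  have [measurable]: "\<psi> \<in> borel_measurable borel" "\<phi> \<in> borel_measurable borel"
    unfolding \<psi>_def[abs_def] \<phi>_def[abs_def] by measurable
  have \<psi>0: "0 \<le> \<psi> (cmod y)" and \<psi>\<phi>: "\<psi> (cmod y) \<le> \<phi> ((cmod y)\<^sup>2)" if y: "y \<noteq> 0" "cmod y < 1" for y
  proof -
    have xy: "0 \<le> cmod x * cmod y" "cmod x * cmod y < 1"
      using x y norm_ge_zero[of x] mult_strict_mono'[of "cmod x" 1 "cmod y" 1] by auto
    have lt: "(cmod x * cmod y) ^ (2 * m) \<le> (cmod x * cmod y)\<^sup>2"
      using xy m by (intro power_decreasing) auto
    have lt1: "(cmod x * cmod y)\<^sup>2 < 1" using xy by (simp add: power_less_one_iff)
    show "0 \<le> \<psi> (cmod y)" unfolding \<psi>_def using lt lt1 by (intro divide_nonneg_nonneg mult_nonneg_nonneg) auto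
    have "\<psi> (cmod y) \<le> cmod y powr (-u) * (1 - (cmod y)\<^sup>2) powr (-v) / (1 - (cmod x * cmod y)\<^sup>2)"
      unfolding \<psi>_def using lt lt1 by (intro divide_left_mono mult_pos_pos) auto
    also have "cmod y powr (-u) = (cmod y)\<^sup>2 powr (-(u/2))"
    proof -
      have "(cmod y)\<^sup>2 = cmod y powr 2" using y by simp
      then show ?thesis by (simp only: powr_powr) simp
    qed
    finally show "\<psi> (cmod y) \<le> \<phi> ((cmod y)\<^sup>2)" by (simp add: \<phi>_def power_mult_distrib)
  qed
  have "(\<integral>\<^sup>+y. ennreal (\<psi> (cmod y)) \<partial>disc_measure) \<le> (\<integral>\<^sup>+y. ennreal (\<phi> ((cmod y)\<^sup>2)) \<partial>disc_measure)"
    by (intro nn_integral_mono_AE eventually_mono[OF AE_disc_measure]) (use \<psi>\<phi> in \<open>auto intro: ennreal_leI\<close>)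
  also have "\<dots> = ennreal pi * (\<integral>\<^sup>+t. indicator {0<..<1} t * ennreal (\<phi> t) \<partial>lborel)"
    by (rule nn_integral_disc_measure_radial) measurable
  also have "\<dots> \<le> ennreal pi * ennreal ((4 / (1 - u/2) + 2 * (1 / (1 - v) + 1 / v)) * (1 - (cmod x)\<^sup>2) powr (-v))"
    unfolding \<phi>_def using u v x2 by (intro mult_left_mono forelli_rudin_radial) auto
  also have "\<dots> = ennreal (?C * (1 - (cmod x)\<^sup>2) powr (-v))"
    by (simp add: ennreal_mult'[symmetric] mult.assoc)
  finally have B: "(\<integral>\<^sup>+y. ennreal (\<psi> (cmod y)) \<partial>disc_measure) \<le> ennreal (?C * (1 - (cmod x)\<^sup>2) powr (-v))" .
  have AE0: "AE y in disc_measure. 0 \<le> \<psi> (cmod y)"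
    by (intro eventually_mono[OF AE_disc_measure]) (use \<psi>0 in auto)
  have int: "integrable disc_measure (\<lambda>y. \<psi> (cmod y))"
    using B AE0 by (intro integrableI_nonneg) (auto intro: le_less_trans)
  have eq: "cmod y powr (-u) * (1 - (cmod y)\<^sup>2) powr (-v) / (cmod (1 - (x * cnj y) ^ m))\<^sup>2 = 
     \<psi> (cmod y) * ?q y" if y: "y \<noteq> 0" "cmod y < 1" for y
  proof -
    have "cmod (x * cnj y) < 1" using cmod_mult_cnj_less[OF x y(2)] .
    then have "cmod ((x * cnj y) ^ m) < 1" using m unfolding norm_power by (simp add: power_less_one_iff)
    note P = poisson_kernel_formula[OF this]
    have e: "(cmod ((x * cnj y) ^ m))\<^sup>2 = (cmod x * cmod y) ^ (2 * m)"
      by (simp only: norm_power norm_mult complex_mod_cnj power_mult[symmetric] mult.commute[of m])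
    have "a / N = a * (R / D)" if "1 / N = R / D" for a N R D :: real
      using that by (metis mult.right_neutral times_divide_eq_right)
    from this[OF P] show ?thesis unfolding e \<psi>_def by simp
  qed
  have "?I
     = (\<integral>\<^sup>+y. ennreal (\<psi> (cmod y) * ?q y) \<partial>disc_measure)"
    by (intro nn_integral_cong_AE eventually_mono[OF AE_disc_measure]) (use eq in auto)
  also have "\<dots> = ennreal (LINT y|disc_measure. \<psi> (cmod y) * ?q y)"
  proof (rule nn_integral_eq_integral)
    show "integrable disc_measure (\<lambda>y. \<psi> (cmod y) * ?q y)"
      by (rule integral_disc_radial_poisson(2)[OF _ int x m]) measurable
    show "AE y in disc_measure. 0 \<le> \<psi> (cmod y) * ?q y"
    proof (intro eventually_mono[OF AE_disc_measure])
      fix y :: complex assume "y \<noteq> 0 \<and> cmod y < 1"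
      then show "0 \<le> \<psi> (cmod y) * ?q y"
        by (subst eq[symmetric]) auto
    qed
  qed
  also have "\<dots> = ennreal (LINT y|disc_measure. \<psi> (cmod y))"
    by (subst integral_disc_radial_poisson(1)[OF _ int x m]) simp_all
  also have "\<dots> = (\<integral>\<^sup>+y. ennreal (\<psi> (cmod y)) \<partial>disc_measure)"
    by (rule nn_integral_eq_integral[symmetric, OF int AE0])
  also note B
  finally show "?I
      \<le> ennreal (?C * (1 - (cmod x)\<^sup>2) powr (-v))" .
qed


section \<open>The reproducing formula in several variables\<close>

definition polydisc_measure :: "(complex ^ 'n::finite) measure" where
  "polydisc_measure = density lborel (indicator punctured_polydisc)"

lemma sets_polydisc_measure [simp, measurable_cong]: "sets polydisc_measure = sets borel"
  by (simp add: polydisc_measure_def)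

lemma space_polydisc_measure [simp]: "space polydisc_measure = UNIV"
  by (simp add: polydisc_measure_def)

lemma nn_integral_polydisc_measure:
  "f \<in> borel_measurable borel \<Longrightarrow> (\<integral>\<^sup>+y. f y \<partial>polydisc_measure) = (\<integral>\<^sup>+y. indicator punctured_polydisc y * f y \<partial>lborel)"
  by (simp add: polydisc_measure_def nn_integral_density)

lemma emeasure_polydisc_measure: "emeasure (polydisc_measure :: (complex ^ 'n::finite) measure) UNIV = ennreal (pi ^ CARD('n))"
  by (simp add: polydisc_measure_def emeasure_density emeasure_punctured_polydisc)

lemma finite_measure_polydisc: "finite_measure polydisc_measure"
  by (rule finite_measureI) (simp add: emeasure_polydisc_measure)

lemma AE_polydisc_measure: "AE y in polydisc_measure. y \<in> punctured_polydisc"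
  unfolding polydisc_measure_def by (subst AE_density) (auto simp: indicator_def)

lemma polydisc_measure_eq_density:
  "(polydisc_measure :: (complex ^ 'n::finite) measure) = density lborel (\<lambda>x. \<Prod>i\<in>UNIV. indicator (ball 0 1 - {0}) (x $ i))"
proof -
  have "indicator punctured_polydisc x = (\<Prod>i\<in>UNIV. indicator (ball 0 1 - {0}) (x $ i) :: ennreal)" for x :: "complex ^ 'n"
    by (auto simp: indicator_def punctured_polydisc_def)
  then show ?thesis
    unfolding polydisc_measure_def by (intro arg_cong[where f="density lborel"] ext)
qed

lemma polydisc_measure_eq_PiM:
  "(polydisc_measure :: (complex ^ 'n::finite) measure) = distr (PiM UNIV (\<lambda>_. disc_measure)) borel (\<lambda>f. \<chi> i. f i)"
  unfolding polydisc_measure_eq_density disc_measure_def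
  by (rule density_lborel_eq_PiM) (auto simp: indicator_def)

lemma nn_integral_polydisc_prod:
  fixes f :: "'n::finite \<Rightarrow> complex \<Rightarrow> ennreal"
  assumes [measurable]: "\<And>i. f i \<in> borel_measurable borel"
  shows "(\<integral>\<^sup>+y. (\<Prod>i\<in>UNIV. f i (y $ i)) \<partial>polydisc_measure) = (\<Prod>i\<in>UNIV. \<integral>\<^sup>+y. f i y \<partial>disc_measure)"
proof -
  interpret product_sigma_finite "\<lambda>_::'n. disc_measure"
    by (simp add: product_sigma_finite_def sigma_finite_disc_measure)
  have [measurable_cong]: "sets (PiM UNIV (\<lambda>_::'n. disc_measure)) = sets (PiM UNIV (\<lambda>_. borel))"
    by (intro sets_PiM_cong) auto
  show ?thesis
    by (subst polydisc_measure_eq_PiM, subst nn_integral_distr) (simp_all add: product_nn_integral_prod)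
qed

definition upd :: "complex ^ 'n \<Rightarrow> 'n \<Rightarrow> complex \<Rightarrow> complex ^ 'n::finite" where
  "upd y j u = (\<chi> i. if i = j then u else y $ i)"

lemma upd_nth: "upd y j u $ i = (if i = j then u else y $ i)"
  by (simp add: upd_def)

lemma upd_self [simp]: "upd y j (y $ j) = y"
  by (simp add: upd_def vec_eq_iff)

lemma measurable_upd [measurable]: "(\<lambda>u. upd y j u) \<in> borel_measurable borel"
  unfolding upd_def by measurable

text \<open>
  The formula for the disc is applied to the coordinates one after another, by induction over the
  set of coordinates that have been integrated. The coordinates not yet integrated are frozen at
  those of \<open>x\<close>, so the set \<open>S\<close> of points that occur is a polydisc, without its coordinate hyperplanes
  except those through \<open>x\<close>. This covers both uses: \<open>x = 0\<close> for the mean value property, and \<open>x\<close> with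
  nonzero coordinates for functions with removable singularities. Boundedness makes every
  iterated integral exist.
\<close>
lemma polydisc_reproducing_slices:
  fixes F :: "complex ^ 'n::finite \<Rightarrow> complex"
  assumes F [measurable]: "F \<in> borel_measurable borel"
    and x: "\<And>i. cmod (x $ i) < 1"
    and S: "S = {y. \<forall>i. y $ i \<noteq> 0 \<and> cmod (y $ i) < 1 \<or> y $ i = x $ i}"
    and M: "\<And>y. y \<in> S \<Longrightarrow> cmod (F y) \<le> M"
    and slice: "\<And>y j. y \<in> S \<Longrightarrow> \<exists>R>1. \<exists>g. g holomorphic_on ball 0 R \<and> (\<forall>u. upd y j u \<in> S \<longrightarrow> F (upd y j u) = g u)"
  shows "(LINT y|polydisc_measure. F y * (\<Prod>i\<in>UNIV. 1 / (1 - x $ i * cnj (y $ i))\<^sup>2)) = of_real pi ^ CARD('n) * F x"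
proof -
  interpret P: product_sigma_finite "\<lambda>_::'n. disc_measure"
    by (simp add: product_sigma_finite_def sigma_finite_disc_measure)
  have [measurable_cong]: "sets (PiM I (\<lambda>_::'n. disc_measure)) = sets (PiM I (\<lambda>_. borel))" for I
    by (intro sets_PiM_cong) auto
  have "{y \<in> space borel. \<forall>i. y $ i \<noteq> 0 \<and> cmod (y $ i) < 1 \<or> y $ i = x $ i} \<in> sets (borel :: (complex ^ 'n) measure)"
    by measurable
  then have [measurable]: "S \<in> sets borel" by (simp add: S)
  have xS: "x \<in> S" by (simp add: S)
  have M0: "0 \<le> M" using M[OF xS] norm_ge_zero[of "F x"] by linarith
  \<comment> \<open>with \<open>F\<close> set to zero outside \<open>S\<close> the inductive claim holds for all frozen coordinates\<close>
  define F' where "F' y = (if y \<in> S then F y else 0)" for y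
  have [measurable]: "F' \<in> borel_measurable borel" unfolding F'_def[abs_def] by measurable
  have F'M: "cmod (F' y) \<le> M" for y using M M0 by (simp add: F'_def)
  define k where "k i u = (if cmod u < 1 then 1 / (1 - x $ i * cnj u)\<^sup>2 else 0)" for i u
  have [measurable]: "k i \<in> borel_measurable borel" for i unfolding k_def[abs_def] by measurable
  have kb: "cmod (k i u) \<le> 1 / (1 - cmod (x $ i))\<^sup>2" for i u
  proof (cases "cmod u < 1")
    case True
    then have "(1 - cmod (x $ i))\<^sup>2 \<le> (cmod (1 - x $ i * cnj u))\<^sup>2"
      using x[of i] by (intro power_mono cmod_one_minus_ge) auto
    moreover have "0 < (1 - cmod (x $ i))\<^sup>2" using x[of i] by simp
    ultimately show ?thesis using True unfolding k_def by (simp add: norm_divide norm_power frac_le)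
  qed (simp add: k_def)
  define m where "m I f = (\<chi> i. if i \<in> I then f i else x $ i)" for I and f :: "'n \<Rightarrow> complex"
  have mm [measurable]: "m I \<in> PiM I (\<lambda>_. borel) \<rightarrow>\<^sub>M borel" for I
  proof -
    have "(\<lambda>f. if i \<in> I then f i else x $ i) \<in> PiM I (\<lambda>_. borel) \<rightarrow>\<^sub>M borel" for i
      by (cases "i \<in> I") simp_all
    then show ?thesis unfolding m_def[abs_def] by (rule borel_measurable_vec_lambda)
  qed
  have one: "(LINT u|disc_measure. F' (upd y j u) * k j u) = of_real pi * F' (upd y j (x $ j))" for y j
  proof (cases "\<forall>i. i \<noteq> j \<longrightarrow> (y $ i \<noteq> 0 \<and> cmod (y $ i) < 1 \<or> y $ i = x $ i)")
    case True
    have yS: "upd y j u \<in> S \<longleftrightarrow> u \<noteq> 0 \<and> cmod u < 1 \<or> u = x $ j" for u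
      using True by (auto simp: S upd_nth)
    then have "upd y j (x $ j) \<in> S" by simp
    from slice[OF this, of j] obtain R g where R: "R > 1" "g holomorphic_on ball 0 R"
      and g: "\<And>u. upd (upd y j (x $ j)) j u \<in> S \<Longrightarrow> F (upd (upd y j (x $ j)) j u) = g u" by blast
    have "upd (upd y j (x $ j)) j u = upd y j u" for u by (simp add: upd_def vec_eq_iff)
    then have g': "F' (upd y j u) = g u" if "u \<noteq> 0 \<and> cmod u < 1 \<or> u = x $ j" for u
      using g[of u] yS[of u] that by (simp add: F'_def)
    have "(LINT u|disc_measure. F' (upd y j u) * k j u) = (LINT u|disc_measure. F' (upd y j u) / (1 - x $ j * cnj u)\<^sup>2)"
      by (intro integral_cong_AE) (auto intro!: eventually_mono[OF AE_disc_measure] simp: k_def)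
    also have "\<dots> = of_real pi * g (x $ j)"
      by (rule bergman_disc_reproducing[OF x R]) (use g' in auto)
    finally show ?thesis using g' by simp
  next
    case False
    then have "upd y j u \<notin> S" for u by (auto simp: S upd_nth)
    then show ?thesis by (simp add: F'_def)
  qed
  have fin: "finite_measure (PiM I (\<lambda>_::'n. disc_measure))" for I
  proof (rule finite_measureI)
    have "emeasure (PiM I (\<lambda>_::'n. disc_measure)) (Pi\<^sub>E I (\<lambda>_. UNIV)) = (\<Prod>i\<in>I. ennreal pi)"
      by (subst P.emeasure_PiM) (auto simp: emeasure_disc_measure)
    then show "emeasure (PiM I (\<lambda>_::'n. disc_measure)) (space (PiM I (\<lambda>_::'n. disc_measure))) \<noteq> \<infinity>"
      by (simp add: space_PiM ennreal_power)
  qed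
  have int: "integrable (PiM I (\<lambda>_::'n. disc_measure)) (\<lambda>f. F' (m I f) * (\<Prod>i\<in>I. k i (f i)))" for I
  proof (rule finite_measure.integrable_const_bound[OF fin])
    show "AE f in PiM I (\<lambda>_::'n. disc_measure). cmod (F' (m I f) * (\<Prod>i\<in>I. k i (f i))) \<le> M * (\<Prod>i\<in>I. 1 / (1 - cmod (x $ i))\<^sup>2)"
      unfolding norm_mult prod_norm[symmetric] using kb F'M M0
      by (intro AE_I2 mult_mono prod_mono prod_nonneg) auto
  qed measurable
  have "(LINT f|PiM I (\<lambda>_. disc_measure). F' (m I f) * (\<Prod>i\<in>I. k i (f i))) = of_real pi ^ card I * F x" for I
    using finite[of I]
  proof (induction I rule: finite_induct)
    case empty
    have "m {} f = x" for f by (simp add: m_def)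
    then show ?case using xS by (simp add: PiM_empty F'_def lebesgue_integral_count_space_finite)
  next
    case (insert j I)
    have "(LINT f|PiM (insert j I) (\<lambda>_. disc_measure). F' (m (insert j I) f) * (\<Prod>i\<in>insert j I. k i (f i))) =
      (LINT f|PiM I (\<lambda>_. disc_measure). (LINT u|disc_measure. F' (m (insert j I) (f(j := u))) * (\<Prod>i\<in>insert j I. k i ((f(j := u)) i))))"
      by (rule P.product_integral_insert[OF insert(1,2) int])
    also have "\<dots> = (LINT f|PiM I (\<lambda>_. disc_measure). of_real pi * (F' (m I f) * (\<Prod>i\<in>I. k i (f i))))"
    proof (intro Bochner_Integration.integral_cong refl)
      fix f :: "'n \<Rightarrow> complex"
      have "m (insert j I) (f(j := u)) = upd (m I f) j u" for u
        by (auto simp: m_def upd_def vec_eq_iff)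
      moreover have "(\<Prod>i\<in>insert j I. k i ((f(j := u)) i)) = k j u * (\<Prod>i\<in>I. k i (f i))" for u
        using insert(1,2) by (simp, intro disjI2 prod.cong) auto
      moreover have "m I f $ j = x $ j" using insert(2) by (simp add: m_def)
      then have "upd (m I f) j (x $ j) = m I f" by (metis upd_self)
      ultimately have "(LINT u|disc_measure. F' (m (insert j I) (f(j := u))) * (\<Prod>i\<in>insert j I. k i ((f(j := u)) i))) =
          (LINT u|disc_measure. (F' (upd (m I f) j u) * k j u) * (\<Prod>i\<in>I. k i (f i)))"
        by (simp add: mult_ac)
      also have "\<dots> = (LINT u|disc_measure. F' (upd (m I f) j u) * k j u) * (\<Prod>i\<in>I. k i (f i))"
        by (rule integral_mult_left_zero)
      also have "\<dots> = of_real pi * (F' (m I f) * (\<Prod>i\<in>I. k i (f i)))"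
        unfolding one using \<open>upd (m I f) j (x $ j) = m I f\<close> by simp
      finally show "(LINT u|disc_measure. F' (m (insert j I) (f(j := u))) * (\<Prod>i\<in>insert j I. k i ((f(j := u)) i))) = of_real pi * (F' (m I f) * (\<Prod>i\<in>I. k i (f i)))" .
    qed
    also have "\<dots> = of_real pi ^ card (insert j I) * F x"
      using insert by simp
    finally show ?case .
  qed
  from this[of UNIV] have main: "(LINT f|PiM UNIV (\<lambda>_. disc_measure). F' (\<chi> i. f i) * (\<Prod>i\<in>UNIV. k i (f i))) = of_real pi ^ CARD('n) * F x"
    by (simp add: m_def)
  have "(LINT y|polydisc_measure. F y * (\<Prod>i\<in>UNIV. 1 / (1 - x $ i * cnj (y $ i))\<^sup>2)) =
     (LINT y|polydisc_measure. F' y * (\<Prod>i\<in>UNIV. k i (y $ i)))"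
  proof (intro integral_cong_AE eventually_mono[OF AE_polydisc_measure])
    fix y :: "complex ^ 'n" assume "y \<in> punctured_polydisc"
    then have "y \<in> S" "\<And>i. cmod (y $ i) < 1" by (auto simp: S punctured_polydisc_def)
    then show "F y * (\<Prod>i\<in>UNIV. 1 / (1 - x $ i * cnj (y $ i))\<^sup>2) = F' y * (\<Prod>i\<in>UNIV. k i (y $ i))"
      by (simp add: F'_def k_def)
  qed measurable
  also have "\<dots> = (LINT f|PiM UNIV (\<lambda>_. disc_measure). F' (\<chi> i. f i) * (\<Prod>i\<in>UNIV. k i (f i)))"
    by (subst polydisc_measure_eq_PiM, subst integral_distr) simp_all
  finally show ?thesis using main by simp
qed

section \<open>Square-integrable functions on the punctured polydisc\<close>

lemma distr_lborel_complex_affine: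
  assumes "r > 0"
  shows "distr lborel borel (\<lambda>y::complex. z + of_real r * y) = density lborel (\<lambda>_. ennreal (1 / r\<^sup>2))"
proof -
  let ?T = "\<lambda>y::complex. z + of_real r * y"
  have T: "?T = (\<lambda>y. z + r *\<^sub>R y)" by (simp add: scaleR_conv_of_real)
  have "lborel = density (distr lborel borel ?T) (\<lambda>_. ennreal (r\<^sup>2))"
    unfolding T using lborel_affine[of r z] assms by (simp add: ennreal_power)
  then have "density lborel (\<lambda>_. ennreal (1 / r\<^sup>2)) = density (density (distr lborel borel ?T) (\<lambda>_. ennreal (r\<^sup>2))) (\<lambda>_. ennreal (1 / r\<^sup>2))"
    by simp
  also have "\<dots> = density (distr lborel borel ?T) (\<lambda>_. ennreal (r\<^sup>2) * ennreal (1 / r\<^sup>2))"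
    by (rule density_density_eq) simp_all
  also have "\<dots> = distr lborel borel ?T"
    using assms by (simp add: ennreal_mult'[symmetric] density_1)
  finally show ?thesis ..
qed

text \<open>
  Used with \<open>r\<close> constant for dilations and with variable \<open>r\<close> for polydiscs around a point.
\<close>
lemma distr_lborel_polydisc_affine:
  assumes r: "\<And>i. r i > 0"
  shows "distr lborel borel (\<lambda>y::complex^'n::finite. \<chi> i. z $ i + of_real (r i) * y $ i) = density lborel (\<lambda>_. ennreal (\<Prod>i\<in>UNIV. 1 / (r i)\<^sup>2))"
proof -
  have "distr lborel borel (\<lambda>y::complex^'n. \<chi> i. z $ i + of_real (r i) * y $ i) = density lborel (\<lambda>x. \<Prod>i\<in>(UNIV::'n set). ennreal (1 / (r i)\<^sup>2))"
    by (rule distr_lborel_componentwise) (use distr_lborel_complex_affine[OF r] in simp_all)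
  then show ?thesis by (simp add: prod_ennreal)
qed

lemma integral_polydisc_measure:
  fixes f :: "complex ^ 'n::finite \<Rightarrow> complex"
  assumes [measurable]: "f \<in> borel_measurable borel"
  shows "(LINT y|polydisc_measure. f y) = (LINT y|lborel. indicator punctured_polydisc y *\<^sub>R f y)"
proof -
  have eq: "(polydisc_measure :: (complex ^ 'n) measure) = density lborel (\<lambda>y. ennreal (indicator punctured_polydisc y))"
    unfolding polydisc_measure_def by (intro arg_cong[where f="density lborel"] ext) (simp add: ennreal_indicator)
  show ?thesis unfolding eq by (rule integral_density) auto
qed

lemma norm_vec_le_sum: "norm (y :: complex ^ 'n::finite) \<le> (\<Sum>i\<in>UNIV. cmod (y $ i))"
  unfolding norm_vec_def by (rule L2_set_le_sum) simp

lemma distr_polydisc_measure_unimodular: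
  assumes c: "\<And>k. cmod (c $ k) = 1"
  shows "distr polydisc_measure borel (\<lambda>w. \<chi> k. c $ k * w $ k) = (polydisc_measure :: (complex ^ 'n) measure)"
proof (rule measure_eqI)
  fix X assume "X \<in> sets (distr polydisc_measure borel (\<lambda>w. \<chi> k. c $ k * w $ k))"
  then have [measurable]: "X \<in> sets borel" by simp
  have c0: "c $ k \<noteq> 0" for k using c[of k] by auto
  have "emeasure (distr polydisc_measure borel (\<lambda>w. \<chi> k. c $ k * w $ k)) X = (\<integral>\<^sup>+y. indicator X (\<chi> k. c $ k * y $ k) \<partial>(polydisc_measure :: (complex ^ 'n) measure))"
    by (subst nn_integral_indicator[symmetric]) (simp_all add: nn_integral_distr del: nn_integral_indicator)
  also have "\<dots> = (\<integral>\<^sup>+y. indicator punctured_polydisc (\<chi> k. c $ k * y $ k) * indicator X (\<chi> k. c $ k * y $ k) \<partial>lborel)"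
    by (subst nn_integral_polydisc_measure) (use c c0 in \<open>auto intro!: nn_integral_cong simp: indicator_def punctured_polydisc_def norm_mult\<close>)
  also have "\<dots> = (\<integral>\<^sup>+y. indicator punctured_polydisc y * indicator X y \<partial>lborel)"
    by (rule nn_integral_unimodular[OF c]) measurable
  also have "\<dots> = emeasure polydisc_measure X"
    by (simp add: polydisc_measure_def emeasure_density)
  finally show "emeasure (distr polydisc_measure borel (\<lambda>w. \<chi> k. c $ k * w $ k)) X = emeasure polydisc_measure X" .
qed simp

text \<open>
  The properties of a pulled back function to which one-variable theory is applied. Continuity
  provides bounds on compact sets.
\<close>
locale punctured_holomorphic =
  fixes F :: "complex ^ 'n::finite \<Rightarrow> complex"
  assumes measurable_F [measurable]: "F \<in> borel_measurable borel"
    and cont: "continuous_on punctured_polydisc F"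
    and slice_holo: "\<And>y j. y \<in> punctured_polydisc \<Longrightarrow> (\<lambda>u. F (upd y j u)) holomorphic_on ball 0 1 - {0}"
    and square_int: "(\<integral>\<^sup>+y. ennreal ((cmod (F y))\<^sup>2) \<partial>polydisc_measure) < \<infinity>"
begin

lemma upd_in_polydisc:
  assumes "y \<in> punctured_polydisc" "u \<noteq> 0" "cmod u < 1"
  shows "upd y j u \<in> punctured_polydisc"
  using assms by (simp add: punctured_polydisc_def upd_nth)

text \<open>
  The mean value property for the function \<open>F\<^sup>2\<close> on a polydisc around \<open>z\<close> whose double still avoids the
  coordinate hyperplanes. Squaring yields a bound by the \<open>L\<^sup>2\<close> norm with the correct power
  of the radii.
\<close>
lemma square_submean:
  assumes z: "z \<in> punctured_polydisc" and r: "\<And>i. r i = min (cmod (z $ i)) (1 - cmod (z $ i)) / 2"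
  shows "ennreal (pi ^ CARD('n) * (\<Prod>i\<in>UNIV. (r i)\<^sup>2) * (cmod (F z))\<^sup>2) \<le>
     (\<integral>\<^sup>+w. indicator {w. \<forall>i. cmod (w $ i - z $ i) < r i} w * ennreal ((cmod (F w))\<^sup>2) \<partial>polydisc_measure)"
proof -
  have r0: "r i > 0" for i using z unfolding r by (simp add: punctured_polydisc_def)
  have D: "z $ i + of_real (r i) * u \<noteq> 0 \<and> cmod (z $ i + of_real (r i) * u) < 1" if "cmod u < 2" for i u
  proof -
    have "cmod (of_real (r i) * u) < 2 * r i" using that r0[of i] by (simp add: norm_mult)
    also have "2 * r i = min (cmod (z $ i)) (1 - cmod (z $ i))" by (simp add: r)
    finally have lt: "cmod (of_real (r i) * u) < min (cmod (z $ i)) (1 - cmod (z $ i))" .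
    have "cmod (z $ i + of_real (r i) * u) < 1"
      using lt norm_triangle_ineq[of "z $ i" "of_real (r i) * u"] by linarith
    moreover have "z $ i + of_real (r i) * u \<noteq> 0"
    proof
      assume "z $ i + of_real (r i) * u = 0"
      then have "cmod (of_real (r i) * u) = cmod (z $ i)"
        by (metis add_eq_0_iff norm_minus_cancel)
      with lt show False by simp
    qed
    ultimately show ?thesis by simp
  qed
  define T where "T y = (\<chi> i. z $ i + of_real (r i) * y $ i)" for y :: "complex ^ 'n"
  have TD: "T y \<in> punctured_polydisc" if "\<And>i. cmod (y $ i) < 2" for y
    using D that by (simp add: T_def punctured_polydisc_def)
  have [measurable]: "T \<in> borel_measurable borel" unfolding T_def[abs_def] by measurable
  have contT: "continuous_on UNIV T" unfolding T_def[abs_def] by (intro continuous_intros)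
  let ?C = "{y :: complex ^ 'n. \<forall>i. cmod (y $ i) \<le> 1}"
  have cC: "compact ?C"
  proof (rule compact_eq_bounded_closed[THEN iffD2], intro conjI)
    have "norm y \<le> (\<Sum>i\<in>(UNIV::'n set). 1)" if "y \<in> ?C" for y
      using norm_vec_le_sum[of y] sum_mono[of UNIV "\<lambda>i. norm (y $ i)" "\<lambda>_. 1"] that by auto
    then show "bounded ?C" by (intro boundedI) auto
    show "closed ?C" by (intro closed_Collect_all closed_Collect_le continuous_intros)
  qed
  have "continuous_on ?C (\<lambda>y. F (T y))"
    by (rule continuous_on_compose2[OF cont continuous_on_subset[OF contT]]) (auto intro!: TD intro: le_less_trans)
  then have "bounded ((\<lambda>y. F (T y)) ` ?C)" using cC by (intro compact_imp_bounded compact_continuous_image)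
  then obtain M where M: "\<And>y. y \<in> ?C \<Longrightarrow> cmod (F (T y)) \<le> M" by (auto simp: bounded_iff)
  have TU: "T (upd y j u) = upd (T y) j (z $ j + of_real (r j) * u)" for y j u
    by (simp add: T_def upd_def vec_eq_iff)
  have "(LINT y|polydisc_measure. (F (T y))\<^sup>2 * (\<Prod>i\<in>UNIV. 1 / (1 - (0::complex^'n) $ i * cnj (y $ i))\<^sup>2)) = of_real pi ^ CARD('n) * (F (T 0))\<^sup>2"
  proof (rule polydisc_reproducing_slices)
    let ?S = "{y :: complex^'n. \<forall>i. y $ i \<noteq> 0 \<and> cmod (y $ i) < 1 \<or> y $ i = 0 $ i}"
    have S: "?S = {y. \<forall>i. cmod (y $ i) < 1}" by (auto; metis norm_zero zero_less_one)
    show "?S = ?S" ..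
    show "cmod ((F (T y))\<^sup>2) \<le> M\<^sup>2" if "y \<in> ?S" for y
      unfolding norm_power using that M[of y] unfolding S by (intro power_mono) (auto intro: less_imp_le)
    show "\<exists>R>1. \<exists>g. g holomorphic_on ball 0 R \<and> (\<forall>u. upd y j u \<in> ?S \<longrightarrow> (F (T (upd y j u)))\<^sup>2 = g u)" if y: "y \<in> ?S" for y j
    proof (intro exI[of _ "2::real"] conjI exI[of _ "\<lambda>u. (F (T (upd y j u)))\<^sup>2"])
      have "T y \<in> punctured_polydisc" using y unfolding S by (intro TD) (auto intro: less_trans)
      from slice_holo[OF this, of j]
      have "((\<lambda>u. F (upd (T y) j u)) \<circ> (\<lambda>u. z $ j + of_real (r j) * u)) holomorphic_on ball 0 2"
        by (intro holomorphic_on_compose_gen[of _ _ _ "ball 0 1 - {0}"] holomorphic_intros) (use D in auto)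
      then show "(\<lambda>u. (F (T (upd y j u)))\<^sup>2) holomorphic_on ball 0 2"
        unfolding TU comp_def by (intro holomorphic_intros)
    qed auto
  qed auto
  moreover have "T 0 = z" by (simp add: T_def vec_eq_iff)
  ultimately have "of_real pi ^ CARD('n) * (F z)\<^sup>2 = (LINT y|polydisc_measure. (F (T y))\<^sup>2)" by simp
  then have "pi ^ CARD('n) * (cmod (F z))\<^sup>2 = cmod (LINT y|polydisc_measure. (F (T y))\<^sup>2)"
    by (simp only: flip: \<open>of_real pi ^ CARD('n) * (F z)\<^sup>2 = _\<close>) (simp add: norm_mult norm_power)
  then have "ennreal (pi ^ CARD('n) * (cmod (F z))\<^sup>2) \<le> (\<integral>\<^sup>+y. ennreal (norm ((F (T y))\<^sup>2)) \<partial>polydisc_measure)"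
    using integral_norm_bound_ennreal[of polydisc_measure "\<lambda>y. (F (T y))\<^sup>2"]
    by (cases "integrable polydisc_measure (\<lambda>y. (F (T y))\<^sup>2)") (auto simp: not_integrable_integral_eq)
  also have "\<dots> = (\<integral>\<^sup>+y. indicator punctured_polydisc y * ennreal ((cmod (F (T y)))\<^sup>2) \<partial>lborel)"
    by (subst nn_integral_polydisc_measure) (simp_all add: norm_power)
  also have "\<dots> \<le> (\<integral>\<^sup>+y. indicator {w. \<forall>i. cmod (w $ i - z $ i) < r i} (T y) * (indicator punctured_polydisc (T y) * ennreal ((cmod (F (T y)))\<^sup>2)) \<partial>lborel)"
  proof (intro nn_integral_mono)
    fix y :: "complex ^ 'n"
    show "indicator punctured_polydisc y * ennreal ((cmod (F (T y)))\<^sup>2) \<le> indicator {w. \<forall>i. cmod (w $ i - z $ i) < r i} (T y) * (indicator punctured_polydisc (T y) * ennreal ((cmod (F (T y)))\<^sup>2))"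
    proof (cases "y \<in> punctured_polydisc")
      case True
      then have "cmod (T y $ i - z $ i) < r i" for i
        using r0[of i] by (simp add: T_def norm_mult punctured_polydisc_def)
      moreover have "T y \<in> punctured_polydisc" using True by (intro TD) (auto simp: punctured_polydisc_def intro: less_trans)
      ultimately show ?thesis using True by simp
    qed simp
  qed
  also have "\<dots> = (\<integral>\<^sup>+w. indicator {w. \<forall>i. cmod (w $ i - z $ i) < r i} w * (indicator punctured_polydisc w * ennreal ((cmod (F w))\<^sup>2)) \<partial>distr lborel borel T)"
    by (subst nn_integral_distr) simp_all
  also have "\<dots> = ennreal (\<Prod>i\<in>UNIV. 1 / (r i)\<^sup>2) * (\<integral>\<^sup>+w. indicator {w. \<forall>i. cmod (w $ i - z $ i) < r i} w * (indicator punctured_polydisc w * ennreal ((cmod (F w))\<^sup>2)) \<partial>lborel)"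
    using distr_lborel_polydisc_affine[OF r0, of z] by (simp add: T_def[abs_def] nn_integral_density nn_integral_cmult)
  also have "(\<integral>\<^sup>+w. indicator {w. \<forall>i. cmod (w $ i - z $ i) < r i} w * (indicator punctured_polydisc w * ennreal ((cmod (F w))\<^sup>2)) \<partial>lborel)
     = (\<integral>\<^sup>+w. indicator {w. \<forall>i. cmod (w $ i - z $ i) < r i} w * ennreal ((cmod (F w))\<^sup>2) \<partial>polydisc_measure)" (is "_ = ?I")
    by (subst nn_integral_polydisc_measure) (simp_all add: mult_ac)
  finally have "ennreal (\<Prod>i\<in>UNIV. (r i)\<^sup>2) * ennreal (pi ^ CARD('n) * (cmod (F z))\<^sup>2) \<le> ennreal (\<Prod>i\<in>UNIV. (r i)\<^sup>2) * (ennreal (\<Prod>i\<in>UNIV. 1 / (r i)\<^sup>2) * ?I)"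
    by (rule mult_left_mono) simp
  also have "\<dots> = ennreal ((\<Prod>i\<in>UNIV. (r i)\<^sup>2) * (\<Prod>i\<in>UNIV. 1 / (r i)\<^sup>2)) * ?I"
    by (simp add: ennreal_mult' prod_nonneg mult.assoc)
  also have "(\<Prod>i\<in>UNIV. (r i)\<^sup>2) * (\<Prod>i\<in>UNIV. 1 / (r i)\<^sup>2) = 1"
    using r0 by (simp add: prod.distrib[symmetric] less_imp_neq[symmetric])
  finally show ?thesis by (simp add: ennreal_mult'[symmetric] mult_ac prod_nonneg)
qed

text \<open>
  By \<open>square_submean\<close> the square of \<open>u F\<close> is bounded by the integral of \<open>\<bar>F\<bar>\<^sup>2\<close> over
  \<open>{w. \<bar>w\<^sub>j\<bar> < 2 \<bar>u\<bar>}\<close>, and this tends to \<open>0\<close> because \<open>F\<close> is square-integrable.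
\<close>
lemma slice_limit:
  assumes y: "y \<in> punctured_polydisc"
  shows "((\<lambda>u. u * F (upd y j u)) \<longlongrightarrow> 0) (at 0)"
proof -
  define I where "I \<delta> = (\<integral>\<^sup>+w. indicator {w. cmod (w $ j) < \<delta>} w * ennreal ((cmod (F w))\<^sup>2) \<partial>polydisc_measure)" for \<delta>
  define q where "q i = min (cmod (y $ i)) (1 - cmod (y $ i)) / 2" for i
  have q0: "q i > 0" for i using y by (simp add: punctured_polydisc_def q_def)
  \<comment> \<open>the radii in the coordinates other than \<open>j\<close> do not depend on \<open>u\<close>, and the \<open>j\<close>-th radius is \<open>\<bar>u\<bar> / 2\<close>\<close>
  define c where "c = pi ^ CARD('n) * (\<Prod>i\<in>UNIV - {j}. (q i)\<^sup>2) / 4"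
  have c0: "c > 0" unfolding c_def using q0 by (auto intro!: prod_pos mult_pos_pos simp: less_imp_neq[symmetric])
  have bound: "ennreal (c * (cmod (u * F (upd y j u)))\<^sup>2) \<le> I (2 * cmod u)" if u: "u \<noteq> 0" "cmod u < 1/2" for u
  proof -
    let ?z = "upd y j u"
    have z: "?z \<in> punctured_polydisc" using upd_in_polydisc[OF y u(1)] u(2) by simp
    define r where "r i = min (cmod (?z $ i)) (1 - cmod (?z $ i)) / 2" for i
    have rj: "r j = cmod u / 2" using u by (simp add: r_def upd_nth)
    have ri: "r i = q i" if "i \<noteq> j" for i using that by (simp add: r_def q_def upd_nth)
    have "(\<Prod>i\<in>UNIV. (r i)\<^sup>2) = (r j)\<^sup>2 * (\<Prod>i\<in>UNIV - {j}. (r i)\<^sup>2)"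
      by (rule prod.remove) auto
    also have "(\<Prod>i\<in>UNIV - {j}. (r i)\<^sup>2) = (\<Prod>i\<in>UNIV - {j}. (q i)\<^sup>2)"
      by (rule prod.cong) (auto simp: ri)
    finally have "c * (cmod (u * F ?z))\<^sup>2 = pi ^ CARD('n) * (\<Prod>i\<in>UNIV. (r i)\<^sup>2) * (cmod (F ?z))\<^sup>2"
      by (simp add: rj c_def norm_mult power_mult_distrib power_divide)
    also have "ennreal \<dots> \<le> (\<integral>\<^sup>+w. indicator {w. \<forall>i. cmod (w $ i - ?z $ i) < r i} w * ennreal ((cmod (F w))\<^sup>2) \<partial>polydisc_measure)"
      by (rule square_submean[OF z r_def])
    also have "\<dots> \<le> I (2 * cmod u)" unfolding I_def
    proof (intro nn_integral_mono mult_right_mono)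
      fix w :: "complex ^ 'n"
      have "cmod (w $ j) < 2 * cmod u" if "\<forall>i. cmod (w $ i - ?z $ i) < r i"
      proof -
        have "cmod (w $ j - u) < cmod u / 2" using that rj by (metis upd_nth)
        moreover have "cmod u > 0" using u by simp
        ultimately show ?thesis using norm_triangle_ineq2[of "w $ j" u] by linarith
      qed
      then show "indicator {w. \<forall>i. cmod (w $ i - ?z $ i) < r i} w \<le> (indicator {w. cmod (w $ j) < 2 * cmod u} w :: ennreal)"
        by (auto simp: indicator_def)
    qed simp
    finally show ?thesis .
  qed
  show ?thesis
  proof (subst tendsto_at_iff_sequentially, intro allI impI)
    fix X :: "nat \<Rightarrow> complex" assume X0: "\<forall>i. X i \<in> UNIV - {0}" and X: "X \<longlonglongrightarrow> 0"
    have "(\<lambda>n. I (2 * cmod (X n))) \<longlonglongrightarrow> (\<integral>\<^sup>+w. 0 \<partial>(polydisc_measure :: (complex ^ 'n) measure))"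
      unfolding I_def
    proof (rule nn_integral_dominated_convergence[where w="\<lambda>w. ennreal ((cmod (F w))\<^sup>2)"])
      show "AE w in polydisc_measure. (\<lambda>n. indicator {w. cmod (w $ j) < 2 * cmod (X n)} w * ennreal ((cmod (F w))\<^sup>2)) \<longlonglongrightarrow> 0"
      proof (rule eventually_mono[OF AE_polydisc_measure])
        fix w :: "complex ^ 'n" assume "w \<in> punctured_polydisc"
        then have w: "cmod (w $ j) > 0" by (simp add: punctured_polydisc_def)
        have "(\<lambda>n. 2 * cmod (X n)) \<longlonglongrightarrow> 2 * cmod 0" by (intro tendsto_intros X)
        then have "\<forall>\<^sub>F n in sequentially. 2 * cmod (X n) < cmod (w $ j)"
          using w by (intro order_tendstoD(2)[where y="2 * cmod 0"]) auto
        then have "\<forall>\<^sub>F n in sequentially. indicator {w. cmod (w $ j) < 2 * cmod (X n)} w * ennreal ((cmod (F w))\<^sup>2) = 0"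
          by (rule eventually_mono) auto
        then show "(\<lambda>n. indicator {w. cmod (w $ j) < 2 * cmod (X n)} w * ennreal ((cmod (F w))\<^sup>2)) \<longlonglongrightarrow> 0"
          by (rule tendsto_eventually)
      qed
      show "(\<integral>\<^sup>+w. ennreal ((cmod (F w))\<^sup>2) \<partial>polydisc_measure) < \<infinity>" by (rule square_int)
    qed (auto simp: indicator_def)
    then have I0: "(\<lambda>n. I (2 * cmod (X n))) \<longlonglongrightarrow> 0" by simp
    have "(\<lambda>n. cmod (X n)) \<longlonglongrightarrow> cmod 0" by (intro tendsto_intros X)
    then have ev: "\<forall>\<^sub>F n in sequentially. cmod (X n) < 1/2"
      by (intro order_tendstoD(2)[where y="cmod 0"]) auto
    have "(\<lambda>n. ennreal (c * (cmod (X n * F (upd y j (X n))))\<^sup>2)) \<longlonglongrightarrow> 0"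
    proof (rule tendsto_sandwich[OF _ _ tendsto_const I0])
      show "\<forall>\<^sub>F n in sequentially. ennreal (c * (cmod (X n * F (upd y j (X n))))\<^sup>2) \<le> I (2 * cmod (X n))"
        using ev by (rule eventually_mono) (use bound X0 in auto)
    qed simp
    then have "(\<lambda>n. c * (cmod (X n * F (upd y j (X n))))\<^sup>2) \<longlonglongrightarrow> 0"
      using c0 by (subst (asm) ennreal_0[symmetric], subst (asm) tendsto_ennreal_iff) auto
    then have "(\<lambda>n. inverse c * (c * (cmod (X n * F (upd y j (X n))))\<^sup>2)) \<longlonglongrightarrow> inverse c * 0"
      by (intro tendsto_intros)
    then have "(\<lambda>n. (cmod (X n * F (upd y j (X n))))\<^sup>2) \<longlonglongrightarrow> 0" using c0 by (simp add: mult.assoc[symmetric])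
    then have "(\<lambda>n. sqrt ((cmod (X n * F (upd y j (X n))))\<^sup>2)) \<longlonglongrightarrow> sqrt 0" by (intro tendsto_intros)
    then show "((\<lambda>u. u * F (upd y j u)) \<circ> X) \<longlonglongrightarrow> 0"
      by (simp add: comp_def tendsto_norm_zero_iff)
  qed
qed

text \<open>
  The theorem of Riemann on removable singularities.
\<close>
lemma slice_extension:
  assumes y: "y \<in> punctured_polydisc"
  obtains g where "g holomorphic_on ball 0 1" "\<And>u. u \<noteq> 0 \<Longrightarrow> cmod u < 1 \<Longrightarrow> F (upd y j u) = g u"
proof -
  have "\<exists>g. g holomorphic_on ball 0 1 \<and> (\<forall>z\<in>ball 0 1 - {0}. g z = F (upd y j z))"
    using holomorphic_on_extend_lim[OF slice_holo[OF y, of j], of] slice_limit[OF y, of j] by simp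
  then obtain g where g: "g holomorphic_on ball 0 1" "\<forall>z\<in>ball 0 1 - {0}. g z = F (upd y j z)"
    by blast
  show thesis by (rule that[OF g(1)]) (use g(2) in auto)
qed

text \<open>
  By the maximum principle for the extended slices, applied in one coordinate after another, the
  supremum over the punctured polydisc of radius \<open>\<rho>\<close> is attained on the compact torus of
  radius \<open>\<rho>\<close>.
\<close>
lemma bounded_on_smaller_polydisc:
  assumes \<rho>: "0 < \<rho>" "\<rho> < 1"
  obtains M where "\<And>y. (\<And>i. y $ i \<noteq> 0 \<and> cmod (y $ i) \<le> \<rho>) \<Longrightarrow> cmod (F y) \<le> M"
proof -
  let ?T = "{y :: complex ^ 'n. \<forall>i. cmod (y $ i) = \<rho>}"
  have cT: "compact ?T"
  proof (rule compact_eq_bounded_closed[THEN iffD2], intro conjI)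
    have "norm y \<le> (\<Sum>i\<in>(UNIV::'n set). \<rho>)" if "y \<in> ?T" for y
      using norm_vec_le_sum[of y] sum_mono[of UNIV "\<lambda>i. norm (y $ i)" "\<lambda>_. \<rho>"] that by auto
    then show "bounded ?T" by (intro boundedI) auto
    show "closed ?T" by (intro closed_Collect_all closed_Collect_eq continuous_intros)
  qed
  have "?T \<subseteq> punctured_polydisc" using \<rho> by (auto simp: punctured_polydisc_def)
  then have "continuous_on ?T F" by (rule continuous_on_subset[OF cont])
  then have "bounded (F ` ?T)" using cT by (intro compact_imp_bounded compact_continuous_image)
  then obtain M where M: "\<And>y. y \<in> ?T \<Longrightarrow> cmod (F y) \<le> M" by (auto simp: bounded_iff)
  have "cmod (F y) \<le> M" if "\<And>i. y $ i \<noteq> 0" "\<And>i. i \<in> I \<Longrightarrow> cmod (y $ i) \<le> \<rho>" "\<And>i. i \<notin> I \<Longrightarrow> cmod (y $ i) = \<rho>" for I y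
    using finite[of I] that
  proof (induction I arbitrary: y rule: finite_induct)
    case empty
    then show ?case by (intro M) auto
  next
    case (insert j I)
    have le: "cmod (y $ i) \<le> \<rho>" for i using insert.prems by (metis order_refl)
    have yP: "y \<in> punctured_polydisc" using insert.prems(1) le \<rho> by (auto simp: punctured_polydisc_def intro: le_less_trans)
    obtain g where g: "g holomorphic_on ball 0 1" and gF: "\<And>u. u \<noteq> 0 \<Longrightarrow> cmod u < 1 \<Longrightarrow> F (upd y j u) = g u"
      by (rule slice_extension[OF yP, of j]) blast
    have sub: "cball 0 \<rho> \<subseteq> ball (0::complex) 1" using \<rho> by auto
    have "cmod (g (y $ j)) \<le> M"
    proof (rule maximum_modulus_frontier[of g "cball 0 \<rho>"])
      show "g holomorphic_on interior (cball 0 \<rho>)"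
        by (rule holomorphic_on_subset[OF g]) (use sub interior_subset in blast)
      show "continuous_on (closure (cball 0 \<rho>)) g"
        by (rule continuous_on_subset[OF holomorphic_on_imp_continuous_on[OF g]]) (use sub in simp)
      show "y $ j \<in> cball 0 \<rho>" using le by simp
      fix u assume "u \<in> frontier (cball (0::complex) \<rho>)"
      then have u: "cmod u = \<rho>" using \<rho> by (simp add: frontier_cball)
      then have u0: "u \<noteq> 0" "cmod u < 1" using \<rho> by auto
      have "cmod (F (upd y j u)) \<le> M"
        by (rule insert.IH) (use insert.prems insert.hyps u u0 in \<open>auto simp: upd_nth\<close>)
      then show "cmod (g u) \<le> M" using gF[OF u0] by simp
    qed auto
    then show ?case using gF[of "y $ j"] insert.prems(1) le[of j] \<rho> by auto
  qed
  from this[where I=UNIV] show thesis by (intro that[of M]) auto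
qed

text \<open>
  The polydisc has finite measure.
\<close>
lemma integrable_F: "integrable polydisc_measure F"
proof (rule integrableI_bounded)
  have "(\<integral>\<^sup>+y. ennreal (norm (F y)) \<partial>polydisc_measure) \<le> (\<integral>\<^sup>+y. 1 + ennreal ((cmod (F y))\<^sup>2) \<partial>polydisc_measure)"
  proof (intro nn_integral_mono)
    fix y
    have "0 \<le> (cmod (F y) - 1)\<^sup>2" by simp
    then have "2 * cmod (F y) \<le> 1 + (cmod (F y))\<^sup>2" by (simp add: power2_diff)
    then have "cmod (F y) \<le> 1 + (cmod (F y))\<^sup>2" using norm_ge_zero[of "F y"] by linarith
    then show "ennreal (norm (F y)) \<le> 1 + ennreal ((cmod (F y))\<^sup>2)"
      using ennreal_leI[of "cmod (F y)" "1 + (cmod (F y))\<^sup>2"] by (subst (asm) ennreal_plus) simp_all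
  qed
  also have "\<dots> = emeasure (polydisc_measure :: (complex ^ 'n) measure) UNIV + (\<integral>\<^sup>+y. ennreal ((cmod (F y))\<^sup>2) \<partial>polydisc_measure)"
    by (subst nn_integral_add) simp_all
  also have "\<dots> < \<infinity>" using square_int by (simp add: emeasure_polydisc_measure)
  finally show "(\<integral>\<^sup>+y. ennreal (norm (F y)) \<partial>polydisc_measure) < \<infinity>" .
qed simp

text \<open>
  The dilated function is bounded, and its slices extend to a disc of radius \<open>1 / \<rho> > 1\<close>.
\<close>
lemma reproducing_dilated:
  assumes x: "x \<in> punctured_polydisc" and \<rho>: "0 < \<rho>" "\<rho> < 1"
  shows "(LINT y|polydisc_measure. F (\<chi> i. of_real \<rho> * y $ i) * (\<Prod>i\<in>UNIV. 1 / (1 - x $ i * cnj (y $ i))\<^sup>2)) = of_real pi ^ CARD('n) * F (\<chi> i. of_real \<rho> * x $ i)"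
proof -
  obtain M where M: "\<And>y. (\<And>i. y $ i \<noteq> 0 \<and> cmod (y $ i) \<le> \<rho>) \<Longrightarrow> cmod (F y) \<le> M"
    using bounded_on_smaller_polydisc[OF \<rho>] by blast
  have x1: "cmod (x $ i) < 1" "x $ i \<noteq> 0" for i using x by (auto simp: punctured_polydisc_def)
  have S: "punctured_polydisc = {y. \<forall>i. y $ i \<noteq> 0 \<and> cmod (y $ i) < 1 \<or> y $ i = x $ i}"
    using x1 by (auto simp: punctured_polydisc_def)
  show ?thesis
  proof (rule polydisc_reproducing_slices[OF _ x1(1) S])
    fix y :: "complex ^ 'n" assume y: "y \<in> punctured_polydisc"
    have scale: "(\<chi> i. of_real \<rho> * y $ i) \<in> punctured_polydisc"
      using y \<rho> mult_strict_mono'[of \<rho> 1 _ 1] by (auto simp: punctured_polydisc_def norm_mult)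
    show "cmod (F (\<chi> i. of_real \<rho> * y $ i)) \<le> M"
      by (rule M) (use y \<rho> in \<open>auto simp: punctured_polydisc_def norm_mult mult_left_le less_imp_le\<close>)
    show "\<exists>R>1. \<exists>g. g holomorphic_on ball 0 R \<and> (\<forall>u. upd y j u \<in> punctured_polydisc \<longrightarrow> F (\<chi> i. of_real \<rho> * upd y j u $ i) = g u)" for j
    proof -
      obtain g where g: "g holomorphic_on ball 0 1" and gF: "\<And>u. u \<noteq> 0 \<Longrightarrow> cmod u < 1 \<Longrightarrow> F (upd (\<chi> i. of_real \<rho> * y $ i) j u) = g u"
        by (rule slice_extension[OF scale, of j]) blast
      have eq: "(\<chi> i. of_real \<rho> * upd y j u $ i) = upd (\<chi> i. of_real \<rho> * y $ i) j (of_real \<rho> * u)" for u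
        by (simp add: upd_def vec_eq_iff)
      show ?thesis
      proof (intro exI[of _ "1 / \<rho>"] conjI exI[of _ "g \<circ> (\<lambda>u. of_real \<rho> * u)"])
        show "1 < 1 / \<rho>" using \<rho> by simp
        show "g \<circ> (\<lambda>u. of_real \<rho> * u) holomorphic_on ball 0 (1 / \<rho>)"
          by (rule holomorphic_on_compose_gen[OF _ g]) (use \<rho> in \<open>auto intro!: holomorphic_intros simp: norm_mult field_simps\<close>)
        show "\<forall>u. upd y j u \<in> punctured_polydisc \<longrightarrow> F (\<chi> i. of_real \<rho> * upd y j u $ i) = (g \<circ> (\<lambda>u. of_real \<rho> * u)) u"
        proof (intro allI impI)
          fix u assume "upd y j u \<in> punctured_polydisc"
          then have "\<forall>i. upd y j u $ i \<noteq> 0 \<and> cmod (upd y j u $ i) < 1" by (simp add: punctured_polydisc_def)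
          from spec[OF this, of j] have u: "u \<noteq> 0" "cmod u < 1" by (simp_all add: upd_nth)
          then have "\<rho> * cmod u < 1" using \<rho> mult_strict_mono'[of \<rho> 1 "cmod u" 1] by auto
          then show "F (\<chi> i. of_real \<rho> * upd y j u $ i) = (g \<circ> (\<lambda>u. of_real \<rho> * u)) u"
            unfolding eq using u \<rho> by (simp add: gF norm_mult)
        qed
      qed
    qed
  qed measurable
qed

text \<open>
  The limit \<open>\<rho> \<rightarrow> 1\<close> of the formula for dilations. After the substitution \<open>w = \<rho> y\<close> the dilation acts on
  the kernel, which is bounded uniformly in \<open>\<rho>\<close>, and dominated convergence applies.
\<close>
lemma reproducing:
  assumes x: "x \<in> punctured_polydisc"
  shows "(LINT y|polydisc_measure. F y * (\<Prod>i\<in>UNIV. 1 / (1 - x $ i * cnj (y $ i))\<^sup>2)) = of_real pi ^ CARD('n) * F x"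
proof -
  define \<rho> where "\<rho> n = 1 - 1 / (real n + 2)" for n :: nat
  have \<rho>: "0 < \<rho> n" "\<rho> n < 1" for n by (auto simp: \<rho>_def field_simps)
  have \<rho>1: "\<rho> \<longlonglongrightarrow> 1" unfolding \<rho>_def by real_asymp
  have x1: "cmod (x $ i) < 1" "x $ i \<noteq> 0" for i using x by (auto simp: punctured_polydisc_def)
  let ?D = "punctured_polydisc :: (complex ^ 'n) set"
  define s where "s n w = (\<chi> i. of_real (1 / \<rho> n) * w $ i)" for n and w :: "complex ^ 'n"
  have [measurable]: "s n \<in> borel_measurable borel" for n unfolding s_def[abs_def] by measurable
  define K where "K y = (\<Prod>i\<in>UNIV. 1 / (1 - x $ i * cnj (y $ i))\<^sup>2)" for y :: "complex ^ 'n"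
  have [measurable]: "K \<in> borel_measurable borel" unfolding K_def[abs_def] by measurable
  define Kb where "Kb = (\<Prod>i\<in>UNIV. 1 / (1 - cmod (x $ i))\<^sup>2)"
  have Kb: "cmod (K y) \<le> Kb" if "y \<in> ?D" for y
    unfolding K_def Kb_def prod_norm[symmetric]
  proof (intro prod_mono conjI)
    fix i
    have "(1 - cmod (x $ i))\<^sup>2 \<le> (cmod (1 - x $ i * cnj (y $ i)))\<^sup>2"
      using x1[of i] that by (intro power_mono cmod_one_minus_ge) (auto simp: punctured_polydisc_def less_imp_le)
    moreover have "0 < (1 - cmod (x $ i))\<^sup>2" using x1[of i] by simp
    ultimately show "cmod (1 / (1 - x $ i * cnj (y $ i))\<^sup>2) \<le> 1 / (1 - cmod (x $ i))\<^sup>2"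
      by (simp add: norm_divide norm_power frac_le)
  qed simp
  have Kb0: "0 \<le> Kb" unfolding Kb_def by (intro prod_nonneg) auto
  \<comment> \<open>the dilation is moved from \<open>F\<close> to the kernel, where it is harmless\<close>
  let ?g = "\<lambda>n w. indicator ?D (s n w) *\<^sub>R (F w * K (s n w))"
  have subst: "(LINT y|polydisc_measure. F (\<chi> i. of_real (\<rho> n) * y $ i) * K y) = 
      of_real ((1 / (\<rho> n)\<^sup>2) ^ CARD('n)) * (LINT w|polydisc_measure. ?g n w)" for n
  proof -
    let ?T = "\<lambda>y :: complex ^ 'n. \<chi> i. of_real (\<rho> n) * y $ i"
    have sT: "s n (?T y) = y" for y using \<rho>(1)[of n] by (simp add: s_def vec_eq_iff)
    have distr: "distr lborel borel ?T = density lborel (\<lambda>_. ennreal ((1 / (\<rho> n)\<^sup>2) ^ CARD('n)))"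
      using distr_lborel_polydisc_affine[of "\<lambda>_. \<rho> n" 0] \<rho>(1) by simp
    have "(LINT y|polydisc_measure. F (?T y) * K y) = (LINT y|lborel. indicator ?D y *\<^sub>R (F (?T y) * K y))"
      by (rule integral_polydisc_measure) measurable
    also have "\<dots> = (LINT y|lborel. indicator ?D (s n (?T y)) *\<^sub>R (F (?T y) * K (s n (?T y))))"
      by (simp only: sT)
    also have "\<dots> = (LINT w|distr lborel borel ?T. ?g n w)"
      by (rule integral_distr[symmetric]) measurable
    also have "\<dots> = (LINT w|lborel. (1 / (\<rho> n)\<^sup>2) ^ CARD('n) *\<^sub>R (?g n w))"
      unfolding distr by (rule integral_density) auto
    also have "\<dots> = of_real ((1 / (\<rho> n)\<^sup>2) ^ CARD('n)) * (LINT w|lborel. ?g n w)"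
      by (simp add: scaleR_conv_of_real)
    also have "(LINT w|lborel. ?g n w) = (LINT w|lborel. indicator ?D w *\<^sub>R (?g n w))"
    proof (intro Bochner_Integration.integral_cong refl)
      fix w :: "complex ^ 'n"
      have "w \<in> ?D" if sw: "s n w \<in> ?D"
      proof -
        have "w $ i \<noteq> 0 \<and> cmod (w $ i) < 1" for i
        proof -
          have *: "w $ i \<noteq> 0" "cmod (w $ i) / \<rho> n < 1" using sw \<rho>(1)[of n] by (auto simp: s_def punctured_polydisc_def norm_divide norm_mult)
          then have "cmod (w $ i) < \<rho> n" using \<rho>(1)[of n] by (simp add: field_simps)
          with * \<rho>(2)[of n] show ?thesis by auto
        qed
        then show ?thesis by (simp add: punctured_polydisc_def)
      qed
      then show "?g n w = indicat_real ?D w *\<^sub>R (?g n w)"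
        by (auto simp: indicator_def)
    qed
    also have "\<dots> = (LINT w|polydisc_measure. ?g n w)"
      by (rule integral_polydisc_measure[symmetric]) measurable
    finally show ?thesis .
  qed
  have lim1: "(\<lambda>n. (LINT w|polydisc_measure. ?g n w)) \<longlonglongrightarrow> (LINT w|polydisc_measure. F w * K w)"
  proof (rule integral_dominated_convergence[where w="\<lambda>w. Kb * cmod (F w)"])
    show "integrable polydisc_measure (\<lambda>w. Kb * cmod (F w))" using integrable_F by auto
    show "AE w in polydisc_measure. cmod (?g n w) \<le> Kb * cmod (F w)" for n
    proof (intro AE_I2)
      fix w
      show "cmod (?g n w) \<le> Kb * cmod (F w)"
      proof (cases "s n w \<in> ?D")
        case True
        have "cmod (F w * K (s n w)) \<le> cmod (F w) * Kb"
          unfolding norm_mult using Kb[OF True] by (intro mult_left_mono) auto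
        then show ?thesis using True by (simp add: mult.commute)
      qed (use Kb0 in simp)
    qed
    show "AE w in polydisc_measure. (\<lambda>n. ?g n w) \<longlonglongrightarrow> F w * K w"
    proof (rule eventually_mono[OF AE_polydisc_measure])
      fix w :: "complex ^ 'n" assume w: "w \<in> ?D"
      have sc: "(\<lambda>n. s n w $ i) \<longlonglongrightarrow> w $ i" for i
      proof -
        have "(\<lambda>n. of_real (1 / \<rho> n) * w $ i) \<longlonglongrightarrow> of_real (1 / 1) * w $ i"
          by (intro tendsto_intros \<rho>1) simp
        then show ?thesis by (simp add: s_def)
      qed
      have nz: "(1 - x $ i * cnj (w $ i))\<^sup>2 \<noteq> 0" for i
      proof -
        have "cmod (w $ i) < 1" using w by (simp add: punctured_polydisc_def)
        then have "cmod (x $ i * cnj (w $ i)) < 1" by (rule cmod_mult_cnj_less[OF x1(1)])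
        then show ?thesis using one_minus_nonzero by simp
      qed
      have Klim: "(\<lambda>n. K (s n w)) \<longlonglongrightarrow> K w" unfolding K_def by (intro tendsto_intros sc nz)
      have "\<forall>\<^sub>F n in sequentially. s n w \<in> ?D"
      proof -
        have "\<forall>\<^sub>F n in sequentially. s n w $ i \<noteq> 0 \<and> cmod (s n w $ i) < 1" for i
        proof -
          have "(\<lambda>n. cmod (s n w $ i)) \<longlonglongrightarrow> cmod (w $ i)" by (intro tendsto_intros sc)
          then have "\<forall>\<^sub>F n in sequentially. cmod (s n w $ i) < 1"
            using w by (intro order_tendstoD(2)) (auto simp: punctured_polydisc_def)
          then show ?thesis
          proof (rule eventually_mono)
            fix n assume "cmod (s n w $ i) < 1"
            then show "s n w $ i \<noteq> 0 \<and> cmod (s n w $ i) < 1"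
              using w \<rho>(1)[of n] by (simp add: s_def punctured_polydisc_def)
          qed
        qed
        then show ?thesis unfolding punctured_polydisc_def by (simp add: eventually_all_finite)
      qed
      then have ev: "\<forall>\<^sub>F n in sequentially. F w * K (s n w) = ?g n w"
        by (rule eventually_mono) simp
      show "(\<lambda>n. ?g n w) \<longlonglongrightarrow> F w * K w"
        by (rule Lim_transform_eventually[OF tendsto_mult_left[OF Klim] ev])
    qed
  qed measurable
  have "(\<lambda>n. of_real ((1 / (\<rho> n)\<^sup>2) ^ CARD('n)) * (LINT w|polydisc_measure. ?g n w)) \<longlonglongrightarrow> of_real ((1 / 1\<^sup>2) ^ CARD('n)) * (LINT w|polydisc_measure. F w * K w)"
    by (intro tendsto_intros lim1 \<rho>1) simp
  moreover have "of_real ((1 / (\<rho> n)\<^sup>2) ^ CARD('n)) * (LINT w|polydisc_measure. ?g n w) = of_real pi ^ CARD('n) * F (\<chi> i. of_real (\<rho> n) * x $ i)" for n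
    unfolding subst[symmetric] using reproducing_dilated[OF x \<rho>] by (simp add: K_def)
  ultimately have lim2: "(\<lambda>n. of_real pi ^ CARD('n) * F (\<chi> i. of_real (\<rho> n) * x $ i)) \<longlonglongrightarrow> (LINT w|polydisc_measure. F w * K w)"
    by simp
  have "(\<lambda>n. F (\<chi> i. of_real (\<rho> n) * x $ i)) \<longlonglongrightarrow> F x"
  proof (rule continuous_on_tendsto_compose[OF cont _ x])
    have "(\<lambda>n. \<chi> i. of_real (\<rho> n) * x $ i) \<longlonglongrightarrow> (\<chi> i. of_real 1 * x $ i)"
      by (intro tendsto_intros \<rho>1)
    then show "(\<lambda>n. \<chi> i. of_real (\<rho> n) * x $ i) \<longlonglongrightarrow> x" by simp
    have "\<rho> n * cmod (x $ i) < 1" for n i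
      using \<rho>[of n] x1(1)[of i] mult_strict_mono'[of "\<rho> n" 1 "cmod (x $ i)" 1] by auto
    then show "\<forall>\<^sub>F n in sequentially. (\<chi> i. of_real (\<rho> n) * x $ i) \<in> ?D"
    proof (intro always_eventually allI)
      fix n
      have "\<rho> n \<noteq> 0" "\<bar>\<rho> n\<bar> = \<rho> n" using \<rho>(1)[of n] by auto
      with \<open>\<And>n i. \<rho> n * cmod (x $ i) < 1\<close> x1(2) show "(\<chi> i. of_real (\<rho> n) * x $ i) \<in> ?D"
        by (simp add: punctured_polydisc_def norm_mult)
    qed
  qed
  then have "(\<lambda>n. of_real pi ^ CARD('n) * F (\<chi> i. of_real (\<rho> n) * x $ i)) \<longlonglongrightarrow> of_real pi ^ CARD('n) * F x"
    by (intro tendsto_intros)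
  from LIMSEQ_unique[OF lim2 this] show ?thesis by (simp add: K_def)
qed

end

section \<open>Splitting the kernel by residues\<close>

text \<open>
  The part \<open>\<Sum>\<^sub>q (r + q m) u ^ (r + q m - 1)\<close> of the series \<open>1 / (1 - u)\<^sup>2 = \<Sum>\<^sub>k k u ^ (k - 1)\<close> that belongs to
  the residue \<open>r \<in> {1..m}\<close> modulo \<open>m\<close>, in closed form.
\<close>
definition residue_kernel :: "nat \<Rightarrow> nat \<Rightarrow> complex \<Rightarrow> complex" where
  "residue_kernel m r u = u ^ (r - 1) * (of_nat r + of_nat (m - r) * u ^ m) / (1 - u ^ m)\<^sup>2"

lemma sum_power_deriv:
  fixes u :: "'a::comm_ring_1"
  shows "(1 - u)\<^sup>2 * (\<Sum>r=1..m. of_nat r * u ^ (r - 1)) = 1 - (of_nat m + 1) * u ^ m + of_nat m * u ^ (m + 1)"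
proof (induction m)
  case (Suc m)
  have "(1 - u)\<^sup>2 * (\<Sum>r=1..Suc m. of_nat r * u ^ (r - 1)) = 
     (1 - u)\<^sup>2 * (\<Sum>r=1..m. of_nat r * u ^ (r - 1)) + (1 - u)\<^sup>2 * (of_nat (Suc m) * u ^ m)"
    by (simp add: distrib_left)
  also have "\<dots> = 1 - (of_nat (Suc m) + 1) * u ^ Suc m + of_nat (Suc m) * u ^ (Suc m + 1)"
    unfolding Suc by (simp add: algebra_simps power2_eq_square)
  finally show ?case .
qed simp

lemma sum_residue_kernel:
  assumes u: "cmod u < 1" and m: "m > 0"
  shows "(\<Sum>r=1..m. residue_kernel m r u) = 1 / (1 - u)\<^sup>2"
proof -
  have um: "cmod (u ^ m) < 1" using u m by (simp add: norm_power power_less_one_iff)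
  have nz: "1 - u \<noteq> 0" "1 - u ^ m \<noteq> 0" using one_minus_nonzero[OF u] one_minus_nonzero[OF um] by auto
  \<comment> \<open>multiplying by powers of \<open>1 - u\<close> turns both sums into polynomials\<close>
  define S1 where "S1 = (\<Sum>r=1..m. u ^ (r - 1))"
  define S2 where "S2 = (\<Sum>r=1..m. of_nat r * u ^ (r - 1))"
  have S1: "(1 - u) * S1 = 1 - u ^ m"
  proof -
    have "S1 = (\<Sum>i<m. u ^ i)"
      unfolding S1_def by (rule sum.reindex_bij_witness[of _ Suc "\<lambda>r. r - 1"]) auto
    then show ?thesis using one_diff_power_eq[of u m] by simp
  qed
  have S2: "(1 - u)\<^sup>2 * S2 = 1 - (of_nat m + 1) * u ^ m + of_nat m * u ^ (m + 1)"
    unfolding S2_def by (rule sum_power_deriv)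
  have "(\<Sum>r=1..m. u ^ (r - 1) * (of_nat r + of_nat (m - r) * u ^ m)) = (1 - u ^ m) * S2 + of_nat m * u ^ m * S1"
    unfolding S1_def S2_def sum_distrib_left sum.distrib[symmetric]
    by (intro sum.cong refl) (auto simp: of_nat_diff algebra_simps)
  note sum_eq = this
  have "(1 - u)\<^sup>2 * (\<Sum>r=1..m. u ^ (r - 1) * (of_nat r + of_nat (m - r) * u ^ m)) =
     (1 - u ^ m) * ((1 - u)\<^sup>2 * S2) + of_nat m * u ^ m * (1 - u) * ((1 - u) * S1)"
    unfolding sum_eq by (simp add: algebra_simps power2_eq_square)
  also have "\<dots> = (1 - u ^ m)\<^sup>2"
    unfolding S1 S2 by (simp add: algebra_simps power2_eq_square)
  finally have "(\<Sum>r=1..m. u ^ (r - 1) * (of_nat r + of_nat (m - r) * u ^ m)) / (1 - u ^ m)\<^sup>2 = 1 / (1 - u)\<^sup>2"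
    using nz by (simp add: field_simps)
  then show ?thesis by (simp add: residue_kernel_def sum_divide_distrib)
qed

lemma residue_kernel_bound:
  assumes u: "cmod u < 1" and r: "1 \<le> r" "r \<le> m"
  shows "cmod (residue_kernel m r u) \<le> real m / (cmod (1 - u ^ m))\<^sup>2"
proof -
  have "cmod (of_nat r + of_nat (m - r) * u ^ m) \<le> real r + real (m - r) * cmod u ^ m"
    by (rule order_trans[OF norm_triangle_ineq]) (simp add: norm_mult norm_power)
  also have "\<dots> \<le> real r + real (m - r) * 1"
    using u by (intro add_left_mono mult_left_mono power_le_one) auto
  also have "\<dots> = real m" using r by (simp add: of_nat_diff)
  finally have "cmod (of_nat r + of_nat (m - r) * u ^ m) \<le> real m" .
  then have "cmod (u ^ (r - 1) * (of_nat r + of_nat (m - r) * u ^ m)) \<le> 1 * real m"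
    unfolding norm_mult norm_power using u by (intro mult_mono power_le_one) auto
  then show ?thesis
    by (simp add: residue_kernel_def norm_divide norm_power divide_right_mono)
qed

lemma residue_kernel_rotate:
  assumes "c ^ m = 1" and r: "1 \<le> r"
  shows "residue_kernel m r (c * u) = c ^ (r - 1) * residue_kernel m r u"
  using assms by (simp add: residue_kernel_def power_mult_distrib)

section \<open>The candidate kernel and its reproducing property\<close>

context monomial_cover
begin

definition nat_d :: "'n \<Rightarrow> nat" where "nat_d j = nat (d j)"

lemma nat_d_pos: "nat_d j > 0" using d_pos[of j] by (simp add: nat_d_def)

lemma int_nat_d: "int (nat_d j) = d j" using d_pos[of j] by (simp add: nat_d_def)

lemma powi_d: "x powi d j = x ^ nat_d j"
  using int_nat_d[of j] by (metis power_int_of_nat)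

text \<open>
  The \<open>k\<close>-th coordinate of \<open>r A\<^sup>-\<^sup>1\<close>. All coordinates are integers if and only if \<open>r\<close> lies in
  the lattice \<open>\<int>\<^sup>n A\<close>.
\<close>
definition lattice_coord :: "('n \<Rightarrow> nat) \<Rightarrow> 'n \<Rightarrow> real" where
  "lattice_coord r k = (\<Sum>j\<in>UNIV. real (r j) * (of_int (B $ j $ k) / of_int (d j)))"

definition all_residues :: "('n \<Rightarrow> nat) set" where
  "all_residues = PiE UNIV (\<lambda>j. {1..nat_d j})"

definition lattice_residues :: "('n \<Rightarrow> nat) set" where
  "lattice_residues = {r \<in> all_residues. \<forall>k. lattice_coord r k \<in> \<int>}"

text \<open>
  The exponent \<open>\<alpha>\<close> with \<open>(\<alpha> + 1) A = r\<close>; the floor is taken of an integer if \<open>r\<close> is in the lattice.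
\<close>
definition exponent :: "('n \<Rightarrow> nat) \<Rightarrow> int ^ 'n" where
  "exponent r = (\<chi> k. \<lfloor>lattice_coord r k\<rfloor> - 1)"

text \<open>
  The Bergman kernel of the region: up to the norming constant, the sum of
  \<open>\<Prod>\<^sub>j ((\<alpha> + 1) A)\<^sub>j \<cdot> (z cnj w) ^ \<alpha>\<close> over all \<open>\<alpha>\<close> whose monomials are square-integrable. These \<open>\<alpha>\<close> form
  finitely many translates of the cone spanned by the rows of \<open>B\<close>, and each translate is a product
  of geometric type. All exponents of \<open>w\<close> are integers, so that holomorphy is visible.
\<close>
definition kernel :: "complex ^ 'n \<Rightarrow> complex ^ 'n \<Rightarrow> complex" where
  "kernel z w = of_real (1 / (pi ^ CARD('n) * \<bar>det real_A\<bar>)) *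
     (\<Sum>r\<in>lattice_residues. laurent_monomial (\<chi> k. z $ k * cnj (w $ k)) (exponent r) *
        (\<Prod>j\<in>UNIV. (of_nat (r j) + of_nat (nat_d j - r j) * laurent_monomial (\<chi> k. z $ k * cnj (w $ k)) (B $ j)) /
            (1 - laurent_monomial (\<chi> k. z $ k * cnj (w $ k)) (B $ j))\<^sup>2))"

lemma finite_all_residues: "finite all_residues"
  by (simp add: all_residues_def finite_PiE)

lemma all_residues_range: "r \<in> all_residues \<Longrightarrow> 1 \<le> r j \<and> r j \<le> nat_d j"
  by (auto simp: all_residues_def PiE_def Pi_def)

lemma of_int_exponent: "r \<in> lattice_residues \<Longrightarrow> of_int (exponent r $ k) = lattice_coord r k - 1"
  by (auto simp: lattice_residues_def exponent_def Ints_def)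

lemma lattice_coord_A: "(\<Sum>k\<in>UNIV. lattice_coord r k * of_int (A $ k $ j)) = real (r j)"
proof -
  have "(\<Sum>k\<in>UNIV. lattice_coord r k * of_int (A $ k $ j)) = 
     (\<Sum>i\<in>UNIV. real (r i) / of_int (d i) * of_int (\<Sum>k\<in>UNIV. B $ i $ k * A $ k $ j))"
    unfolding lattice_coord_def sum_distrib_right of_int_sum sum_distrib_left
    by (subst sum.swap) (simp add: mult_ac)
  also have "\<dots> = (\<Sum>i\<in>UNIV. if i = j then real (r j) else 0)"
    unfolding BA_entry using d_pos[of j] by (intro sum.cong) auto
  finally show ?thesis by simp
qed

lemma exponent_A: "r \<in> lattice_residues \<Longrightarrow> (\<Sum>k\<in>UNIV. exponent r $ k * A $ k $ j) = int (r j) - column_sum j"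
proof -
  assume r: "r \<in> lattice_residues"
  have "real_of_int (\<Sum>k\<in>UNIV. exponent r $ k * A $ k $ j) = (\<Sum>k\<in>UNIV. (lattice_coord r k - 1) * of_int (A $ k $ j))"
    by (simp add: of_int_exponent[OF r])
  also have "\<dots> = real (r j) - of_int (column_sum j)"
    by (simp add: left_diff_distrib sum_subtractf lattice_coord_A column_sum_def)
  finally have "real_of_int (\<Sum>k\<in>UNIV. exponent r $ k * A $ k $ j) = real_of_int (int (r j) - column_sum j)"
    by simp
  then show ?thesis by (simp only: of_int_eq_iff)
qed

lemma jac_nonzero: "y \<in> complex_torus \<Longrightarrow> jac y \<noteq> 0"
  by (simp add: jac_def laurent_monomial_nonzero)

lemma jac_mult: "jac (\<chi> k. x $ k * y $ k) = jac x * jac y"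
  by (simp add: jac_def laurent_monomial_mult_vec)

lemma jac_cnj: "jac (\<chi> k. cnj (y $ k)) = cnj (jac y)"
  by (simp add: jac_def laurent_monomial_cnj)

lemma cover_cnj: "cover (\<chi> k. cnj (y $ k)) = (\<chi> k. cnj (cover y $ k))"
  by (simp add: cover_def laurent_monomial_cnj)

text \<open>
  The link between the two descriptions of the kernel. With \<open>u\<^sub>j = x\<^sub>j cnj y\<^sub>j\<close> the argument
  \<open>z cnj w\<close> is \<open>cover u\<close>, its \<open>j\<close>-th row monomial is \<open>u\<^sub>j ^ d\<^sub>j\<close>, and the monomial with exponent \<open>\<alpha>\<close> is
  \<open>\<Prod>\<^sub>j u\<^sub>j powi (r\<^sub>j - s\<^sub>j)\<close>.
\<close>
lemma kernel_cover:
  assumes x: "x \<in> complex_torus" and y: "y \<in> complex_torus"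
  shows "jac x * cnj (jac y) * kernel (cover x) (cover y) = of_real (1 / (pi ^ CARD('n) * \<bar>det real_A\<bar>)) *
    (\<Sum>r\<in>lattice_residues. \<Prod>j\<in>UNIV. residue_kernel (nat_d j) (r j) (x $ j * cnj (y $ j)))"
proof -
  define u where "u = (\<chi> j. x $ j * cnj (y $ j))"
  have u: "u \<in> complex_torus" using x y by (simp add: u_def complex_torus_def)
  have t: "(\<chi> k. cover x $ k * cnj (cover y $ k)) = cover u"
    using cover_mult[of x "\<chi> k. cnj (y $ k)"] by (simp add: cover_cnj u_def)
  have tau: "laurent_monomial (cover u) (B $ j) = u $ j ^ nat_d j" for j
    by (simp add: laurent_monomial_cover_row[OF u] powi_d)
  have summand: "jac u * (laurent_monomial (cover u) (exponent r) * (\<Prod>j\<in>UNIV. (of_nat (r j) + of_nat (nat_d j - r j) * u $ j ^ nat_d j) / (1 - u $ j ^ nat_d j)\<^sup>2))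
      = (\<Prod>j\<in>UNIV. residue_kernel (nat_d j) (r j) (u $ j))" if r: "r \<in> lattice_residues" for r
  proof -
    have "jac u * laurent_monomial (cover u) (exponent r) = (\<Prod>j\<in>UNIV. u $ j powi (column_sum j - 1) * u $ j powi (int (r j) - column_sum j))"
      unfolding laurent_monomial_cover[OF u] exponent_A[OF r] by (simp add: jac_def laurent_monomial_def prod.distrib)
    also have "\<dots> = (\<Prod>j\<in>UNIV. u $ j ^ (r j - 1))"
    proof (intro prod.cong refl)
      fix j
      have "u $ j \<noteq> 0" using u by (simp add: complex_torus_def)
      then have "u $ j powi (column_sum j - 1) * u $ j powi (int (r j) - column_sum j) = u $ j powi (int (r j) - 1)"
        by (simp add: power_int_add[symmetric])
      also have "int (r j) - 1 = int (r j - 1)" using all_residues_range[of r j] r by (simp add: lattice_residues_def of_nat_diff)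
      finally show "u $ j powi (column_sum j - 1) * u $ j powi (int (r j) - column_sum j) = u $ j ^ (r j - 1)"
        by simp
    qed
    finally show ?thesis
      by (simp only: mult.assoc[symmetric] prod.distrib[symmetric]) (simp add: residue_kernel_def)
  qed
  have "jac x * cnj (jac y) = jac u"
    using jac_mult[of x "\<chi> k. cnj (y $ k)"] by (simp add: jac_cnj u_def)
  then have "jac x * cnj (jac y) * kernel (cover x) (cover y) = of_real (1 / (pi ^ CARD('n) * \<bar>det real_A\<bar>)) *
      (\<Sum>r\<in>lattice_residues. jac u * (laurent_monomial (cover u) (exponent r) * (\<Prod>j\<in>UNIV. (of_nat (r j) + of_nat (nat_d j - r j) * u $ j ^ nat_d j) / (1 - u $ j ^ nat_d j)\<^sup>2)))"
    unfolding kernel_def t tau by (simp add: sum_distrib_left mult_ac)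
  also have "(\<Sum>r\<in>lattice_residues. jac u * (laurent_monomial (cover u) (exponent r) * (\<Prod>j\<in>UNIV. (of_nat (r j) + of_nat (nat_d j - r j) * u $ j ^ nat_d j) / (1 - u $ j ^ nat_d j)\<^sup>2))) =
      (\<Sum>r\<in>lattice_residues. \<Prod>j\<in>UNIV. residue_kernel (nat_d j) (r j) (u $ j))"
    by (intro sum.cong refl summand)
  finally show ?thesis by (simp add: u_def)
qed

text \<open>
  The majorant of the pulled back Bergman kernel.
\<close>
definition polydisc_kernel :: "complex ^ 'n \<Rightarrow> complex ^ 'n \<Rightarrow> real" where
  "polydisc_kernel x y = (\<Prod>j\<in>UNIV. 1 / (cmod (1 - (x $ j * cnj (y $ j)) ^ nat_d j))\<^sup>2)"

definition kernel_const :: real where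
  "kernel_const = 1 / (pi ^ CARD('n) * \<bar>det real_A\<bar>) * (real (card lattice_residues) * (\<Prod>j\<in>UNIV. real (nat_d j)))"

lemma prod_residue_kernel_bound:
  assumes x: "x \<in> punctured_polydisc" and y: "y \<in> punctured_polydisc" and r: "r \<in> all_residues"
  shows "cmod (\<Prod>j\<in>UNIV. residue_kernel (nat_d j) (r j) (x $ j * cnj (y $ j))) \<le> (\<Prod>j\<in>UNIV. real (nat_d j)) * polydisc_kernel x y"
  unfolding polydisc_kernel_def prod_norm[symmetric] prod.distrib[symmetric]
proof (intro prod_mono conjI)
  fix j
  have "cmod (x $ j * cnj (y $ j)) < 1"
    using x y by (intro cmod_mult_cnj_less) (auto simp: punctured_polydisc_def)
  then show "cmod (residue_kernel (nat_d j) (r j) (x $ j * cnj (y $ j))) \<le> real (nat_d j) * (1 / (cmod (1 - (x $ j * cnj (y $ j)) ^ nat_d j))\<^sup>2)"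
    using residue_kernel_bound[of "x $ j * cnj (y $ j)" "r j" "nat_d j"] all_residues_range[OF r, of j] by simp
qed simp

text \<open>
  Since the residues \<open>r\<^sub>j\<close> are at least \<open>1\<close>, the numerators of the residue kernels are bounded.
\<close>
lemma kernel_bound:
  assumes x: "x \<in> punctured_polydisc" and y: "y \<in> punctured_polydisc"
  shows "cmod (jac x) * cmod (jac y) * cmod (kernel (cover x) (cover y)) \<le> kernel_const * polydisc_kernel x y"
proof -
  have "cmod (jac x) * cmod (jac y) * cmod (kernel (cover x) (cover y)) = cmod (jac x * cnj (jac y) * kernel (cover x) (cover y))"
    by (simp add: norm_mult)
  also have "\<dots> = 1 / (pi ^ CARD('n) * \<bar>det real_A\<bar>) * cmod (\<Sum>r\<in>lattice_residues. \<Prod>j\<in>UNIV. residue_kernel (nat_d j) (r j) (x $ j * cnj (y $ j)))"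
    unfolding kernel_cover[OF punctured_subset_torus[OF x] punctured_subset_torus[OF y]] norm_mult norm_of_real by simp
  also have "\<dots> \<le> 1 / (pi ^ CARD('n) * \<bar>det real_A\<bar>) * (\<Sum>r\<in>lattice_residues. (\<Prod>j\<in>UNIV. real (nat_d j)) * polydisc_kernel x y)"
    using prod_residue_kernel_bound[OF x y] 
    by (intro mult_left_mono sum_norm_le) (auto simp: lattice_residues_def)
  also have "\<dots> = kernel_const * polydisc_kernel x y"
    by (simp add: kernel_const_def)
  finally show ?thesis .
qed

lemma polydisc_kernel_bounded:
  assumes x: "x \<in> punctured_polydisc"
  obtains M where "\<And>y. y \<in> punctured_polydisc \<Longrightarrow> 0 \<le> polydisc_kernel x y \<and> polydisc_kernel x y \<le> M" "M \<ge> 0"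
proof
  let ?M = "\<Prod>j\<in>UNIV. 1 / (1 - cmod (x $ j))\<^sup>2"
  show "?M \<ge> 0" by (intro prod_nonneg) auto
  fix y :: "complex ^ 'n" assume y: "y \<in> punctured_polydisc"
  show "0 \<le> polydisc_kernel x y \<and> polydisc_kernel x y \<le> ?M" unfolding polydisc_kernel_def
  proof (intro conjI prod_nonneg prod_mono ballI)
    fix j
    have x1: "cmod (x $ j) < 1" and y1: "cmod (y $ j) < 1" using x y by (auto simp: punctured_polydisc_def)
    have le: "cmod (x $ j * cnj (y $ j)) \<le> cmod (x $ j)" using y1 by (simp add: norm_mult mult_left_le)
    have "cmod ((x $ j * cnj (y $ j)) ^ nat_d j) \<le> cmod (x $ j * cnj (y $ j)) ^ 1"
      unfolding norm_power using nat_d_pos[of j] le x1 by (intro power_decreasing) auto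
    then have "1 - cmod (x $ j) \<le> cmod (1 - (x $ j * cnj (y $ j)) ^ nat_d j)"
      using le norm_triangle_ineq2[of 1 "(x $ j * cnj (y $ j)) ^ nat_d j"] by simp
    then have "(1 - cmod (x $ j))\<^sup>2 \<le> (cmod (1 - (x $ j * cnj (y $ j)) ^ nat_d j))\<^sup>2"
      using x1 by (intro power_mono) auto
    then show "1 / (cmod (1 - (x $ j * cnj (y $ j)) ^ nat_d j))\<^sup>2 \<le> 1 / (1 - cmod (x $ j))\<^sup>2"
      using x1 by (intro frac_le) auto
  qed auto
qed

lemma measurable_kernel [measurable]:
  assumes [measurable]: "f \<in> borel_measurable M" "g \<in> borel_measurable M"
  shows "(\<lambda>x. kernel (f x) (g x)) \<in> borel_measurable M"
  unfolding kernel_def by measurable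

lemma measurable_disc_kernel [measurable]:
  assumes [measurable]: "f \<in> borel_measurable M" "g \<in> borel_measurable M"
  shows "(\<lambda>x. polydisc_kernel (f x) (g x)) \<in> borel_measurable M"
  unfolding polydisc_kernel_def by measurable

lemma measurable_residue_kernel [measurable]:
  assumes [measurable]: "f \<in> borel_measurable M"
  shows "(\<lambda>x. residue_kernel m r (f x)) \<in> borel_measurable M"
  unfolding residue_kernel_def by measurable

text \<open>
  If the \<open>k\<close>-th coordinate of \<open>r A\<^sup>-\<^sup>1\<close> is not an integer then the rotation by the angles
  \<open>\<theta>\<^sub>j = 2 \<pi> B\<^sub>j\<^sub>k / d\<^sub>j\<close> is a deck transformation of \<open>cover\<close> that multiplies the integrand by a
  constant different from \<open>1\<close>.
\<close>
lemma integral_nonlattice_zero: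
  assumes [measurable]: "h \<in> borel_measurable borel" and r: "r \<in> all_residues - lattice_residues"
  shows "(LINT y|polydisc_measure. h (cover y) * jac y * (\<Prod>j\<in>UNIV. residue_kernel (nat_d j) (r j) (x $ j * cnj (y $ j)))) = 0"
    (is "(LINT y|_. ?f y) = 0")
proof -
  obtain k where k: "lattice_coord r k \<notin> \<int>" using r by (auto simp: lattice_residues_def)
  let ?e = "exp (\<i> * of_real (2 * pi - 2 * pi * lattice_coord r k))"
  define \<theta> where "\<theta> j = 2 * pi * (of_int (B $ j $ k) / of_int (d j))" for j
  define c where "c = (\<chi> j. exp (\<i> * of_real (\<theta> j)))"
  have c1: "cmod (c $ j) = 1" for j by (simp add: c_def)
  have pow: "laurent_monomial c \<alpha> = exp (\<i> * of_real (\<Sum>j\<in>UNIV. of_int (\<alpha> $ j) * \<theta> j))" for \<alpha>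
    unfolding laurent_monomial_def c_def vec_lambda_beta exp_powi
    by (subst exp_sum[symmetric]) (simp_all add: sum_distrib_left mult_ac)
  have covc: "cover c $ i = 1" for i
  proof -
    have "(\<Sum>j\<in>UNIV. of_int (A $ i $ j) * \<theta> j) = 2 * pi * (\<Sum>j\<in>UNIV. of_int (A $ i $ j) * (of_int (B $ j $ k) / of_int (d j)))"
      by (simp add: \<theta>_def sum_distrib_left mult_ac)
    also have "\<dots> = (if i = k then 2 * pi else 0)" unfolding AB_entry by simp
    finally show ?thesis unfolding cover_def vec_lambda_beta pow by (auto simp: exp_eq_1 split: if_splits)
  qed
  have cov: "cover (\<chi> j. c $ j * y $ j) = cover y" for y
    by (simp add: cover_mult covc)
  have sth: "(\<Sum>j\<in>UNIV. of_int (column_sum j) * \<theta> j) = 2 * pi"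
  proof -
    have "(\<Sum>j\<in>UNIV. of_int (column_sum j) * \<theta> j) = (\<Sum>i\<in>UNIV. 2 * pi * (\<Sum>j\<in>UNIV. of_int (A $ i $ j) * (of_int (B $ j $ k) / of_int (d j))))"
      unfolding column_sum_def of_int_sum sum_distrib_right sum_distrib_left \<theta>_def
      by (subst sum.swap) (simp add: mult_ac)
    also have "\<dots> = 2 * pi" unfolding AB_entry sum_distrib_left[symmetric] by simp
    finally show ?thesis .
  qed
  have rth: "(\<Sum>j\<in>UNIV. real (r j) * \<theta> j) = 2 * pi * lattice_coord r k"
    by (simp add: \<theta>_def lattice_coord_def sum_distrib_left mult_ac)
  have jacc: "jac c = exp (\<i> * of_real (2 * pi - (\<Sum>j\<in>UNIV. \<theta> j)))"
    unfolding jac_def pow by (simp add: left_diff_distrib sum_subtractf sth)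
  have cd: "cnj (c $ j) ^ nat_d j = 1" for j
  proof -
    have "c $ j ^ nat_d j = exp (of_nat (nat_d j) * (\<i> * of_real (\<theta> j)))"
      by (simp add: c_def exp_of_nat_mult)
    also have "of_nat (nat_d j) * (\<i> * of_real (\<theta> j)) = \<i> * of_real (2 * pi * of_int (B $ j $ k))"
    proof -
      have "real (nat_d j) * \<theta> j = 2 * pi * of_int (B $ j $ k)"
        using d_pos[of j] int_nat_d[of j] by (simp add: \<theta>_def nat_d_def)
      then show ?thesis by (metis mult.left_commute of_real_mult of_real_of_nat_eq)
    qed
    also have "exp \<dots> = 1" by (auto simp: exp_eq_1 intro!: exI[of _ "B $ j $ k"])
    finally show ?thesis by (metis complex_cnj_one complex_cnj_power)
  qed
  have cr: "(\<Prod>j\<in>UNIV. cnj (c $ j) ^ (r j - 1)) = exp (\<i> * of_real ((\<Sum>j\<in>UNIV. \<theta> j) - 2 * pi * lattice_coord r k))"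
  proof -
    have "(\<Prod>j\<in>UNIV. cnj (c $ j) ^ (r j - 1)) = (\<Prod>j\<in>UNIV. exp (\<i> * of_real (\<theta> j - real (r j) * \<theta> j)))"
    proof (intro prod.cong refl)
      fix j
      have "1 \<le> r j" using all_residues_range[of r j] r by simp
      then have "of_nat (r j - 1) * (- (\<i> * of_real (\<theta> j))) = \<i> * of_real (\<theta> j - real (r j) * \<theta> j)"
        by (simp add: of_nat_diff algebra_simps)
      then show "cnj (c $ j) ^ (r j - 1) = exp (\<i> * of_real (\<theta> j - real (r j) * \<theta> j))"
        by (simp add: c_def exp_cnj exp_of_nat_mult[symmetric])
    qed
    also have "\<dots> = exp (\<i> * of_real (\<Sum>j\<in>UNIV. \<theta> j - real (r j) * \<theta> j))"
      by (simp add: exp_sum[symmetric] sum_distrib_left)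
    finally show ?thesis by (simp add: sum_subtractf rth)
  qed
  have rot: "?f (\<chi> j. c $ j * y $ j) = ?e * ?f y" for y
  proof -
    have "residue_kernel (nat_d j) (r j) (x $ j * cnj (c $ j * y $ j)) = cnj (c $ j) ^ (r j - 1) * residue_kernel (nat_d j) (r j) (x $ j * cnj (y $ j))" for j
      using residue_kernel_rotate[OF cd, of "r j" j "x $ j * cnj (y $ j)"] all_residues_range[of r j] r by (simp add: mult_ac)
    then have "?f (\<chi> j. c $ j * y $ j) = (jac c * (\<Prod>j\<in>UNIV. cnj (c $ j) ^ (r j - 1))) * ?f y"
      by (simp add: cov jac_mult prod.distrib mult_ac)
    also have "jac c * (\<Prod>j\<in>UNIV. cnj (c $ j) ^ (r j - 1)) = ?e"
      unfolding jacc cr exp_add[symmetric] by (simp add: algebra_simps)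
    finally show ?thesis .
  qed
  have ne: "?e \<noteq> 1"
  proof
    assume "?e = 1"
    then obtain n :: int where n: "2 * pi - 2 * pi * lattice_coord r k = of_int (2 * n) * pi"
      by (auto simp: exp_eq_1)
    have "2 * pi * (1 - lattice_coord r k) = 2 * pi - 2 * pi * lattice_coord r k"
      by (simp add: right_diff_distrib)
    also have "\<dots> = 2 * pi * of_int n" unfolding n by simp
    finally have "2 * pi * (1 - lattice_coord r k) = 2 * pi * of_int n" .
    then have "1 - lattice_coord r k = of_int n" by simp
    then have "lattice_coord r k = of_int (1 - n)" by simp
    with k show False by (metis Ints_of_int)
  qed
  have "(LINT y|polydisc_measure. ?f y) = (LINT y|distr polydisc_measure borel (\<lambda>w. \<chi> k. c $ k * w $ k). ?f y)"
    by (simp add: distr_polydisc_measure_unimodular[OF c1])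
  also have "\<dots> = (LINT y|polydisc_measure. ?f (\<chi> j. c $ j * y $ j))"
    by (rule integral_distr) measurable
  also have "\<dots> = ?e * (LINT y|polydisc_measure. ?f y)"
    unfolding rot by simp
  finally have "(1 - ?e) * (LINT y|polydisc_measure. ?f y) = 0"
    unfolding left_diff_distrib by simp
  then show ?thesis using ne[symmetric] by (simp only: mult_eq_0_iff right_minus_eq simp_thms)
qed

text \<open>
  The change of variables as an identity of measures, which yields it for Bochner integrals too.
\<close>
lemma region_measure_eq_distr:
  "density lborel (indicator region) = distr (density polydisc_measure (\<lambda>y. ennreal (\<bar>det real_A\<bar> * (cmod (jac y))\<^sup>2))) borel cover"
proof (rule measure_eqI)
  fix X assume "X \<in> sets (density lborel (indicator region))"
  then have [measurable]: "X \<in> sets borel" by simp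
  let ?N = "distr (density polydisc_measure (\<lambda>y. ennreal (\<bar>det real_A\<bar> * (cmod (jac y))\<^sup>2))) borel cover"
  have "emeasure (density lborel (indicator region)) X = (\<integral>\<^sup>+z. indicator region z * indicator X z \<partial>lborel)"
    by (simp add: emeasure_density)
  also have "\<dots> = ennreal \<bar>det real_A\<bar> * (\<integral>\<^sup>+y. indicator punctured_polydisc y * (ennreal ((cmod (jac y))\<^sup>2) * indicator X (cover y)) \<partial>lborel)"
    by (rule change_of_variables) measurable
  also have "\<dots> = (\<integral>\<^sup>+y. ennreal (\<bar>det real_A\<bar> * (cmod (jac y))\<^sup>2) * indicator X (cover y) \<partial>polydisc_measure)"
    by (subst nn_integral_polydisc_measure) (simp_all add: nn_integral_cmult[symmetric] ennreal_mult mult_ac)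
  also have "\<dots> = (\<integral>\<^sup>+z. indicator X z \<partial>?N)"
    by (subst nn_integral_distr) (simp_all add: nn_integral_density)
  finally show "emeasure (density lborel (indicator region)) X = emeasure ?N X"
    by simp
qed simp

lemma integral_region:
  fixes h :: "complex ^ 'n \<Rightarrow> 'c::{banach,second_countable_topology}"
  assumes [measurable]: "h \<in> borel_measurable borel"
  shows "(LINT z|density lborel (indicator region). h z) = (LINT y|polydisc_measure. (\<bar>det real_A\<bar> * (cmod (jac y))\<^sup>2) *\<^sub>R h (cover y))"
    and "integrable (density lborel (indicator region)) h \<longleftrightarrow> integrable polydisc_measure (\<lambda>y. (\<bar>det real_A\<bar> * (cmod (jac y))\<^sup>2) *\<^sub>R h (cover y))"
  unfolding region_measure_eq_distr
  by (simp_all add: integral_distr integral_density integrable_distr_eq integrable_density)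

lemma nn_integral_region:
  assumes [measurable]: "h \<in> borel_measurable borel"
  shows "(\<integral>\<^sup>+z. h z \<partial>density lborel (indicator region)) = (\<integral>\<^sup>+y. ennreal (\<bar>det real_A\<bar> * (cmod (jac y))\<^sup>2) * h (cover y) \<partial>polydisc_measure)"
  unfolding region_measure_eq_distr by (simp add: nn_integral_distr nn_integral_density)

text \<open>
  The reproducing formula on the polydisc, after discarding the residues outside the lattice, is the
  pullback of the reproducing formula on the region: one factor \<open>jac y\<close> comes from the pulled back
  function, and \<open>cnj (jac y)\<close> comes from \<open>kernel_cover\<close>.
\<close>
theorem kernel_reproducing:
  assumes f [measurable]: "f \<in> borel_measurable borel"
    and F: "punctured_holomorphic (\<lambda>y. indicator punctured_polydisc y * (f (cover y) * jac y))" (is "punctured_holomorphic ?F")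
    and z: "z \<in> region"
  shows "(LINT w|density lborel (indicator region). kernel z w * f w) = f z"
proof -
  interpret F: punctured_holomorphic ?F by (rule F)
  obtain x where x: "x \<in> punctured_polydisc" and zx: "cover x = z" by (rule cover_surj[OF z])
  obtain M where M: "\<And>y. y \<in> punctured_polydisc \<Longrightarrow> 0 \<le> polydisc_kernel x y \<and> polydisc_kernel x y \<le> M" and M0: "M \<ge> 0"
    using polydisc_kernel_bounded[OF x] by blast
  let ?G = "\<lambda>r y. \<Prod>j\<in>UNIV. residue_kernel (nat_d j) (r j) (x $ j * cnj (y $ j))"
  have int: "integrable polydisc_measure (\<lambda>y. ?F y * ?G r y)" if r: "r \<in> all_residues" for r
  proof (rule Bochner_Integration.integrable_bound[where f="\<lambda>y. ((\<Prod>j\<in>UNIV. real (nat_d j)) * M) * cmod (?F y)"])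
    show "integrable polydisc_measure (\<lambda>y. ((\<Prod>j\<in>UNIV. real (nat_d j)) * M) * cmod (?F y))"
      using F.integrable_F by (intro integrable_mult_right integrable_norm)
    show "AE y in polydisc_measure. norm (?F y * ?G r y) \<le> norm ((\<Prod>j\<in>UNIV. real (nat_d j)) * M * cmod (?F y))"
    proof (rule eventually_mono[OF AE_polydisc_measure])
      fix y :: "complex ^ 'n" assume y: "y \<in> punctured_polydisc"
      have "cmod (?G r y) \<le> (\<Prod>j\<in>UNIV. real (nat_d j)) * polydisc_kernel x y"
        by (rule prod_residue_kernel_bound[OF x y r])
      also have "\<dots> \<le> (\<Prod>j\<in>UNIV. real (nat_d j)) * M"
        using M[OF y] by (intro mult_left_mono prod_nonneg) auto
      finally have "cmod (?F y) * cmod (?G r y) \<le> cmod (?F y) * ((\<Prod>j\<in>UNIV. real (nat_d j)) * M)"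
        by (intro mult_left_mono) auto
      moreover have "0 \<le> (\<Prod>j\<in>UNIV. real (nat_d j))" by (intro prod_nonneg) auto
      then have "\<bar>(\<Prod>j\<in>UNIV. real (nat_d j))\<bar> = (\<Prod>j\<in>UNIV. real (nat_d j))" "\<bar>M\<bar> = M" using M0 by auto
      ultimately show "norm (?F y * ?G r y) \<le> norm ((\<Prod>j\<in>UNIV. real (nat_d j)) * M * cmod (?F y))"
        by (simp add: norm_mult abs_mult mult_ac)
    qed
  qed measurable
  have "of_real pi ^ CARD('n) * ?F x = (LINT y|polydisc_measure. ?F y * (\<Prod>i\<in>UNIV. 1 / (1 - x $ i * cnj (y $ i))\<^sup>2))"
    by (rule F.reproducing[OF x, symmetric])
  also have "\<dots> = (LINT y|polydisc_measure. (\<Sum>r\<in>all_residues. ?F y * ?G r y))"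
  proof (intro integral_cong_AE eventually_mono[OF AE_polydisc_measure])
    fix y :: "complex ^ 'n" assume y: "y \<in> punctured_polydisc"
    have "1 / (1 - x $ i * cnj (y $ i))\<^sup>2 = (\<Sum>r=1..nat_d i. residue_kernel (nat_d i) r (x $ i * cnj (y $ i)))" for i
    proof (rule sum_residue_kernel[symmetric])
      show "cmod (x $ i * cnj (y $ i)) < 1" using x y by (intro cmod_mult_cnj_less) (auto simp: punctured_polydisc_def)
    qed (rule nat_d_pos)
    then have "(\<Prod>i\<in>UNIV. 1 / (1 - x $ i * cnj (y $ i))\<^sup>2) = (\<Prod>i\<in>UNIV. \<Sum>r\<in>{1..nat_d i}. residue_kernel (nat_d i) r (x $ i * cnj (y $ i)))"
      by simp
    also have "\<dots> = (\<Sum>r\<in>all_residues. ?G r y)"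
      unfolding all_residues_def by (rule prod_sum_PiE) auto
    finally show "?F y * (\<Prod>i\<in>UNIV. 1 / (1 - x $ i * cnj (y $ i))\<^sup>2) = (\<Sum>r\<in>all_residues. ?F y * ?G r y)"
      by (simp add: sum_distrib_left)
  qed measurable
  also have "\<dots> = (\<Sum>r\<in>all_residues. (LINT y|polydisc_measure. ?F y * ?G r y))"
    by (rule Bochner_Integration.integral_sum) (rule int)
  also have "\<dots> = (\<Sum>r\<in>lattice_residues. (LINT y|polydisc_measure. ?F y * ?G r y))"
  proof (rule sum.mono_neutral_right[OF finite_all_residues])
    show "\<forall>r\<in>all_residues - lattice_residues. (LINT y|polydisc_measure. ?F y * ?G r y) = 0"
    proof
      fix r assume r: "r \<in> all_residues - lattice_residues"
      have "(LINT y|polydisc_measure. ?F y * ?G r y) = (LINT y|polydisc_measure. f (cover y) * jac y * ?G r y)"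
        by (intro integral_cong_AE eventually_mono[OF AE_polydisc_measure]) auto
      then show "(LINT y|polydisc_measure. ?F y * ?G r y) = 0" by (simp add: integral_nonlattice_zero[OF f r])
    qed
  qed (auto simp: lattice_residues_def)
  also have "\<dots> = (LINT y|polydisc_measure. (\<Sum>r\<in>lattice_residues. ?F y * ?G r y))"
    by (rule Bochner_Integration.integral_sum[symmetric]) (rule int, simp add: lattice_residues_def)
  also have "\<dots> = (LINT y|polydisc_measure. of_real (pi ^ CARD('n)) * jac x * ((\<bar>det real_A\<bar> * (cmod (jac y))\<^sup>2) *\<^sub>R (kernel z (cover y) * f (cover y))))"
  proof (intro integral_cong_AE eventually_mono[OF AE_polydisc_measure])
    fix y :: "complex ^ 'n" assume y: "y \<in> punctured_polydisc"
    have nz: "of_real (pi ^ CARD('n) * \<bar>det real_A\<bar>) \<noteq> (0::complex)" using det_real_A by simp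
    have "(\<Sum>r\<in>lattice_residues. ?F y * ?G r y) = f (cover y) * jac y * (\<Sum>r\<in>lattice_residues. ?G r y)"
      using y by (simp add: sum_distrib_left)
    also have "(\<Sum>r\<in>lattice_residues. ?G r y) = of_real (pi ^ CARD('n) * \<bar>det real_A\<bar>) * (jac x * cnj (jac y) * kernel (cover x) (cover y))"
      unfolding kernel_cover[OF punctured_subset_torus[OF x] punctured_subset_torus[OF y]] using nz by simp
    also have "f (cover y) * jac y * \<dots> = of_real (pi ^ CARD('n)) * jac x * ((\<bar>det real_A\<bar> * (cmod (jac y))\<^sup>2) *\<^sub>R (kernel z (cover y) * f (cover y)))"
      unfolding zx scaleR_conv_of_real of_real_mult complex_norm_square by (simp only: ac_simps)
    finally show "(\<Sum>r\<in>lattice_residues. ?F y * ?G r y) = of_real (pi ^ CARD('n)) * jac x * ((\<bar>det real_A\<bar> * (cmod (jac y))\<^sup>2) *\<^sub>R (kernel z (cover y) * f (cover y)))" .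
  qed measurable
  also have "\<dots> = of_real (pi ^ CARD('n)) * jac x * (LINT y|polydisc_measure. (\<bar>det real_A\<bar> * (cmod (jac y))\<^sup>2) *\<^sub>R (kernel z (cover y) * f (cover y)))"
    by (rule integral_mult_right_zero)
  also have "(LINT y|polydisc_measure. (\<bar>det real_A\<bar> * (cmod (jac y))\<^sup>2) *\<^sub>R (kernel z (cover y) * f (cover y))) = (LINT w|density lborel (indicator region). kernel z w * f w)"
    by (rule integral_region(1)[symmetric]) measurable
  finally have "of_real (pi ^ CARD('n)) * jac x * f z = of_real (pi ^ CARD('n)) * jac x * (LINT w|density lborel (indicator region). kernel z w * f w)"
    using x zx by (simp add: mult_ac)
  then show ?thesis using jac_nonzero[OF punctured_subset_torus[OF x]] by simp
qed

end

section \<open>Holomorphic functions of several variables\<close>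

lemma has_derivative_vec_lambda:
  fixes f :: "'n::finite \<Rightarrow> 'a::real_normed_vector \<Rightarrow> 'b::euclidean_space"
  assumes "\<And>i. (f i has_derivative f' i) (at x)"
  shows "((\<lambda>x. \<chi> i. f i x) has_derivative (\<lambda>h. \<chi> i. f' i h)) (at x)"
proof (subst has_derivative_componentwise_within, intro ballI)
  fix b :: "'b ^ 'n" assume "b \<in> Basis"
  then obtain i u where b: "b = axis i u" by (auto simp: Basis_vec_def)
  show "((\<lambda>x. (\<chi> i. f i x) \<bullet> b) has_derivative (\<lambda>h. (\<chi> i. f' i h) \<bullet> b)) (at x)"
    unfolding b by (simp add: inner_axis) (intro has_derivative_inner_left assms)
qed

text \<open>
  The pointwise form of \<^const>\<open>holomorphic_Cn\<close>, for which closure under algebraic operations can be stated.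
\<close>
definition complex_differentiable_at :: "(complex ^ 'n::finite \<Rightarrow> complex) \<Rightarrow> complex ^ 'n \<Rightarrow> bool" where
  "complex_differentiable_at f z \<longleftrightarrow> (\<exists>D. (f has_derivative D) (at z) \<and> (\<forall>c v. D (c *s v) = c * D v))"

lemma holomorphic_Cn_iff: "holomorphic_Cn f \<Omega> \<longleftrightarrow> (\<forall>z\<in>\<Omega>. complex_differentiable_at f z)"
  by (simp add: holomorphic_Cn_def complex_differentiable_at_def)

lemma cdiff_const [simp]: "complex_differentiable_at (\<lambda>_. c) z"
  unfolding complex_differentiable_at_def by (rule exI[of _ "\<lambda>_. 0"]) simp

lemma cdiff_nth [simp]: "complex_differentiable_at (\<lambda>z. z $ k) z"
  unfolding complex_differentiable_at_def
  by (rule exI[of _ "\<lambda>v. v $ k"]) (auto intro!: bounded_linear_imp_has_derivative)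

lemma cdiff_add:
  assumes "complex_differentiable_at f z" "complex_differentiable_at g z"
  shows "complex_differentiable_at (\<lambda>z. f z + g z) z"
proof -
  obtain D E where D: "(f has_derivative D) (at z)" "\<forall>c v. D (c *s v) = c * D v" 
    and E: "(g has_derivative E) (at z)" "\<forall>c v. E (c *s v) = c * E v"
    using assms unfolding complex_differentiable_at_def by blast
  show ?thesis unfolding complex_differentiable_at_def
    using has_derivative_add[OF D(1) E(1)] D(2) E(2) by (intro exI[of _ "\<lambda>v. D v + E v"]) (simp add: algebra_simps)
qed

lemma cdiff_mult:
  assumes "complex_differentiable_at f z" "complex_differentiable_at g z"
  shows "complex_differentiable_at (\<lambda>z. f z * g z) z"
proof -
  obtain D E where D: "(f has_derivative D) (at z)" "\<forall>c v. D (c *s v) = c * D v" 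
    and E: "(g has_derivative E) (at z)" "\<forall>c v. E (c *s v) = c * E v"
    using assms unfolding complex_differentiable_at_def by blast
  show ?thesis unfolding complex_differentiable_at_def
    using has_derivative_mult[OF D(1) E(1)] D(2) E(2)
    by (intro exI[of _ "\<lambda>v. f z * E v + D v * g z"]) (simp add: algebra_simps)
qed

lemma cdiff_diff:
  assumes "complex_differentiable_at f z" "complex_differentiable_at g z"
  shows "complex_differentiable_at (\<lambda>z. f z - g z) z"
  using cdiff_add[OF assms(1) cdiff_mult[OF cdiff_const[of "-1"] assms(2)]] by simp

lemma cdiff_inverse:
  assumes "complex_differentiable_at f z" "f z \<noteq> 0"
  shows "complex_differentiable_at (\<lambda>z. inverse (f z)) z"
proof -
  obtain D where D: "(f has_derivative D) (at z)" "\<forall>c v. D (c *s v) = c * D v"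
    using assms unfolding complex_differentiable_at_def by blast
  show ?thesis unfolding complex_differentiable_at_def
    using Deriv.has_derivative_inverse[OF assms(2) D(1)] D(2)
    by (intro exI[of _ "\<lambda>v. - (inverse (f z) * D v * inverse (f z))"]) (simp add: algebra_simps)
qed

lemma cdiff_divide:
  assumes "complex_differentiable_at f z" "complex_differentiable_at g z" "g z \<noteq> 0"
  shows "complex_differentiable_at (\<lambda>z. f z / g z) z"
  unfolding divide_inverse by (intro cdiff_mult cdiff_inverse assms)

lemma cdiff_power:
  assumes "complex_differentiable_at f z"
  shows "complex_differentiable_at (\<lambda>z. f z ^ n) z"
  by (induction n) (auto intro: cdiff_mult assms)

lemma cdiff_power_int:
  assumes "complex_differentiable_at f z" "0 \<le> n \<or> f z \<noteq> 0"
  shows "complex_differentiable_at (\<lambda>z. f z powi n) z"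
  using assms by (cases "0 \<le> n") (auto simp: power_int_def intro: cdiff_power cdiff_inverse)

lemma cdiff_sum:
  assumes "\<And>i. i \<in> I \<Longrightarrow> complex_differentiable_at (f i) z"
  shows "complex_differentiable_at (\<lambda>z. \<Sum>i\<in>I. f i z) z"
  using assms by (induction I rule: infinite_finite_induct) (auto intro: cdiff_add)

lemma cdiff_prod:
  assumes "\<And>i. i \<in> I \<Longrightarrow> complex_differentiable_at (f i) z"
  shows "complex_differentiable_at (\<lambda>z. \<Prod>i\<in>I. f i z) z"
  using assms by (induction I rule: infinite_finite_induct) (auto intro: cdiff_mult)

lemma cdiff_laurent_monomial:
  assumes "\<And>k. 0 \<le> \<alpha> $ k \<or> z $ k \<noteq> 0"
  shows "complex_differentiable_at (\<lambda>z. laurent_monomial z \<alpha>) z"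
  unfolding laurent_monomial_def by (intro cdiff_prod cdiff_power_int cdiff_nth assms)

lemma cdiff_transform:
  assumes "complex_differentiable_at f z" "open S" "z \<in> S" "\<And>w. w \<in> S \<Longrightarrow> f w = g w"
  shows "complex_differentiable_at g z"
  using assms has_derivative_transform_within_open[of f _ z UNIV S g] unfolding complex_differentiable_at_def
  by blast

lemma cdiff_isCont: "complex_differentiable_at f z \<Longrightarrow> isCont f z"
  unfolding complex_differentiable_at_def by (auto intro: has_derivative_continuous)

text \<open>
  Restricting a holomorphic function to a holomorphic curve gives a holomorphic function of one
  variable.
\<close>
lemma cdiff_compose_curve:
  assumes f: "complex_differentiable_at f (\<chi> k. \<gamma> k u)" and \<gamma>: "\<And>k. \<gamma> k field_differentiable (at u)"
  shows "(\<lambda>t. f (\<chi> k. \<gamma> k t)) field_differentiable (at u)"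
proof -
  obtain D where D: "(f has_derivative D) (at (\<chi> k. \<gamma> k u))" "\<forall>c v. D (c *s v) = c * D v"
    using f unfolding complex_differentiable_at_def by blast
  obtain \<gamma>' where \<gamma>': "\<And>k. (\<gamma> k has_field_derivative \<gamma>' k) (at u)"
    using \<gamma> unfolding field_differentiable_def by metis
  have "((\<lambda>t. \<chi> k. \<gamma> k t) has_derivative (\<lambda>h. \<chi> k. \<gamma>' k * h)) (at u)"
    using \<gamma>' by (intro has_derivative_vec_lambda) (simp add: has_field_derivative_def)
  from has_derivative_compose[OF this D(1)] have "((\<lambda>t. f (\<chi> k. \<gamma> k t)) has_derivative (\<lambda>h. D (\<chi> k. \<gamma>' k * h))) (at u)" .
  also have "(\<lambda>h. D (\<chi> k. \<gamma>' k * h)) = (*) (D (\<chi> k. \<gamma>' k))"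
  proof
    fix h
    have "(\<chi> k. \<gamma>' k * h) = h *s (\<chi> k. \<gamma>' k)" by (simp add: vec_eq_iff mult.commute)
    then show "D (\<chi> k. \<gamma>' k * h) = D (\<chi> k. \<gamma>' k) * h" using D(2) by (simp add: mult.commute)
  qed
  finally show ?thesis unfolding field_differentiable_def has_field_derivative_def by blast
qed

lemma holomorphic_Cn_continuous_on: "holomorphic_Cn f S \<Longrightarrow> continuous_on S f"
  unfolding holomorphic_Cn_iff by (intro continuous_at_imp_continuous_on ballI cdiff_isCont) auto

lemma laurent_monomial_upd_field_differentiable:
  assumes "u \<noteq> 0"
  shows "(\<lambda>u. laurent_monomial (upd y j u) \<alpha>) field_differentiable (at u)"
proof -
  have "(\<lambda>u. laurent_monomial (upd y j u) \<alpha>) holomorphic_on (- {0})"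
    unfolding laurent_monomial_def
  proof (rule holomorphic_on_prod)
    fix k
    show "(\<lambda>u. upd y j u $ k powi \<alpha> $ k) holomorphic_on (- {0})"
      by (cases "k = j") (auto simp: upd_nth intro!: holomorphic_intros)
  qed
  then show ?thesis using assms by (intro holomorphic_on_imp_differentiable_at[of _ "- {0}"]) auto
qed

text \<open>
  Transfer between the completed measure, in which the operators are stated, and Borel measure.
\<close>
lemma nn_integral_lebesgue_on:
  assumes [measurable]: "U \<in> sets borel" "h \<in> borel_measurable borel"
  shows "(\<integral>\<^sup>+z. h z \<partial>lebesgue_on U) = (\<integral>\<^sup>+z. h z \<partial>density lborel (indicator U))"
proof -
  have U: "U \<in> sets lebesgue" using assms(1) by simp
  have "(\<integral>\<^sup>+z. h z \<partial>lebesgue_on U) = (\<integral>\<^sup>+z. h z * indicator U z \<partial>lebesgue)"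
    using U by (subst nn_integral_restrict_space) simp_all
  also have "\<dots> = (\<integral>\<^sup>+z. h z * indicator U z \<partial>lborel)"
    by (subst nn_integral_completion) simp_all
  finally show ?thesis by (simp add: nn_integral_density mult.commute)
qed

lemma integral_lebesgue_on:
  fixes h :: "'a::euclidean_space \<Rightarrow> 'c::{banach,second_countable_topology}"
  assumes [measurable]: "U \<in> sets borel" "h \<in> borel_measurable borel"
  shows "integral\<^sup>L (lebesgue_on U) h = integral\<^sup>L (density lborel (indicator U)) h"
    and "integrable (lebesgue_on U) h \<longleftrightarrow> integrable (density lborel (indicator U)) h"
proof -
  have U: "U \<in> sets lebesgue" using assms(1) by simp
  have eq: "density lborel (indicator U) = density lborel (\<lambda>y. ennreal (indicator U y))"
    by (intro arg_cong[where f="density lborel"] ext) (simp add: ennreal_indicator)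
  have "integral\<^sup>L (lebesgue_on U) h = integral\<^sup>L lebesgue (\<lambda>z. indicator U z *\<^sub>R h z)"
    using U by (subst integral_restrict_space) simp_all
  also have "\<dots> = integral\<^sup>L lborel (\<lambda>z. indicator U z *\<^sub>R h z)"
    by (rule integral_completion) measurable
  also have "\<dots> = integral\<^sup>L (density lborel (indicator U)) h"
    unfolding eq by (rule integral_density[symmetric]) auto
  finally show "integral\<^sup>L (lebesgue_on U) h = integral\<^sup>L (density lborel (indicator U)) h" .
  have "integrable (lebesgue_on U) h \<longleftrightarrow> integrable lebesgue (\<lambda>z. indicator U z *\<^sub>R h z)"
    using U by (subst integrable_restrict_space) simp_all
  also have "\<dots> \<longleftrightarrow> integrable lborel (\<lambda>z. indicator U z *\<^sub>R h z)"
    by (rule integrable_completion) measurable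
  also have "\<dots> \<longleftrightarrow> integrable (density lborel (indicator U)) h"
    unfolding eq by (rule integrable_density[symmetric]) auto
  finally show "integrable (lebesgue_on U) h \<longleftrightarrow> integrable (density lborel (indicator U)) h" .
qed

section \<open>The Bergman kernel of the region\<close>

locale monomial_domain = monomial_cover +
  assumes open_U: "open (monomial_region B)"
begin

abbreviation U :: "(complex ^ 'a) set" where "U \<equiv> monomial_region B"

abbreviation region_measure :: "(complex ^ 'a) measure" where "region_measure \<equiv> density lborel (indicator region)"

lemma U_borel [measurable]: "U \<in> sets borel" using open_U by simp

lemma density_U: "density lborel (indicator U) = region_measure"
  by (rule density_cong) (auto intro!: eventually_mono[OF AE_complex_torus] simp: region_def indicator_def)

lemma region_subset: "region \<subseteq> U" by (simp add: region_def)

lemma AE_region: "AE z in lebesgue_on U. z \<in> region"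
proof -
  have "AE z in lborel. z \<in> U \<longrightarrow> z \<in> region"
    by (rule eventually_mono[OF AE_complex_torus]) (simp add: region_def)
  then have "AE z in lebesgue. z \<in> U \<longrightarrow> z \<in> region" by (rule AE_completion)
  then show ?thesis by (subst AE_restrict_space_iff) auto
qed

lemma measurable_restrict_zero:
  assumes "continuous_on U f"
  shows "(\<lambda>z. if z \<in> U then f z else (0::complex)) \<in> borel_measurable borel"
proof -
  have "(\<lambda>z. indicator U z *\<^sub>R f z) \<in> borel_measurable borel"
    by (rule borel_measurable_continuous_on_indicator[OF _ assms]) simp
  moreover have "(\<lambda>z. indicator U z *\<^sub>R f z) = (\<lambda>z. if z \<in> U then f z else 0)"
    by (auto simp: indicator_def)
  ultimately show ?thesis by simp
qed

lemma continuous_on_laurent_monomial: "continuous_on complex_torus (\<lambda>z. laurent_monomial z \<alpha>)"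
  unfolding laurent_monomial_def complex_torus_def by (intro continuous_intros) auto

lemma continuous_on_cover: "continuous_on complex_torus cover"
proof -
  have "continuous_on complex_torus (\<lambda>y. \<chi> k. laurent_monomial y (A $ k))"
    by (intro continuous_on_vec_lambda continuous_on_laurent_monomial)
  then show ?thesis by (simp add: cover_def[abs_def])
qed

lemma cover_in_U: "y \<in> punctured_polydisc \<Longrightarrow> cover y \<in> U"
  using cover_in_region_iff[of y] punctured_subset_torus region_subset by auto

text \<open>
  Only the values of \<open>f\<close> on the region matter; setting \<open>f\<close> to \<open>0\<close> elsewhere makes it Borel
  measurable.
\<close>
lemma punctured_holomorphic_pullback:
  assumes f: "f \<in> bergman_space U"
  shows "punctured_holomorphic (\<lambda>y. indicator punctured_polydisc y * ((\<lambda>z. if z \<in> U then f z else 0) (cover y) * jac y))"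
proof
  let ?f0 = "\<lambda>z. if z \<in> U then f z else 0"
  let ?F = "\<lambda>y. indicator punctured_polydisc y * (?f0 (cover y) * jac y)"
  have hol: "holomorphic_Cn f U" and int: "integrable (lebesgue_on U) (\<lambda>z. (cmod (f z))\<^sup>2)"
    using f by (auto simp: bergman_space_def)
  have cf: "continuous_on U f" by (rule holomorphic_Cn_continuous_on[OF hol])
  note m0 [measurable] = measurable_restrict_zero[OF cf]
  show "?F \<in> borel_measurable borel" by measurable
  have sub: "punctured_polydisc \<subseteq> complex_torus" using punctured_subset_torus by auto
  have "continuous_on punctured_polydisc (\<lambda>y. f (cover y) * jac y)"
    unfolding jac_def
    by (intro continuous_on_mult continuous_on_compose2[OF cf] continuous_on_subset[OF continuous_on_cover sub]
       continuous_on_subset[OF continuous_on_laurent_monomial sub]) (auto simp: cover_in_U)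
  then show "continuous_on punctured_polydisc ?F"
    by (rule continuous_on_eq) (simp add: cover_in_U)
  show "(\<lambda>u. ?F (upd y j u)) holomorphic_on ball 0 1 - {0}" if y: "y \<in> punctured_polydisc" for y j
  proof -
    have up: "upd y j u \<in> punctured_polydisc" if "u \<in> ball 0 1 - {0}" for u
      using that y by (simp add: punctured_polydisc_def upd_nth)
    have "(\<lambda>u. f (\<chi> k. laurent_monomial (upd y j u) (A $ k)) * laurent_monomial (upd y j u) (\<chi> j. column_sum j - 1)) holomorphic_on ball 0 1 - {0}"
    proof (rule holomorphic_on_mult; rule holomorphic_onI[OF field_differentiable_at_within])
      fix u :: complex assume u: "u \<in> ball 0 1 - {0}"
      have "complex_differentiable_at f (\<chi> k. laurent_monomial (upd y j u) (A $ k))"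
        using hol cover_in_U[OF up[OF u]] by (simp add: holomorphic_Cn_iff cover_def)
      then show "(\<lambda>u. f (\<chi> k. laurent_monomial (upd y j u) (A $ k))) field_differentiable at u"
        by (rule cdiff_compose_curve) (use u in \<open>auto intro: laurent_monomial_upd_field_differentiable\<close>)
      show "(\<lambda>u. laurent_monomial (upd y j u) (\<chi> j. column_sum j - 1)) field_differentiable at u"
        using u by (auto intro: laurent_monomial_upd_field_differentiable)
    qed
    then show ?thesis
      by (rule holomorphic_transform) (use up cover_in_U in \<open>auto simp: jac_def cover_def\<close>)
  qed
  have "(\<integral>\<^sup>+z. ennreal ((cmod (?f0 z))\<^sup>2) \<partial>region_measure) = (\<integral>\<^sup>+z. ennreal ((cmod (?f0 z))\<^sup>2) \<partial>lebesgue_on U)"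
    by (subst nn_integral_lebesgue_on) (simp_all add: density_U)
  also have "\<dots> = (\<integral>\<^sup>+z. ennreal ((cmod (f z))\<^sup>2) \<partial>lebesgue_on U)"
    by (intro nn_integral_cong) (simp add: space_restrict_space)
  also have "\<dots> < \<infinity>"
    using int by (simp add: integrable_iff_bounded)
  finally have fin: "(\<integral>\<^sup>+z. ennreal ((cmod (?f0 z))\<^sup>2) \<partial>region_measure) < \<infinity>" .
  have "ennreal \<bar>det real_A\<bar> * (\<integral>\<^sup>+y. ennreal ((cmod (?F y))\<^sup>2) \<partial>polydisc_measure) = (\<integral>\<^sup>+y. ennreal (\<bar>det real_A\<bar> * (cmod (jac y))\<^sup>2) * ennreal ((cmod (?f0 (cover y)))\<^sup>2) \<partial>polydisc_measure)"
    by (subst nn_integral_cmult[symmetric], measurable, intro nn_integral_cong_AE eventually_mono[OF AE_polydisc_measure])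
       (simp add: ennreal_mult[symmetric] norm_mult power_mult_distrib mult_ac)
  also have "\<dots> = (\<integral>\<^sup>+z. ennreal ((cmod (?f0 z))\<^sup>2) \<partial>region_measure)"
    by (rule nn_integral_region[symmetric]) measurable
  also note fin
  finally show "(\<integral>\<^sup>+y. ennreal ((cmod (?F y))\<^sup>2) \<partial>polydisc_measure) < \<infinity>"
    using det_real_A by (auto simp: ennreal_mult_less_top)
qed

lemma cmod_row_less_one: "w \<in> U \<Longrightarrow> cmod (laurent_monomial w (B $ j)) < 1"
  by (simp add: monomial_region_def cmod_laurent_monomial)

text \<open>
  Negative powers of \<open>w $ k\<close> would be a problem only where the region contains points with \<open>w $ k = 0\<close>.
  There the \<open>k\<close>-th column of \<open>B\<close> is nonnegative and not zero, so that \<open>\<alpha>\<^sub>k + 1\<close>, a combination of its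
  entries with positive coefficients, is positive.
\<close>
lemma exponent_nonneg:
  assumes w: "w \<in> U" "w $ k = 0" and r: "r \<in> lattice_residues"
  shows "0 \<le> exponent r $ k"
proof -
  have B: "0 \<le> B $ j $ k" for j using w by (auto simp: monomial_region_def not_less[symmetric])
  have "\<exists>j. B $ j $ k \<noteq> 0"
  proof (rule ccontr)
    assume "\<not> ?thesis"
    then show False using AB_entry[of k k] by simp
  qed
  then obtain j where j: "0 < B $ j $ k" using B by (metis order_le_less)
  have r1: "1 \<le> r i" for i using r all_residues_range[of r i] by (simp add: lattice_residues_def)
  have "0 < lattice_coord r k" unfolding lattice_coord_def
  proof (rule sum_pos2)
    show "0 < real (r j) * (of_int (B $ j $ k) / of_int (d j))"
      using r1[of j] j d_pos[of j] by (intro mult_pos_pos divide_pos_pos) auto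
    show "0 \<le> real (r i) * (of_int (B $ i $ k) / of_int (d i))" for i
      using B[of i] d_pos[of i] by (intro mult_nonneg_nonneg divide_nonneg_nonneg) auto
  qed auto
  then have "0 < real_of_int (exponent r $ k) + 1" using of_int_exponent[OF r, of k] by simp
  then show ?thesis by linarith
qed

lemma kernel_split:
  "cnj (kernel z w) = of_real (1 / (pi ^ CARD('a) * \<bar>det real_A\<bar>)) *
     (\<Sum>r\<in>lattice_residues. cnj (laurent_monomial z (exponent r)) * laurent_monomial w (exponent r) *
        (\<Prod>j\<in>UNIV. (of_nat (r j) + of_nat (nat_d j - r j) * (cnj (laurent_monomial z (B $ j)) * laurent_monomial w (B $ j))) /
            (1 - cnj (laurent_monomial z (B $ j)) * laurent_monomial w (B $ j))\<^sup>2))"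
  using laurent_monomial_mult_vec[of z "\<chi> k. cnj (w $ k)"] laurent_monomial_cnj[of w]
  by (simp add: kernel_def)

lemma cdiff_kernel:
  assumes z: "z \<in> U" and w: "w \<in> U"
  shows "complex_differentiable_at (\<lambda>w. cnj (kernel z w)) w"
  unfolding kernel_split
proof (intro cdiff_mult cdiff_sum cdiff_prod cdiff_divide cdiff_add cdiff_diff cdiff_power cdiff_const cdiff_laurent_monomial)
  show "0 \<le> exponent r $ k \<or> w $ k \<noteq> 0" if "r \<in> lattice_residues" for r k
    using exponent_nonneg[OF w _ that] by blast
  show "0 \<le> B $ j $ k \<or> w $ k \<noteq> 0" for j k
    using w by (auto simp: monomial_region_def not_less[symmetric])
  then show "0 \<le> B $ j $ k \<or> w $ k \<noteq> 0" for j k by this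
  have "cmod (cnj (laurent_monomial z (B $ j)) * laurent_monomial w (B $ j)) < 1" for j
    using cmod_mult_cnj_less[OF cmod_row_less_one[OF w] cmod_row_less_one[OF z], of j j] by (simp add: mult.commute)
  then show "(1 - cnj (laurent_monomial z (B $ j)) * laurent_monomial w (B $ j))\<^sup>2 \<noteq> 0" for j
    using one_minus_nonzero by simp
qed

text \<open>
  For fixed \<open>z\<close> the pulled back kernel times the Jacobian is bounded.
\<close>
lemma kernel_square_integrable:
  assumes z: "z \<in> region"
  shows "integrable region_measure (\<lambda>w. (cmod (kernel z w))\<^sup>2)"
proof -
  obtain x where x: "x \<in> punctured_polydisc" and zx: "cover x = z" by (rule cover_surj[OF z])
  obtain M where M: "\<And>y. y \<in> punctured_polydisc \<Longrightarrow> 0 \<le> polydisc_kernel x y \<and> polydisc_kernel x y \<le> M" and M0: "M \<ge> 0"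
    using polydisc_kernel_bounded[OF x] by blast
  have jx: "cmod (jac x) > 0" using jac_nonzero[OF punctured_subset_torus[OF x]] by simp
  have kc: "kernel_const \<ge> 0" unfolding kernel_const_def by (intro mult_nonneg_nonneg prod_nonneg) auto
  let ?C = "\<bar>det real_A\<bar> * (kernel_const * M / cmod (jac x))\<^sup>2"
  have "integrable polydisc_measure (\<lambda>y. (\<bar>det real_A\<bar> * (cmod (jac y))\<^sup>2) *\<^sub>R (cmod (kernel z (cover y)))\<^sup>2)"
  proof (rule finite_measure.integrable_const_bound[OF finite_measure_polydisc, where B="?C"])
    show "AE y in polydisc_measure. norm ((\<bar>det real_A\<bar> * (cmod (jac y))\<^sup>2) *\<^sub>R (cmod (kernel z (cover y)))\<^sup>2) \<le> ?C"
    proof (rule eventually_mono[OF AE_polydisc_measure])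
      fix y :: "complex ^ 'a" assume y: "y \<in> punctured_polydisc"
      have "cmod (jac x) * cmod (jac y) * cmod (kernel z (cover y)) \<le> kernel_const * M"
        using kernel_bound[OF x y] M[OF y] kc unfolding zx by (meson mult_left_mono order_trans)
      then have "cmod (jac y) * cmod (kernel z (cover y)) \<le> kernel_const * M / cmod (jac x)"
        using jx by (simp add: field_simps)
      then have "(cmod (jac y) * cmod (kernel z (cover y)))\<^sup>2 \<le> (kernel_const * M / cmod (jac x))\<^sup>2"
        by (intro power_mono) auto
      then have "\<bar>det real_A\<bar> * (cmod (jac y) * cmod (kernel z (cover y)))\<^sup>2 \<le> ?C"
        by (intro mult_left_mono) auto
      then show "norm ((\<bar>det real_A\<bar> * (cmod (jac y))\<^sup>2) *\<^sub>R (cmod (kernel z (cover y)))\<^sup>2) \<le> ?C"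
        by (simp add: power_mult_distrib abs_mult mult.assoc)
    qed
  qed measurable
  then show ?thesis by (subst integral_region(2)) simp_all
qed

text \<open>
  The value \<open>0\<close> off the region is the convention in \<^const>\<open>bergman_kernel\<close>.
\<close>
definition extended_kernel :: "complex ^ 'a \<Rightarrow> complex ^ 'a \<Rightarrow> complex" where
  "extended_kernel z w = (if w \<in> U then kernel z w else 0)"

lemma extended_kernel_in_bergman_space:
  assumes z: "z \<in> region"
  shows "(\<lambda>w. cnj (extended_kernel z w)) \<in> bergman_space U"
  unfolding bergman_space_def
proof (intro CollectI conjI)
  have zU: "z \<in> U" using z region_subset by auto
  show "holomorphic_Cn (\<lambda>w. cnj (extended_kernel z w)) U"
    unfolding holomorphic_Cn_iff
    by (intro ballI cdiff_transform[OF cdiff_kernel[OF zU] open_U]) (auto simp: extended_kernel_def)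
  have "integrable (lebesgue_on U) (\<lambda>w. (cmod (kernel z w))\<^sup>2)"
    using kernel_square_integrable[OF z] by (subst integral_lebesgue_on(2)) (simp_all add: density_U)
  then show "integrable (lebesgue_on U) (\<lambda>w. (cmod (cnj (extended_kernel z w)))\<^sup>2)"
    by (rule Bochner_Integration.integrable_cong[THEN iffD1, rotated -1])
       (auto simp: extended_kernel_def space_restrict_space)
qed

lemma extended_kernel_reproducing:
  assumes z: "z \<in> region" and f: "f \<in> bergman_space U"
  shows "f z = (LINT w|lebesgue_on U. extended_kernel z w * f w)"
proof -
  let ?f0 = "\<lambda>z. if z \<in> U then f z else 0"
  have "holomorphic_Cn f U" using f by (simp add: bergman_space_def)
  note m0 [measurable] = measurable_restrict_zero[OF holomorphic_Cn_continuous_on[OF this]]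
  have "(LINT w|lebesgue_on U. extended_kernel z w * f w) = (LINT w|lebesgue_on U. kernel z w * ?f0 w)"
    by (intro Bochner_Integration.integral_cong) (auto simp: extended_kernel_def space_restrict_space)
  also have "\<dots> = (LINT w|region_measure. kernel z w * ?f0 w)"
    by (subst integral_lebesgue_on(1)) (simp_all add: density_U)
  also have "\<dots> = ?f0 z"
    by (rule kernel_reproducing[OF m0 punctured_holomorphic_pullback[OF f] z])
  finally show ?thesis using z region_subset by auto
qed

lemma bergman_space_diff:
  assumes f: "f \<in> bergman_space U" and g: "g \<in> bergman_space U"
  shows "(\<lambda>z. f z - g z) \<in> bergman_space U" "integrable (lebesgue_on U) (\<lambda>z. cnj (f z) * g z)"
proof -
  have hol: "holomorphic_Cn f U" "holomorphic_Cn g U" and int: "integrable (lebesgue_on U) (\<lambda>z. (cmod (f z))\<^sup>2)" "integrable (lebesgue_on U) (\<lambda>z. (cmod (g z))\<^sup>2)"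
    using f g by (auto simp: bergman_space_def)
  have U: "U \<in> sets lebesgue" by simp
  have [measurable]: "f \<in> borel_measurable (lebesgue_on U)" "g \<in> borel_measurable (lebesgue_on U)"
    using holomorphic_Cn_continuous_on[OF hol(1)] holomorphic_Cn_continuous_on[OF hol(2)] U
    by (auto intro: continuous_imp_measurable_on_sets_lebesgue)
  have [measurable]: "(\<lambda>z. cnj (f z)) \<in> borel_measurable (lebesgue_on U)"
    by (rule measurable_compose[OF _ borel_measurable_cnj]) measurable
  have sum: "integrable (lebesgue_on U) (\<lambda>z. 2 * (cmod (f z))\<^sup>2 + 2 * (cmod (g z))\<^sup>2)" using int by simp
  have "integrable (lebesgue_on U) (\<lambda>z. (cmod (f z - g z))\<^sup>2)"
  proof (rule Bochner_Integration.integrable_bound[OF sum])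
    have "(cmod (f z - g z))\<^sup>2 \<le> 2 * (cmod (f z))\<^sup>2 + 2 * (cmod (g z))\<^sup>2" for z
    proof -
      have "(cmod (f z - g z))\<^sup>2 \<le> (cmod (f z) + cmod (g z))\<^sup>2" by (intro power_mono norm_triangle_ineq4) auto
      moreover have "0 \<le> (cmod (f z) - cmod (g z))\<^sup>2" by simp
      ultimately show ?thesis by (simp add: power2_sum power2_diff)
    qed
    then show "AE z in lebesgue_on U. norm ((cmod (f z - g z))\<^sup>2) \<le> norm (2 * (cmod (f z))\<^sup>2 + 2 * (cmod (g z))\<^sup>2)"
      by (intro AE_I2) simp
  qed measurable
  moreover have "holomorphic_Cn (\<lambda>z. f z - g z) U"
    using hol by (auto simp: holomorphic_Cn_iff intro: cdiff_diff)
  ultimately show "(\<lambda>z. f z - g z) \<in> bergman_space U" by (simp add: bergman_space_def)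
  show "integrable (lebesgue_on U) (\<lambda>z. cnj (f z) * g z)"
  proof (rule Bochner_Integration.integrable_bound[OF sum])
    have "cmod (cnj (f z) * g z) \<le> 2 * (cmod (f z))\<^sup>2 + 2 * (cmod (g z))\<^sup>2" for z
    proof -
      have "0 \<le> (cmod (f z) - cmod (g z))\<^sup>2" by simp
      then have "2 * (cmod (f z) * cmod (g z)) \<le> (cmod (f z))\<^sup>2 + (cmod (g z))\<^sup>2" by (simp add: power2_diff)
      moreover have "0 \<le> cmod (f z) * cmod (g z)" "0 \<le> (cmod (f z))\<^sup>2" "0 \<le> (cmod (g z))\<^sup>2" by auto
      ultimately have "cmod (f z) * cmod (g z) \<le> 2 * (cmod (f z))\<^sup>2 + 2 * (cmod (g z))\<^sup>2" by linarith
      then show ?thesis by (simp add: norm_mult)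
    qed
    then show "AE z in lebesgue_on U. norm (cnj (f z) * g z) \<le> norm (2 * (cmod (f z))\<^sup>2 + 2 * (cmod (g z))\<^sup>2)"
      by (intro AE_I2) simp
  qed measurable
qed

text \<open>
  Testing with \<open>g\<close> itself shows that \<open>g\<close> vanishes almost everywhere, hence everywhere by
  continuity.
\<close>
lemma bergman_space_zero:
  assumes g: "g \<in> bergman_space U" and orth: "\<And>f. f \<in> bergman_space U \<Longrightarrow> (LINT w|lebesgue_on U. cnj (g w) * f w) = 0"
    and w: "w \<in> U"
  shows "g w = 0"
proof -
  have hol: "holomorphic_Cn g U" and int: "integrable (lebesgue_on U) (\<lambda>z. (cmod (g z))\<^sup>2)"
    using g by (auto simp: bergman_space_def)
  have "(LINT w|lebesgue_on U. complex_of_real ((cmod (g w))\<^sup>2)) = 0"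
    using orth[OF g] by (simp add: complex_norm_square mult.commute del: of_real_power)
  then have "(LINT w|lebesgue_on U. (cmod (g w))\<^sup>2) = 0"
    unfolding integral_complex_of_real by simp
  then have "AE w in lebesgue_on U. (cmod (g w))\<^sup>2 = 0"
    using integral_nonneg_eq_0_iff_AE[OF int] by simp
  then have "AE w in lebesgue. w \<in> U \<longrightarrow> g w = 0"
    by (subst (asm) AE_restrict_space_iff) auto
  then have nul: "AE w in lebesgue. \<not> (w \<in> U \<and> g w \<noteq> 0)" by (rule eventually_mono) auto
  show ?thesis
  proof (rule ccontr)
    assume "g w \<noteq> 0"
    have op: "open (U \<inter> g -` (- {0}))"
      using continuous_on_open_vimage[OF open_U, THEN iffD1, OF holomorphic_Cn_continuous_on[OF hol], rule_format, of "- {0}"]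
      by (simp add: Int_commute open_Compl)
    have "w \<in> U \<inter> g -` (- {0})" using w \<open>g w \<noteq> 0\<close> by simp
    with op have "\<not> negligible (U \<inter> g -` (- {0}))"
      using open_not_negligible by blast
    moreover have "negligible (U \<inter> g -` (- {0}))"
    proof -
      have "U \<inter> g -` (- {0}) \<in> sets lebesgue" using op by simp
      then show ?thesis unfolding negligible_iff_null_sets using nul
        by (subst AE_iff_null_sets) (auto elim: eventually_mono)
    qed
    ultimately show False by contradiction
  qed
qed

text \<open>
  Two functions that represent the evaluation at \<open>z\<close> differ by a function that is conjugate to an
  element of the Bergman space and orthogonal to it.
\<close>
lemma bergman_kernel_eq:
  assumes z: "z \<in> region"
  shows "bergman_kernel U z = extended_kernel z"
  unfolding bergman_kernel_def
proof (rule the_equality)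
  show "(\<lambda>\<zeta>. cnj (extended_kernel z \<zeta>)) \<in> bergman_space U \<and> (\<forall>\<zeta>. \<zeta> \<notin> U \<longrightarrow> extended_kernel z \<zeta> = 0) \<and>
        (\<forall>f\<in>bergman_space U. f z = (LINT \<zeta>|lebesgue_on U. extended_kernel z \<zeta> * f \<zeta>))"
    using extended_kernel_in_bergman_space[OF z] extended_kernel_reproducing[OF z] by (simp add: extended_kernel_def)
next
  fix k assume k: "(\<lambda>\<zeta>. cnj (k \<zeta>)) \<in> bergman_space U \<and> (\<forall>\<zeta>. \<zeta> \<notin> U \<longrightarrow> k \<zeta> = 0) \<and>
        (\<forall>f\<in>bergman_space U. f z = (LINT \<zeta>|lebesgue_on U. k \<zeta> * f \<zeta>))"
  let ?g = "\<lambda>w. cnj (k w) - cnj (extended_kernel z w)"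
  note e = extended_kernel_in_bergman_space[OF z]
  have g: "?g \<in> bergman_space U" using k e by (intro bergman_space_diff) auto
  have "?g w = 0" if w: "w \<in> U" for w
  proof (rule bergman_space_zero[OF g _ w])
    fix f assume f: "f \<in> bergman_space U"
    have "integrable (lebesgue_on U) (\<lambda>w. k w * f w)" "integrable (lebesgue_on U) (\<lambda>w. extended_kernel z w * f w)"
      using bergman_space_diff(2)[of "\<lambda>\<zeta>. cnj (k \<zeta>)" f] bergman_space_diff(2)[OF e f] k f by simp_all
    then have "(LINT w|lebesgue_on U. k w * f w - extended_kernel z w * f w) = f z - f z"
      using k f extended_kernel_reproducing[OF z f] by (subst Bochner_Integration.integral_diff) auto
    then show "(LINT w|lebesgue_on U. cnj (?g w) * f w) = 0" by (simp add: left_diff_distrib)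
  qed
  then show "k = extended_kernel z"
    using k by (intro ext) (metis complex_cnj_cancel_iff eq_iff_diff_eq_0 extended_kernel_def)
qed

end

section \<open>The weighted bound on the polydisc\<close>

text \<open>
  Young's inequality is applied to \<open>s x\<close> and \<open>m powr (p - 1)\<close>, where \<open>m\<close> is the \<open>w\<close>-mean of \<open>s\<close>, and
  integrated against \<open>w\<close>.
\<close>
lemma weighted_power_mean:
  fixes w s :: "'a \<Rightarrow> real"
  assumes p: "1 < p" and w0: "\<And>x. 0 \<le> w x" and s0: "\<And>x. 0 \<le> s x"
    and iw: "integrable M w" and iws: "integrable M (\<lambda>x. w x * s x)"
    and [measurable]: "s \<in> borel_measurable M"
  shows "ennreal ((LINT x|M. w x * s x) powr p) \<le> ennreal ((LINT x|M. w x) powr (p - 1)) * (\<integral>\<^sup>+x. ennreal (w x * s x powr p) \<partial>M)"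
proof -
  let ?J = "\<integral>\<^sup>+x. ennreal (w x * s x powr p) \<partial>M"
  define N where "N = (LINT x|M. w x)"
  define I where "I = (LINT x|M. w x * s x)"
  have [measurable]: "w \<in> borel_measurable M" using iw by auto
  have N0: "0 \<le> N" unfolding N_def using w0 by (intro Bochner_Integration.integral_nonneg) auto
  have I0: "0 \<le> I" unfolding I_def using w0 s0 by (intro Bochner_Integration.integral_nonneg) auto
  consider "I = 0" | "I > 0" "?J = \<infinity>" | "I > 0" "?J < \<infinity>"
    using I0 by (auto simp: less_top[symmetric] order_le_less)
  then have "ennreal (I powr p) \<le> ennreal (N powr (p - 1)) * ?J"
  proof cases
    case 1
    then show ?thesis by simp
  next
    case 2
    have "N \<noteq> 0"
    proof
      assume "N = 0"
      then have "AE x in M. w x = 0"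
        using integral_nonneg_eq_0_iff_AE[OF iw] w0 by (simp add: N_def)
      then have "I = (LINT x|M. 0)" unfolding I_def by (intro integral_cong_AE) (auto elim: eventually_mono)
      with 2 show False by simp
    qed
    then have "N powr (p - 1) > 0" using N0 by simp
    then show ?thesis using 2 by (simp add: ennreal_mult_top)
  next
    case 3
    have iJ: "integrable M (\<lambda>x. w x * s x powr p)"
      using 3 w0 by (intro integrableI_nonneg) auto
    define J where "J = (LINT x|M. w x * s x powr p)"
    have J0: "0 \<le> J" unfolding J_def using w0 by (intro Bochner_Integration.integral_nonneg) auto
    have Npos: "N > 0"
    proof (rule ccontr)
      assume "\<not> N > 0"
      then have "N = 0" using N0 by simp
      then have "AE x in M. w x = 0"
        using integral_nonneg_eq_0_iff_AE[OF iw] w0 by (simp add: N_def)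
      then have "I = (LINT x|M. 0)" unfolding I_def by (intro integral_cong_AE) (auto elim: eventually_mono)
      with 3 show False by simp
    qed
    \<comment> \<open>\<open>N\<close> is the total mass of the weight, so \<open>m\<close> is the weighted mean\<close>
    define m where "m = I / N"
    have m: "m > 0" using 3 Npos by (simp add: m_def)
    define q where "q = p / (p - 1)"
    have q: "q > 1" "1 / p + 1 / q = 1" using p by (auto simp: q_def field_simps)
    have mq: "(m powr (p - 1)) powr q = m powr p" using p by (simp add: powr_powr q_def)
    have yg: "s x * m powr (p - 1) \<le> s x powr p / p + m powr p / q" for x
      using Youngs_inequality[OF p q, of "s x" "m powr (p - 1)"] s0[of x] by (simp add: mq)
    have "(LINT x|M. (w x * s x) * m powr (p - 1)) \<le> (LINT x|M. (w x * s x powr p) * (1 / p) + w x * (m powr p / q))"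
    proof (rule integral_mono)
      fix x
      have "w x * (s x * m powr (p - 1)) \<le> w x * (s x powr p / p + m powr p / q)"
        by (rule mult_left_mono[OF yg w0])
      then show "(w x * s x) * m powr (p - 1) \<le> (w x * s x powr p) * (1 / p) + w x * (m powr p / q)"
        by (simp add: algebra_simps)
    qed (use iws iJ iw in auto)
    also have "\<dots> = J / p + N * (m powr p / q)"
      using iJ iw by (simp add: J_def N_def)
    finally have "I * m powr (p - 1) \<le> J / p + N * (m powr p / q)"
      by (simp add: I_def)
    moreover have "I * m powr (p - 1) = N * m powr p"
    proof -
      have "I = N * m" using Npos by (simp add: m_def)
      moreover have "m powr p = m * m powr (p - 1)" using m powr_add[of m 1 "p - 1"] by simp
      ultimately show ?thesis by simp
    qed
    ultimately have "N * m powr p * (1 - 1 / q) \<le> J / p" by (simp add: algebra_simps)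
    also have "1 - 1 / q = 1 / p" using q by linarith
    finally have NJ: "N * m powr p \<le> J" using p by (simp add: field_simps)
    have "I powr p = N powr (p - 1) * (N * m powr p)"
    proof -
      have "I powr p = (N * m) powr p" using Npos by (simp add: m_def)
      also have "\<dots> = N powr p * m powr p" using Npos m by (simp add: powr_mult)
      also have "N powr p = N powr (p - 1) * N" using Npos powr_add[of N "p - 1" 1] by simp
      finally show ?thesis by simp
    qed
    also have "\<dots> \<le> N powr (p - 1) * J" using NJ by (intro mult_left_mono) auto
    finally have "ennreal (I powr p) \<le> ennreal (N powr (p - 1)) * ennreal J"
      using J0 by (simp add: ennreal_mult[symmetric] ennreal_leI)
    also have "ennreal J = ?J"
      unfolding J_def using iJ w0 by (intro nn_integral_eq_integral[symmetric]) auto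
    finally show ?thesis .
  qed
  then show ?thesis by (simp add: I_def N_def)
qed

lemma prod_mono_ennreal:
  fixes f g :: "'a \<Rightarrow> ennreal"
  assumes "\<And>i. i \<in> I \<Longrightarrow> f i \<le> g i"
  shows "prod f I \<le> prod g I"
  using assms by (induction I rule: infinite_finite_induct) (auto intro: mult_mono)

lemma sigma_finite_polydisc: "sigma_finite_measure polydisc_measure"
  using finite_measure_polydisc by (rule finite_measure.axioms(1))

context monomial_cover
begin

lemma polydisc_kernel_commute: "polydisc_kernel x y = polydisc_kernel y x"
proof -
  have "cmod (1 - (x $ j * cnj (y $ j)) ^ nat_d j) = cmod (1 - (y $ j * cnj (x $ j)) ^ nat_d j)" for j
  proof -
    have "cnj (1 - (x $ j * cnj (y $ j)) ^ nat_d j) = 1 - (y $ j * cnj (x $ j)) ^ nat_d j" by (simp add: mult.commute)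
    then show ?thesis by (metis complex_mod_cnj)
  qed
  then show ?thesis by (simp add: polydisc_kernel_def)
qed

lemma polydisc_kernel_nonneg: "0 \<le> polydisc_kernel x y"
  unfolding polydisc_kernel_def by (intro prod_nonneg) auto

text \<open>
  Integrand and measure are products, so the estimate for the disc applies in each coordinate.
\<close>
lemma polydisc_kernel_forelli_rudin:
  fixes u :: "'n \<Rightarrow> real"
  assumes u: "\<And>i. 0 \<le> u i" "\<And>i. u i < 2" and v: "0 < v" "v < 1"
  obtains C where "C > 0" "\<And>x. x \<in> punctured_polydisc \<Longrightarrow>
    (\<integral>\<^sup>+y. ennreal (polydisc_kernel x y * (\<Prod>i\<in>UNIV. cmod (y $ i) powr (- u i) * (1 - (cmod (y $ i))\<^sup>2) powr (-v))) \<partial>polydisc_measure)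
      \<le> ennreal (C * (\<Prod>i\<in>UNIV. (1 - (cmod (x $ i))\<^sup>2) powr (-v)))"
proof -
  let ?I = "\<lambda>i x m. \<integral>\<^sup>+y. ennreal (cmod y powr (- u i) * (1 - (cmod y)\<^sup>2) powr (-v) / (cmod (1 - (x * cnj y) ^ m))\<^sup>2) \<partial>disc_measure"
  have "\<forall>i. \<exists>C>0. \<forall>x m. cmod x < 1 \<longrightarrow> m > 0 \<longrightarrow>
    ?I i x m
      \<le> ennreal (C * (1 - (cmod x)\<^sup>2) powr (-v))"
  proof
    fix i
    show "\<exists>C>0. \<forall>x m. cmod x < 1 \<longrightarrow> m > 0 \<longrightarrow>
      ?I i x m
        \<le> ennreal (C * (1 - (cmod x)\<^sup>2) powr (-v))"
      by (rule forelli_rudin_disc[OF u(1)[of i] u(2)[of i] v]) blast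
  qed
  from choice[OF this] obtain C where C0: "\<forall>i. C i > 0 \<and> (\<forall>x m. cmod x < 1 \<longrightarrow> m > 0 \<longrightarrow>
    ?I i x m
      \<le> ennreal (C i * (1 - (cmod x)\<^sup>2) powr (-v)))" ..
  then have C: "\<And>i. C i > 0" "\<And>i x m. cmod x < 1 \<Longrightarrow> m > 0 \<Longrightarrow>
    ?I i x m
      \<le> ennreal (C i * (1 - (cmod x)\<^sup>2) powr (-v))"
    by blast+
  show thesis
  proof
    show "(\<Prod>i\<in>UNIV. C i) > 0" using C(1) by (intro prod_pos) auto
    fix x :: "complex ^ 'n" assume x: "x \<in> punctured_polydisc"
    let ?K = "\<integral>\<^sup>+y. ennreal (polydisc_kernel x y * (\<Prod>i\<in>UNIV. cmod (y $ i) powr (- u i) * (1 - (cmod (y $ i))\<^sup>2) powr (-v))) \<partial>polydisc_measure"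
    have "?K
      = (\<integral>\<^sup>+y. (\<Prod>i\<in>UNIV. ennreal (cmod (y $ i) powr (- u i) * (1 - (cmod (y $ i))\<^sup>2) powr (-v) / (cmod (1 - (x $ i * cnj (y $ i)) ^ nat_d i))\<^sup>2)) \<partial>polydisc_measure)"
      by (intro nn_integral_cong) (simp add: prod_ennreal polydisc_kernel_def prod.distrib[symmetric])
    also have "\<dots> = (\<Prod>i\<in>UNIV. \<integral>\<^sup>+y. ennreal (cmod y powr (- u i) * (1 - (cmod y)\<^sup>2) powr (-v) / (cmod (1 - (x $ i * cnj y) ^ nat_d i))\<^sup>2) \<partial>disc_measure)"
      by (rule nn_integral_polydisc_prod) measurable
    also have "\<dots> \<le> (\<Prod>i\<in>UNIV. ennreal (C i * (1 - (cmod (x $ i))\<^sup>2) powr (-v)))"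
      using x nat_d_pos by (intro prod_mono_ennreal C(2)) (auto simp: punctured_polydisc_def)
    also have "\<dots> = ennreal ((\<Prod>i\<in>UNIV. C i) * (\<Prod>i\<in>UNIV. (1 - (cmod (x $ i))\<^sup>2) powr (-v)))"
      using C(1) by (simp add: prod_ennreal less_imp_le prod.distrib)
    finally show "?K
      \<le> ennreal ((\<Prod>i\<in>UNIV. C i) * (\<Prod>i\<in>UNIV. (1 - (cmod (x $ i))\<^sup>2) powr (-v)))" .
  qed
qed

text \<open>
  Schur's test with \<open>H1 = \<Prod> \<bar>y\<^sub>i\<bar> powr (- u\<^sub>i) (1 - \<bar>y\<^sub>i\<bar>\<^sup>2) powr (- 1/2)\<close>, where \<open>u\<^sub>i = a\<^sub>i / (p - 1)\<close>. For fixed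
  \<open>x\<close> the power mean inequality for the measure \<open>K(x, y) H1(y) dy\<close> bounds the \<open>p\<close>-th power of
  \<open>\<integral> K g = \<integral> K H1 (g / H1)\<close> by \<open>(\<integral> K H1) powr (p - 1) \<cdot> \<integral> K g powr p H1 powr (1 - p)\<close>. The exponents are
  chosen such that \<open>H1 powr (1 - p) = W / H2\<close>, where \<open>W\<close> is the weight and \<open>H2\<close> is again a Forelli-Rudin
  test function, this time without singularity at the origin. Integrating in \<open>x\<close> against \<open>W\<close> then
  reproduces \<open>H2\<close>, which cancels. The bound \<open>a\<^sub>i < 2 (p - 1)\<close> is \<open>u\<^sub>i < 2\<close>; and \<open>p \<le> 2\<close> ensures that the exponent
  \<open>(p - 1) / 2\<close> in \<open>H2\<close> is less than \<open>1\<close>.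
\<close>
theorem polydisc_kernel_weighted_bound:
  fixes a :: "'n \<Rightarrow> real"
  assumes p: "1 < p" "p \<le> 2" and a: "\<And>i. 0 \<le> a i" "\<And>i. a i < 2 * (p - 1)"
  obtains C where "C > 0" "\<And>g. g \<in> borel_measurable borel \<Longrightarrow> (\<And>y. 0 \<le> g y) \<Longrightarrow>
    (\<integral>\<^sup>+x. ennreal ((LINT y|polydisc_measure. polydisc_kernel x y * g y) powr p * (\<Prod>i\<in>UNIV. cmod (x $ i) powr a i)) \<partial>polydisc_measure)
     \<le> ennreal C * (\<integral>\<^sup>+y. ennreal (g y powr p * (\<Prod>i\<in>UNIV. cmod (y $ i) powr a i)) \<partial>polydisc_measure)"
proof -
  let ?h = "\<lambda>x. \<Prod>i\<in>UNIV. (1 - (cmod (x $ i))\<^sup>2) powr (-(1/2))"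
  \<comment> \<open>exponents for which \<open>H1 powr (p - 1)\<close> times the weight has no singularity at the origin\<close>
  define u where "u i = a i / (p - 1)" for i
  define v where "v = (p - 1) / 2"
  have u: "0 \<le> u i" "u i < 2" for i using a[of i] p by (auto simp: u_def field_simps)
  have v: "0 < v" "v < 1" using p by (auto simp: v_def)
  have half: "0 < (1/2 :: real)" "(1/2 :: real) < 1" by auto
  have zero: "\<And>i::'n. 0 \<le> (0::real)" "\<And>i::'n. (0::real) < 2" by auto
  obtain C1 where C1: "C1 > 0" "\<And>x. x \<in> punctured_polydisc \<Longrightarrow>
    (\<integral>\<^sup>+y. ennreal (polydisc_kernel x y * (\<Prod>i\<in>UNIV. cmod (y $ i) powr (- u i) * (1 - (cmod (y $ i))\<^sup>2) powr (-(1/2)))) \<partial>polydisc_measure)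
      \<le> ennreal (C1 * ?h x)"
    by (rule polydisc_kernel_forelli_rudin[of u "1/2", OF u(1) u(2) half]) blast
  obtain C2 where C2: "C2 > 0" "\<And>x. x \<in> punctured_polydisc \<Longrightarrow>
    (\<integral>\<^sup>+y. ennreal (polydisc_kernel x y * (\<Prod>i\<in>UNIV. cmod (y $ i) powr (- 0) * (1 - (cmod (y $ i))\<^sup>2) powr (-v))) \<partial>polydisc_measure)
      \<le> ennreal (C2 * (\<Prod>i\<in>UNIV. (1 - (cmod (x $ i))\<^sup>2) powr (-v)))"
    by (rule polydisc_kernel_forelli_rudin[of "\<lambda>_. 0" v, OF zero v]) blast
  define H1 where "H1 y = (\<Prod>i\<in>UNIV. cmod (y $ i) powr (- u i) * (1 - (cmod (y $ i))\<^sup>2) powr (-(1/2)))" for y :: "complex ^ 'n"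
  define H2 where "H2 y = (\<Prod>i\<in>UNIV. (1 - (cmod (y $ i))\<^sup>2) powr (-v))" for y :: "complex ^ 'n"
  define W where "W y = (\<Prod>i\<in>UNIV. cmod (y $ i) powr a i)" for y :: "complex ^ 'n"
  have [measurable]: "H1 \<in> borel_measurable borel" "H2 \<in> borel_measurable borel" "W \<in> borel_measurable borel"
    unfolding H1_def[abs_def] H2_def[abs_def] W_def[abs_def] by measurable
  have H1n: "0 \<le> H1 y" and H2n: "0 \<le> H2 y" and Wn: "0 \<le> W y" for y
    by (auto simp: H1_def H2_def W_def intro!: prod_nonneg)
  have sq: "0 < 1 - (cmod (y $ i))\<^sup>2" if "y \<in> punctured_polydisc" for y i
    using that cmod_less_imp_square_less[of "y $ i"] by (simp add: punctured_polydisc_def)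
  have H1p: "0 < H1 y" and H2p: "0 < H2 y" if y: "y \<in> punctured_polydisc" for y
    using sq[OF y] y by (auto simp: H1_def H2_def punctured_polydisc_def less_imp_neq[symmetric] intro!: prod_pos mult_pos_pos)
  have W1: "W y \<le> 1" if y: "y \<in> punctured_polydisc" for y
    unfolding W_def using y a(1) by (intro prod_le_1 conjI) (auto simp: punctured_polydisc_def less_imp_le intro!: powr_le1)
  have H12: "H1 y powr (1 - p) = W y / H2 y" if y: "y \<in> punctured_polydisc" for y
  proof -
    have "H1 y powr (1 - p) = (\<Prod>i\<in>UNIV. (cmod (y $ i) powr (- u i) * (1 - (cmod (y $ i))\<^sup>2) powr (-(1/2))) powr (1 - p))"
      unfolding H1_def by (subst prod_powr_distrib) auto
    also have "\<dots> = (\<Prod>i\<in>UNIV. cmod (y $ i) powr a i / (1 - (cmod (y $ i))\<^sup>2) powr (-v))"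
    proof (intro prod.cong refl)
      fix i
      have "- u i * (1 - p) = a i" using p by (simp add: u_def field_simps)
      moreover have "-(1/2) * (1 - p) = v" by (simp add: v_def field_simps)
      ultimately show "(cmod (y $ i) powr (- u i) * (1 - (cmod (y $ i))\<^sup>2) powr (-(1/2))) powr (1 - p) = cmod (y $ i) powr a i / (1 - (cmod (y $ i))\<^sup>2) powr (-v)"
        unfolding powr_mult powr_powr by (simp only: powr_minus divide_inverse inverse_inverse_eq)
    qed
    finally show ?thesis by (simp add: W_def H2_def prod_dividef)
  qed
  show thesis
  proof
    show "C1 powr (p - 1) * C2 > 0" using C1(1) C2(1) by simp
    fix g :: "complex ^ 'n \<Rightarrow> real" assume g [measurable]: "g \<in> borel_measurable borel" and g0: "\<And>y. 0 \<le> g y"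
    let ?G = "\<lambda>y. g y powr p * W y / H2 y"
    let ?L = "\<lambda>x. LINT y|polydisc_measure. polydisc_kernel x y * g y"
    let ?F = "\<lambda>x y. ennreal (H2 x) * ennreal (polydisc_kernel x y) * ennreal (?G y)"
    have pt: "ennreal (?L x powr p * W x) \<le>
        ennreal (C1 powr (p - 1)) * (\<integral>\<^sup>+y. ?F x y \<partial>polydisc_measure)"
      if x: "x \<in> punctured_polydisc" for x
    proof (cases "integrable polydisc_measure (\<lambda>y. polydisc_kernel x y * g y)")
      case False
      then show ?thesis by (simp add: not_integrable_integral_eq)
    next
      case True
      let ?w = "\<lambda>y. polydisc_kernel x y * H1 y" and ?s = "\<lambda>y. g y / H1 y"
      have wfin: "(\<integral>\<^sup>+y. ennreal (?w y) \<partial>polydisc_measure) \<le> ennreal (C1 * ?h x)"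
        using C1(2)[OF x] by (simp only: H1_def)
      have iw: "integrable polydisc_measure ?w"
        using wfin H1n polydisc_kernel_nonneg by (intro integrableI_nonneg) (auto intro: le_less_trans)
      have N: "(LINT y|polydisc_measure. ?w y) \<le> C1 * ?h x"
      proof -
        have "ennreal (LINT y|polydisc_measure. ?w y) \<le> ennreal (C1 * ?h x)"
          using wfin nn_integral_eq_integral[OF iw] H1n polydisc_kernel_nonneg by auto
        then show ?thesis using C1(1) by (subst (asm) ennreal_le_iff) (auto intro!: mult_nonneg_nonneg prod_nonneg)
      qed
      have N0: "0 \<le> (LINT y|polydisc_measure. ?w y)" using H1n polydisc_kernel_nonneg by (intro Bochner_Integration.integral_nonneg) auto
      have AEws: "AE y in polydisc_measure. ?w y * ?s y = polydisc_kernel x y * g y"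
        by (rule eventually_mono[OF AE_polydisc_measure]) (use H1p in \<open>auto simp: less_imp_neq[symmetric]\<close>)
      have iws: "integrable polydisc_measure (\<lambda>y. ?w y * ?s y)"
        using True by (subst integrable_cong_AE[OF _ _ AEws]) auto
      have "ennreal (?L x powr p) = ennreal ((LINT y|polydisc_measure. ?w y * ?s y) powr p)"
        by (subst integral_cong_AE[OF _ _ AEws]) auto
      also have "\<dots> \<le> ennreal ((LINT y|polydisc_measure. ?w y) powr (p - 1)) * (\<integral>\<^sup>+y. ennreal (?w y * ?s y powr p) \<partial>polydisc_measure)"
        by (rule weighted_power_mean[OF p(1) _ _ iw iws]) (use H1n g0 polydisc_kernel_nonneg in auto)
      also have "(\<integral>\<^sup>+y. ennreal (?w y * ?s y powr p) \<partial>polydisc_measure) = (\<integral>\<^sup>+y. ennreal (polydisc_kernel x y) * ennreal (?G y) \<partial>polydisc_measure)"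
      proof (intro nn_integral_cong_AE eventually_mono[OF AE_polydisc_measure])
        fix y :: "complex ^ 'n" assume y: "y \<in> punctured_polydisc"
        have "H1 y * (g y / H1 y) powr p = g y powr p * H1 y powr (1 - p)"
        proof -
          have "(g y / H1 y) powr p = g y powr p / H1 y powr p" using g0 H1n by (simp add: powr_divide)
          moreover have "H1 y powr (1 - p) = H1 y / H1 y powr p" using H1p[OF y] by (simp add: powr_diff)
          ultimately show ?thesis by simp
        qed
        then have "?w y * ?s y powr p = polydisc_kernel x y * ?G y" unfolding H12[OF y] by (simp add: mult.assoc)
        then show "ennreal (?w y * ?s y powr p) = ennreal (polydisc_kernel x y) * ennreal (?G y)"
          by (simp only: ennreal_mult'[OF polydisc_kernel_nonneg])
      qed
      finally have 1: "ennreal (?L x powr p) \<le> ennreal ((LINT y|polydisc_measure. ?w y) powr (p - 1)) * (\<integral>\<^sup>+y. ennreal (polydisc_kernel x y) * ennreal (?G y) \<partial>polydisc_measure)" .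
      have 2: "(LINT y|polydisc_measure. ?w y) powr (p - 1) \<le> C1 powr (p - 1) * H2 x"
      proof -
        have "(LINT y|polydisc_measure. ?w y) powr (p - 1) \<le> (C1 * ?h x) powr (p - 1)"
          using N N0 p by (intro powr_mono2) auto
        also have "\<dots> = C1 powr (p - 1) * ?h x powr (p - 1)"
          by (rule powr_mult)
        also have "?h x powr (p - 1) = (\<Prod>i\<in>UNIV. ((1 - (cmod (x $ i))\<^sup>2) powr (-(1/2))) powr (p - 1))"
          by (rule prod_powr_distrib)
        also have "\<dots> = H2 x" unfolding H2_def v_def powr_powr by (simp add: field_simps)
        finally show ?thesis .
      qed
      have "ennreal (?L x powr p * W x) \<le> ennreal (?L x powr p)"
        using W1[OF x] Wn[of x] by (intro ennreal_leI mult_left_le) auto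
      also note 1
      also have "ennreal ((LINT y|polydisc_measure. ?w y) powr (p - 1)) * (\<integral>\<^sup>+y. ennreal (polydisc_kernel x y) * ennreal (?G y) \<partial>polydisc_measure)
         \<le> ennreal (C1 powr (p - 1) * H2 x) * (\<integral>\<^sup>+y. ennreal (polydisc_kernel x y) * ennreal (?G y) \<partial>polydisc_measure)"
        using 2 by (intro mult_right_mono ennreal_leI) auto
      also have "\<dots> = ennreal (C1 powr (p - 1)) * (\<integral>\<^sup>+y. ?F x y \<partial>polydisc_measure)"
        using H2n by (simp add: ennreal_mult mult.assoc nn_integral_cmult)
      finally show ?thesis .
    qed
    have "(\<integral>\<^sup>+x. ennreal (?L x powr p * W x) \<partial>polydisc_measure)
       \<le> (\<integral>\<^sup>+x. ennreal (C1 powr (p - 1)) * (\<integral>\<^sup>+y. ?F x y \<partial>polydisc_measure) \<partial>polydisc_measure)"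
      by (intro nn_integral_mono_AE eventually_mono[OF AE_polydisc_measure] pt)
    also have "\<dots> = ennreal (C1 powr (p - 1)) * (\<integral>\<^sup>+x. (\<integral>\<^sup>+y. ?F x y \<partial>polydisc_measure) \<partial>polydisc_measure)"
      by (rule nn_integral_cmult) (intro sigma_finite_measure.borel_measurable_nn_integral[OF sigma_finite_polydisc], measurable)
    also have "(\<integral>\<^sup>+x. (\<integral>\<^sup>+y. ?F x y \<partial>polydisc_measure) \<partial>polydisc_measure) =
       (\<integral>\<^sup>+y. (\<integral>\<^sup>+x. ?F x y \<partial>polydisc_measure) \<partial>polydisc_measure)"
      by (rule pair_sigma_finite.Fubini') (auto simp: pair_sigma_finite_def sigma_finite_polydisc)
    also have "\<dots> \<le> (\<integral>\<^sup>+y. ennreal C2 * ennreal (g y powr p * W y) \<partial>polydisc_measure)"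
    proof (intro nn_integral_mono_AE eventually_mono[OF AE_polydisc_measure])
      fix y :: "complex ^ 'n" assume y: "y \<in> punctured_polydisc"
      have "(\<integral>\<^sup>+x. ?F x y \<partial>polydisc_measure) = (\<integral>\<^sup>+x. ennreal (H2 x) * ennreal (polydisc_kernel x y) \<partial>polydisc_measure) * ennreal (?G y)"
        by (rule nn_integral_multc) measurable
      also have "(\<integral>\<^sup>+x. ennreal (H2 x) * ennreal (polydisc_kernel x y) \<partial>polydisc_measure) = 
         (\<integral>\<^sup>+x. ennreal (polydisc_kernel y x * (\<Prod>i\<in>UNIV. cmod (x $ i) powr (- 0) * (1 - (cmod (x $ i))\<^sup>2) powr (-v))) \<partial>polydisc_measure)"
      proof (intro nn_integral_cong_AE eventually_mono[OF AE_polydisc_measure])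
        fix x :: "complex ^ 'n" assume "x \<in> punctured_polydisc"
        then have "H2 x = (\<Prod>i\<in>UNIV. cmod (x $ i) powr (- 0) * (1 - (cmod (x $ i))\<^sup>2) powr (-v))"
          unfolding H2_def by (intro prod.cong refl) (simp add: punctured_polydisc_def)
        then show "ennreal (H2 x) * ennreal (polydisc_kernel x y) = ennreal (polydisc_kernel y x * (\<Prod>i\<in>UNIV. cmod (x $ i) powr (- 0) * (1 - (cmod (x $ i))\<^sup>2) powr (-v)))"
          using H2n[of x] polydisc_kernel_nonneg[of x y] polydisc_kernel_commute[of x y] by (metis ennreal_mult mult.commute)
      qed
      also have "\<dots> \<le> ennreal (C2 * H2 y)" using C2(2)[OF y] by (simp only: H2_def)
      finally have "(\<integral>\<^sup>+x. ?F x y \<partial>polydisc_measure) \<le> ennreal (C2 * H2 y) * ennreal (?G y)"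
        by (simp add: mult_right_mono)
      also have "\<dots> = ennreal C2 * ennreal (g y powr p * W y)"
        using C2(1) H2p[OF y] Wn[of y] by (simp add: ennreal_mult[symmetric])
      finally show "(\<integral>\<^sup>+x. ?F x y \<partial>polydisc_measure) \<le> ennreal C2 * ennreal (g y powr p * W y)" .
    qed
    also have "\<dots> = ennreal C2 * (\<integral>\<^sup>+y. ennreal (g y powr p * W y) \<partial>polydisc_measure)"
      by (rule nn_integral_cmult) measurable
    finally have "(\<integral>\<^sup>+x. ennreal (?L x powr p * W x) \<partial>polydisc_measure)
      \<le> ennreal (C1 powr (p - 1)) * (ennreal C2 * (\<integral>\<^sup>+y. ennreal (g y powr p * W y) \<partial>polydisc_measure))"
      by (simp add: mult_left_mono)
    also have "\<dots> = ennreal (C1 powr (p - 1) * C2) * (\<integral>\<^sup>+y. ennreal (g y powr p * W y) \<partial>polydisc_measure)"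
      using C2(1) by (simp add: ennreal_mult mult.assoc)
    finally show "(\<integral>\<^sup>+x. ennreal (?L x powr p * (\<Prod>i\<in>UNIV. cmod (x $ i) powr a i)) \<partial>polydisc_measure)
     \<le> ennreal (C1 powr (p - 1) * C2) * (\<integral>\<^sup>+y. ennreal (g y powr p * (\<Prod>i\<in>UNIV. cmod (y $ i) powr a i)) \<partial>polydisc_measure)"
      by (simp only: W_def)
  qed
qed

lemma cmod_jac_powr:
  assumes y: "y \<in> punctured_polydisc"
  shows "cmod (jac y) powr t = (\<Prod>i\<in>UNIV. cmod (y $ i) powr (of_int (column_sum i - 1) * t))"
proof -
  have "cmod (jac y) = (\<Prod>i\<in>UNIV. cmod (y $ i) powr of_int (column_sum i - 1))"
    unfolding jac_def cmod_laurent_monomial using y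
    by (intro prod.cong refl, subst powr_real_of_int') (auto simp: punctured_polydisc_def)
  then show ?thesis by (simp add: prod_powr_distrib powr_powr)
qed

end

section \<open>The absolute Bergman operator\<close>

text \<open>
  With \<open>g y = \<bar>jac y\<bar>\<close> on the preimage of \<open>E\<close>, the change of variables and \<open>kernel_bound\<close> reduce the claim
  to \<open>polydisc_kernel_weighted_bound\<close>: on the side of the operator the weight \<open>\<bar>jac x\<bar>\<^sup>2\<close> loses the factor
  \<open>\<bar>jac x\<bar> powr p\<close> to the kernel, and on the side of \<open>E\<close> the power \<open>g powr p\<close> completes
  \<open>\<bar>jac y\<bar> powr (2 - p)\<close> to \<open>\<bar>jac y\<bar>\<^sup>2\<close>.
\<close>
lemma (in monomial_domain) restricted_type_abs_bergman:
  assumes p: "1 < p" "p \<le> 2"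
    and cs: "\<And>j. (of_int (column_sum j) - 1) * (2 - p) < 2 * (p - 1)"
  shows "restricted_type p (lebesgue_on U) (abs_bergman_defined_at U) (abs_bergman U)"
proof -
  let ?D = "\<bar>det real_A\<bar>"
  have D: "?D > 0" using det_real_A by simp
  define a where "a i = of_int (column_sum i - 1) * (2 - p)" for i
  have a: "0 \<le> a i" "a i < 2 * (p - 1)" for i
    using column_sum_pos[of i] p cs[of i] by (auto simp: a_def)
  obtain C where C0: "C > 0" and C: "\<And>g. g \<in> borel_measurable borel \<Longrightarrow> (\<And>y. 0 \<le> g y) \<Longrightarrow>
    (\<integral>\<^sup>+x. ennreal ((LINT y|polydisc_measure. polydisc_kernel x y * g y) powr p * (\<Prod>i\<in>UNIV. cmod (x $ i) powr a i)) \<partial>polydisc_measure)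
     \<le> ennreal C * (\<integral>\<^sup>+y. ennreal (g y powr p * (\<Prod>i\<in>UNIV. cmod (y $ i) powr a i)) \<partial>polydisc_measure)"
    by (rule polydisc_kernel_weighted_bound[of p a, OF p a]) blast
  have kc: "kernel_const \<ge> 0" unfolding kernel_const_def by (intro mult_nonneg_nonneg prod_nonneg) auto
  define C' where "C' = (?D * kernel_const) powr p * C"
  have C'0: "C' \<ge> 0" using C0 by (simp add: C'_def)
  have sfr: "sigma_finite_measure region_measure"
    by (rule sigma_finite_density_lborel) (auto simp: indicator_def)
  have U_leb: "U \<in> sets lebesgue" by simp
  have main: "(AE z in lebesgue_on U. abs_bergman_defined_at U (indicator E) z) \<and>
      abs_bergman U (indicator E) \<in> borel_measurable (lebesgue_on U) \<and>
      (\<integral>\<^sup>+z. ennreal (cmod (abs_bergman U (indicator E) z) powr p) \<partial>lebesgue_on U) \<le> ennreal C' * emeasure (lebesgue_on U) E"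
    if E: "E \<in> sets (lebesgue_on U)" and finE: "emeasure (lebesgue_on U) E < \<infinity>" for E
  proof -
    have E_leb: "E \<in> sets lebesgue"
      using E U_leb by (auto simp: sets_restrict_space_iff)
    \<comment> \<open>a Borel set that agrees with \<open>E\<close> up to a null set\<close>
    define E0 where "E0 = main_part lborel E"
    have E0 [measurable]: "E0 \<in> sets borel"
      using main_part_sets[OF E_leb] by (simp add: E0_def)
    have "AE z in lborel. z \<in> E0 \<longleftrightarrow> z \<in> E"
      unfolding E0_def by (rule AE_in_main_part[OF E_leb])
    then have "AE z in lebesgue. z \<in> E0 \<longleftrightarrow> z \<in> E" by (rule AE_completion)
    then have AEE: "AE z in lebesgue_on U. z \<in> E0 \<longleftrightarrow> z \<in> E"
      by (subst AE_restrict_space_iff) (auto elim: eventually_mono)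
    have emE: "emeasure (lebesgue_on U) E = emeasure region_measure E0"
    proof -
      have "emeasure (lebesgue_on U) E = (\<integral>\<^sup>+z. indicator E z \<partial>lebesgue_on U)"
        using E by simp
      also have "\<dots> = (\<integral>\<^sup>+z. indicator E0 z \<partial>lebesgue_on U)"
        by (intro nn_integral_cong_AE eventually_mono[OF AEE]) (auto simp: indicator_def)
      also have "\<dots> = (\<integral>\<^sup>+z. indicator E0 z \<partial>region_measure)"
        by (subst nn_integral_lebesgue_on) (simp_all add: density_U)
      finally show ?thesis by simp
    qed
    have finE0: "emeasure region_measure E0 < \<infinity>" using finE emE by simp
    define h where "h z w = cmod (kernel z w) * indicator E0 w" for z w
    have [measurable]: "(\<lambda>w. h z w) \<in> borel_measurable borel" for z unfolding h_def by measurable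
    have h0: "0 \<le> h z w" for z w by (simp add: h_def)
    define Q where "Q z = (LINT w|region_measure. h z w)" for z
    have Q0: "0 \<le> Q z" for z unfolding Q_def using h0 by (intro Bochner_Integration.integral_nonneg) auto
    have Qm [measurable]: "Q \<in> borel_measurable borel"
    proof -
      have "(\<lambda>z. LINT w|region_measure. h z w) \<in> borel_measurable borel"
        by (rule sigma_finite_measure.borel_measurable_lebesgue_integral[OF sfr]) (unfold h_def, measurable)
      then show ?thesis by (simp add: Q_def[abs_def])
    qed
    have ih: "integrable region_measure (h z)" if z: "z \<in> region" for z
    proof (rule Bochner_Integration.integrable_bound[where f="\<lambda>w. (cmod (kernel z w))\<^sup>2 + indicator E0 w"])
      show "integrable region_measure (\<lambda>w. (cmod (kernel z w))\<^sup>2 + indicator E0 w)"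
        using kernel_square_integrable[OF z] finE0 by (intro Bochner_Integration.integrable_add integrable_real_indicator) auto
      have "h z w \<le> (cmod (kernel z w))\<^sup>2 + indicator E0 w" for w
      proof -
        have "0 \<le> (cmod (kernel z w) - 1)\<^sup>2" by simp
        then have "2 * cmod (kernel z w) \<le> (cmod (kernel z w))\<^sup>2 + 1" by (simp add: power2_diff)
        then have "cmod (kernel z w) \<le> (cmod (kernel z w))\<^sup>2 + 1" using norm_ge_zero[of "kernel z w"] by linarith
        then show ?thesis by (simp add: h_def indicator_def)
      qed
      then show "AE w in region_measure. norm (h z w) \<le> norm ((cmod (kernel z w))\<^sup>2 + indicator E0 w)"
        using h0 by (intro AE_I2) (auto simp: abs_of_nonneg add_nonneg_nonneg)
    qed measurable
    have [measurable]: "(\<lambda>w. of_real (cmod (extended_kernel z w)) * indicator E w :: complex) \<in> borel_measurable (lebesgue_on U)" for z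
    proof -
      have "extended_kernel z \<in> borel_measurable borel"
        unfolding extended_kernel_def[abs_def] by measurable
      then have "extended_kernel z \<in> borel_measurable (lebesgue_on U)"
        by (intro measurable_restrict_space1 measurable_completion) simp
      moreover have "(indicator E :: _ \<Rightarrow> complex) \<in> borel_measurable (lebesgue_on U)"
        by (rule borel_measurable_indicator[OF E])
      ultimately show ?thesis by measurable
    qed
    have AEk: "AE w in lebesgue_on U. complex_of_real (h z w) = of_real (cmod (bergman_kernel U z w)) * indicator E w" if z: "z \<in> region" for z
    proof -
      have "AE w in lebesgue_on U. w \<in> U" by (intro AE_I2) (simp add: space_restrict_space)
      with AEE show ?thesis
        unfolding bergman_kernel_eq[OF z]
        by eventually_elim (auto simp: h_def extended_kernel_def indicator_def)
    qed
    have ihU: "integrable (lebesgue_on U) (\<lambda>w. complex_of_real (h z w))" if z: "z \<in> region" for z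
    proof (subst integral_lebesgue_on(2))
      show "integrable (density lborel (indicator U)) (\<lambda>w. complex_of_real (h z w))"
        unfolding density_U using ih[OF z] by (rule integrable_of_real)
    qed simp_all
    have def_at: "abs_bergman_defined_at U (indicator E) z" if z: "z \<in> region" for z
      unfolding abs_bergman_defined_at_def
    proof (rule integrable_cong_AE_imp[OF ihU[OF z]])
      show "(\<lambda>\<zeta>. complex_of_real (cmod (bergman_kernel U z \<zeta>)) * indicator E \<zeta>) \<in> borel_measurable (lebesgue_on U)"
        unfolding bergman_kernel_eq[OF z] by measurable
      show "AE w in lebesgue_on U. complex_of_real (h z w) = complex_of_real (cmod (bergman_kernel U z w)) * indicator E w"
        by (rule AEk[OF z])
    qed
    have val: "abs_bergman U (indicator E) z = of_real (Q z)" if z: "z \<in> region" for z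
    proof -
      have "abs_bergman U (indicator E) z = (LINT w|lebesgue_on U. complex_of_real (h z w))"
        unfolding abs_bergman_def
      proof (rule integral_cong_AE)
        show "(\<lambda>\<zeta>. complex_of_real (cmod (bergman_kernel U z \<zeta>)) * indicator E \<zeta>) \<in> borel_measurable (lebesgue_on U)"
          unfolding bergman_kernel_eq[OF z] by measurable
        show "(\<lambda>w. complex_of_real (h z w)) \<in> borel_measurable (lebesgue_on U)" using ihU[OF z] by auto
        show "AE w in lebesgue_on U. complex_of_real (cmod (bergman_kernel U z w)) * indicator E w = complex_of_real (h z w)"
          using AEk[OF z] by (rule eventually_mono) simp
      qed
      also have "\<dots> = (LINT w|region_measure. complex_of_real (h z w))"
        by (subst integral_lebesgue_on(1)) (simp_all add: density_U)
      finally show ?thesis by (simp add: Q_def)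
    qed
    have meas: "abs_bergman U (indicator E) \<in> borel_measurable (lebesgue_on U)"
    proof (rule measurableI)
      fix S :: "complex set" assume S: "S \<in> sets borel"
      let ?T = "abs_bergman U (indicator E)"
      have Qc: "(\<lambda>z. complex_of_real (Q z)) \<in> borel_measurable borel" by measurable
      have 1: "region \<inter> ((\<lambda>z. complex_of_real (Q z)) -` S) \<in> sets lebesgue"
        using measurable_sets[OF Qc S] by auto
      \<comment> \<open>off the region nothing is known about the values, but that part is a null set\<close>
      have 2: "(U - region) \<inter> ?T -` S \<in> sets lebesgue"
      proof -
        have "U - region \<in> null_sets lebesgue"
        proof -
          have "U - region \<in> sets borel" by measurable
          moreover have "AE z in lborel. z \<notin> U - region"
            by (rule eventually_mono[OF AE_complex_torus]) (simp add: region_def)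
          ultimately have "U - region \<in> null_sets lborel" by (subst AE_iff_null_sets) auto
          then show ?thesis by (rule null_sets_completionI)
        qed
        then have "(U - region) \<inter> ?T -` S \<in> null_sets lebesgue"
          by (rule null_sets_completion_subset[rotated]) auto
        then show ?thesis by auto
      qed
      have "?T -` S \<inter> space (lebesgue_on U) = (region \<inter> ((\<lambda>z. complex_of_real (Q z)) -` S)) \<union> ((U - region) \<inter> ?T -` S)"
        using region_subset val by (auto simp: space_restrict_space)
      moreover have "\<dots> \<in> sets lebesgue" using 1 2 by (rule sets.Un)
      ultimately show "?T -` S \<inter> space (lebesgue_on U) \<in> sets (lebesgue_on U)"
        using U_leb by (auto simp: sets_restrict_space_iff space_restrict_space)
    qed simp
    define g where "g y = cmod (jac y) * indicator E0 (cover y)" for y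
    have gm [measurable]: "g \<in> borel_measurable borel" unfolding g_def[abs_def] by measurable
    have g0: "0 \<le> g y" for y by (simp add: g_def)
    have E0pull: "emeasure region_measure E0 = (\<integral>\<^sup>+y. ennreal (?D * (cmod (jac y))\<^sup>2) * indicator E0 (cover y) \<partial>polydisc_measure)"
      using nn_integral_region[of "indicator E0"] by simp
    have ig: "integrable polydisc_measure g"
    proof (rule integrableI_nonneg)
      have "(\<integral>\<^sup>+y. ennreal (g y) \<partial>polydisc_measure) \<le> (\<integral>\<^sup>+y. 1 + ennreal (1 / ?D) * (ennreal (?D * (cmod (jac y))\<^sup>2) * indicator E0 (cover y)) \<partial>polydisc_measure)"
      proof (intro nn_integral_mono)
        fix y
        have "0 \<le> (cmod (jac y) - 1)\<^sup>2" by simp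
        then have "2 * cmod (jac y) \<le> (cmod (jac y))\<^sup>2 + 1" by (simp add: power2_diff)
        then have "cmod (jac y) \<le> 1 + (cmod (jac y))\<^sup>2" using norm_ge_zero[of "jac y"] by linarith
        then have "ennreal (cmod (jac y)) \<le> 1 + ennreal ((cmod (jac y))\<^sup>2)"
          using ennreal_leI[of "cmod (jac y)" "1 + (cmod (jac y))\<^sup>2"] by (subst (asm) ennreal_plus) simp_all
        then show "ennreal (g y) \<le> 1 + ennreal (1 / ?D) * (ennreal (?D * (cmod (jac y))\<^sup>2) * indicator E0 (cover y))"
          using D by (simp add: g_def indicator_def ennreal_mult[symmetric])
      qed
      also have "\<dots> = emeasure (polydisc_measure :: (complex ^ 'a) measure) UNIV + ennreal (1 / ?D) * emeasure region_measure E0"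
        unfolding E0pull by (subst nn_integral_add) (simp_all add: nn_integral_cmult)
      also have "\<dots> < \<infinity>" using finE0 by (simp add: emeasure_polydisc_measure ennreal_mult_less_top)
      finally show "(\<integral>\<^sup>+y. ennreal (g y) \<partial>polydisc_measure) < \<infinity>" .
    qed (use g0 in auto)
    have Qpull: "cmod (jac x) * Q (cover x) \<le> ?D * kernel_const * (LINT y|polydisc_measure. polydisc_kernel x y * g y)"
      if x: "x \<in> punctured_polydisc" for x
    proof -
      have z: "cover x \<in> region" using cover_in_region_iff[OF punctured_subset_torus[OF x]] x by simp
      obtain M where M: "\<And>y. y \<in> punctured_polydisc \<Longrightarrow> 0 \<le> polydisc_kernel x y \<and> polydisc_kernel x y \<le> M" and M0: "M \<ge> 0"
        using polydisc_kernel_bounded[OF x] by blast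
      have i1: "integrable polydisc_measure (\<lambda>y. (?D * (cmod (jac y))\<^sup>2) *\<^sub>R h (cover x) (cover y))"
        using ih[OF z] by (subst (asm) integral_region(2)) simp_all
      have i2: "integrable polydisc_measure (\<lambda>y. polydisc_kernel x y * g y)"
      proof (rule Bochner_Integration.integrable_bound[where f="\<lambda>y. M * g y"])
        show "integrable polydisc_measure (\<lambda>y. M * g y)" using ig by simp
        show "AE y in polydisc_measure. norm (polydisc_kernel x y * g y) \<le> norm (M * g y)"
          using M M0 g0 polydisc_kernel_nonneg by (intro eventually_mono[OF AE_polydisc_measure]) (auto simp: abs_mult intro!: mult_right_mono)
      qed measurable
      have "cmod (jac x) * Q (cover x) = (LINT y|polydisc_measure. cmod (jac x) * ((?D * (cmod (jac y))\<^sup>2) *\<^sub>R h (cover x) (cover y)))"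
        unfolding Q_def by (subst integral_region(1)) simp_all
      also have "\<dots> \<le> (LINT y|polydisc_measure. ?D * kernel_const * (polydisc_kernel x y * g y))"
      proof (rule integral_mono_AE)
        show "AE y in polydisc_measure. cmod (jac x) * ((?D * (cmod (jac y))\<^sup>2) *\<^sub>R h (cover x) (cover y)) \<le> ?D * kernel_const * (polydisc_kernel x y * g y)"
        proof (rule eventually_mono[OF AE_polydisc_measure])
          fix y :: "complex ^ 'a" assume y: "y \<in> punctured_polydisc"
          have "cmod (jac x) * cmod (jac y) * cmod (kernel (cover x) (cover y)) * (?D * g y) \<le> kernel_const * polydisc_kernel x y * (?D * g y)"
            using kernel_bound[OF x y] g0[of y] D by (intro mult_right_mono) auto
          then show "cmod (jac x) * ((?D * (cmod (jac y))\<^sup>2) *\<^sub>R h (cover x) (cover y)) \<le> ?D * kernel_const * (polydisc_kernel x y * g y)"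
            by (cases "cover y \<in> E0") (simp_all add: h_def g_def power2_eq_square mult_ac)
        qed
      qed (use i1 i2 in auto)
      finally show ?thesis using i2 by simp
    qed
    let ?L = "\<lambda>x. LINT y|polydisc_measure. polydisc_kernel x y * g y"
    have W: "(\<Prod>i\<in>UNIV. cmod (y $ i) powr a i) = cmod (jac y) powr (2 - p)" if "y \<in> punctured_polydisc" for y
      unfolding a_def by (rule cmod_jac_powr[OF that, symmetric])
    have "(\<integral>\<^sup>+z. ennreal (cmod (abs_bergman U (indicator E) z) powr p) \<partial>lebesgue_on U) = (\<integral>\<^sup>+z. ennreal (Q z powr p) \<partial>lebesgue_on U)"
      by (intro nn_integral_cong_AE eventually_mono[OF AE_region]) (simp add: val Q0)
    also have "\<dots> = (\<integral>\<^sup>+z. ennreal (Q z powr p) \<partial>region_measure)"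
      by (subst nn_integral_lebesgue_on) (simp_all add: density_U)
    also have "\<dots> = (\<integral>\<^sup>+x. ennreal (?D * (cmod (jac x))\<^sup>2) * ennreal (Q (cover x) powr p) \<partial>polydisc_measure)"
      by (rule nn_integral_region) measurable
    also have "\<dots> \<le> (\<integral>\<^sup>+x. ennreal (?D * (?D * kernel_const) powr p) * ennreal (?L x powr p * (\<Prod>i\<in>UNIV. cmod (x $ i) powr a i)) \<partial>polydisc_measure)"
    proof (intro nn_integral_mono_AE eventually_mono[OF AE_polydisc_measure])
      fix x :: "complex ^ 'a" assume x: "x \<in> punctured_polydisc"
      have L0: "0 \<le> ?L x" using g0 polydisc_kernel_nonneg by (intro Bochner_Integration.integral_nonneg) auto
      have j: "cmod (jac x) > 0" using jac_nonzero[OF punctured_subset_torus[OF x]] by simp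
      have "(cmod (jac x))\<^sup>2 * Q (cover x) powr p = cmod (jac x) powr (2 - p) * (cmod (jac x) * Q (cover x)) powr p"
      proof -
        have "(cmod (jac x))\<^sup>2 = cmod (jac x) powr (2 - p) * cmod (jac x) powr p"
          using j by (simp add: powr_add[symmetric])
        then show ?thesis using j Q0[of "cover x"] by (simp add: powr_mult mult.assoc)
      qed
      also have "\<dots> \<le> cmod (jac x) powr (2 - p) * (?D * kernel_const * ?L x) powr p"
        using Qpull[OF x] j Q0[of "cover x"] p by (intro mult_left_mono powr_mono2) auto
      also have "(?D * kernel_const * ?L x) powr p = (?D * kernel_const) powr p * ?L x powr p"
        by (rule powr_mult)
      finally have "?D * ((cmod (jac x))\<^sup>2 * Q (cover x) powr p) \<le> ?D * (cmod (jac x) powr (2 - p) * ((?D * kernel_const) powr p * ?L x powr p))"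
        by (intro mult_left_mono) auto
      then have "?D * (cmod (jac x))\<^sup>2 * Q (cover x) powr p \<le> ?D * (?D * kernel_const) powr p * (?L x powr p * (\<Prod>i\<in>UNIV. cmod (x $ i) powr a i))"
        unfolding W[OF x] by (simp only: ac_simps)
      then have "ennreal (?D * (cmod (jac x))\<^sup>2 * Q (cover x) powr p) \<le> ennreal (?D * (?D * kernel_const) powr p * (?L x powr p * (\<Prod>i\<in>UNIV. cmod (x $ i) powr a i)))"
        by (rule ennreal_leI)
      then show "ennreal (?D * (cmod (jac x))\<^sup>2) * ennreal (Q (cover x) powr p) \<le> ennreal (?D * (?D * kernel_const) powr p) * ennreal (?L x powr p * (\<Prod>i\<in>UNIV. cmod (x $ i) powr a i))"
        by (simp add: ennreal_mult' prod_nonneg del: ennreal_le_iff)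
    qed
    also have "\<dots> = ennreal (?D * (?D * kernel_const) powr p) * (\<integral>\<^sup>+x. ennreal (?L x powr p * (\<Prod>i\<in>UNIV. cmod (x $ i) powr a i)) \<partial>polydisc_measure)"
    proof (rule nn_integral_cmult)
      have [measurable]: "(\<lambda>x. LINT y|polydisc_measure. polydisc_kernel x y * g y) \<in> borel_measurable (polydisc_measure :: (complex ^ 'a) measure)"
        by (rule sigma_finite_measure.borel_measurable_lebesgue_integral[OF sigma_finite_polydisc]) measurable
      show "(\<lambda>x. ennreal (?L x powr p * (\<Prod>i\<in>UNIV. cmod (x $ i) powr a i))) \<in> borel_measurable polydisc_measure"
        by measurable
    qed
    also have "\<dots> \<le> ennreal (?D * (?D * kernel_const) powr p) * (ennreal C * (\<integral>\<^sup>+y. ennreal (g y powr p * (\<Prod>i\<in>UNIV. cmod (y $ i) powr a i)) \<partial>polydisc_measure))"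
      by (intro mult_left_mono C[OF gm g0]) auto
    also have "(\<integral>\<^sup>+y. ennreal (g y powr p * (\<Prod>i\<in>UNIV. cmod (y $ i) powr a i)) \<partial>polydisc_measure) = (\<integral>\<^sup>+y. ennreal (1 / ?D) * (ennreal (?D * (cmod (jac y))\<^sup>2) * indicator E0 (cover y)) \<partial>polydisc_measure)"
    proof (intro nn_integral_cong_AE eventually_mono[OF AE_polydisc_measure])
      fix y :: "complex ^ 'a" assume y: "y \<in> punctured_polydisc"
      have j: "cmod (jac y) > 0" using jac_nonzero[OF punctured_subset_torus[OF y]] by simp
      then have "cmod (jac y) powr p * cmod (jac y) powr (2 - p) = (cmod (jac y))\<^sup>2"
        by (simp add: powr_add[symmetric])
      then show "ennreal (g y powr p * (\<Prod>i\<in>UNIV. cmod (y $ i) powr a i)) = ennreal (1 / ?D) * (ennreal (?D * (cmod (jac y))\<^sup>2) * indicator E0 (cover y))"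
        unfolding W[OF y] using D by (cases "cover y \<in> E0") (simp_all add: g_def ennreal_mult[symmetric])
    qed
    also have "\<dots> = ennreal (1 / ?D) * emeasure region_measure E0"
      unfolding E0pull by (rule nn_integral_cmult) measurable
    also have "ennreal (?D * (?D * kernel_const) powr p) * (ennreal C * (ennreal (1 / ?D) * emeasure region_measure E0)) = ennreal C' * emeasure region_measure E0"
    proof -
      have "ennreal (?D * (?D * kernel_const) powr p) * (ennreal C * (ennreal (1 / ?D) * emeasure region_measure E0)) = 
         (ennreal (?D * (?D * kernel_const) powr p) * (ennreal C * ennreal (1 / ?D))) * emeasure region_measure E0"
        by (simp only: mult.assoc)
      also have "ennreal (?D * (?D * kernel_const) powr p) * (ennreal C * ennreal (1 / ?D)) = ennreal C'"
        using C0 D by (simp add: ennreal_mult[symmetric] C'_def)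
      finally show ?thesis .
    qed
    finally have "(\<integral>\<^sup>+z. ennreal (cmod (abs_bergman U (indicator E) z) powr p) \<partial>lebesgue_on U) \<le> ennreal C' * emeasure (lebesgue_on U) E"
      unfolding emE .
    moreover have "AE z in lebesgue_on U. abs_bergman_defined_at U (indicator E) z"
      by (rule eventually_mono[OF AE_region]) (rule def_at)
    ultimately show ?thesis using meas by blast
  qed
  \<comment> \<open>\<open>C'\<close> may be zero, but the constant has to be positive\<close>
  show ?thesis unfolding restricted_type_def
  proof (intro exI[of _ "(C' + 1) powr (1 / p)"] conjI ballI impI)
    show "0 < (C' + 1) powr (1 / p)" using C'0 by simp
    fix E assume E: "E \<in> sets (lebesgue_on U)" and finE: "emeasure (lebesgue_on U) E < \<infinity>"
    let ?T = "abs_bergman U (indicator E)"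
    note m = main[OF E finE]
    show "AE z in lebesgue_on U. abs_bergman_defined_at U (indicator E) z" using m by blast
    have Tm [measurable]: "?T \<in> borel_measurable (lebesgue_on U)" using m by blast
    have le: "(\<integral>\<^sup>+z. ennreal (cmod (?T z) powr p) \<partial>lebesgue_on U) \<le> ennreal (C' * measure (lebesgue_on U) E)"
      using m finE C'0 by (simp add: emeasure_eq_ennreal_measure ennreal_mult)
    have int: "integrable (lebesgue_on U) (\<lambda>z. cmod (?T z) powr p)"
      using le by (intro integrableI_nonneg) (auto intro: le_less_trans)
    then show "?T \<in> Lp_space p (lebesgue_on U)" by (simp add: Lp_space_def)
    have "ennreal (LINT z|lebesgue_on U. cmod (?T z) powr p) \<le> ennreal (C' * measure (lebesgue_on U) E)"
      using le nn_integral_eq_integral[OF int] by simp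
    then have "(LINT z|lebesgue_on U. cmod (?T z) powr p) \<le> C' * measure (lebesgue_on U) E"
      using C'0 by (subst (asm) ennreal_le_iff) auto
    also have "\<dots> \<le> (C' + 1) * measure (lebesgue_on U) E" by (intro mult_right_mono) auto
    finally have "(LINT z|lebesgue_on U. cmod (?T z) powr p) powr (1 / p) \<le> ((C' + 1) * measure (lebesgue_on U) E) powr (1 / p)"
      using p by (intro powr_mono2 Bochner_Integration.integral_nonneg) auto
    also have "\<dots> = (C' + 1) powr (1 / p) * measure (lebesgue_on U) E powr (1 / p)"
      by (rule powr_mult)
    also have "measure (lebesgue_on U) E = (LINT z|lebesgue_on U. cmod (indicator E z) powr p)"
    proof -
      have "(LINT z|lebesgue_on U. cmod (indicator E z) powr p) = (LINT z|lebesgue_on U. indicator E z)"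
        by (intro Bochner_Integration.integral_cong) (auto simp: indicator_def)
      also have "\<dots> = measure (lebesgue_on U) E"
        using sets.sets_into_space[OF E] by (simp add: Int_absorb2)
      finally show ?thesis ..
    qed
    finally show "Lp_norm p (lebesgue_on U) ?T \<le> (C' + 1) powr (1 / p) * Lp_norm p (lebesgue_on U) (indicator E)"
      by (simp add: Lp_norm_def)
  qed
qed

section \<open>The covering of a monomial polyhedron\<close>

lemma matrix_adjugate_entry:
  "(\<Sum>k\<in>UNIV. B $ i $ k * adjugate B $ k $ j) = (if i = j then det B else 0)"
  using arg_cong[OF matrix_mul_adjugate[of B], of "\<lambda>M. M $ i $ j"]
  by (simp add: matrix_matrix_mult_def mat_def)

text \<open>
  The curve \<open>z\<^sub>k = exp (- t \<Sum>\<^sub>l \<Delta>\<^sub>k\<^sub>l c\<^sub>l)\<close> stays in the region for \<open>t > 0\<close> and positive \<open>c\<close>, as \<open>B \<Delta> = det B\<close>. If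
  \<open>\<Delta>\<^sub>i\<^sub>j\<close> were negative then a large \<open>c\<^sub>j\<close> would make \<open>z\<^sub>i\<close> unbounded.
\<close>
lemma adjugate_nonneg:
  fixes B :: "int ^ 'n ^ 'n::finite"
  assumes bd: "bounded (monomial_region B)" and det: "det B > 0"
  shows "0 \<le> adjugate B $ i $ j"
proof (rule ccontr)
  assume neg: "\<not> 0 \<le> adjugate B $ i $ j"
  define \<Delta> where "\<Delta> = adjugate B"
  define S where "S = (\<Sum>l\<in>UNIV. \<bar>\<Delta> $ i $ l\<bar>)"
  \<comment> \<open>\<open>S\<close> dominates the contribution of the other columns to row \<open>i\<close>\<close>
  define c where "c l = (if l = j then 1 + S else 1)" for l
  have S0: "0 \<le> S" unfolding S_def by (intro sum_nonneg) auto
  have cpos: "c l > 0" for l using S0 by (simp add: c_def)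
  define e where "e k = - (\<Sum>l\<in>UNIV. \<Delta> $ k $ l * c l)" for k
  define z where "z t = (\<chi> k. complex_of_real (exp (t * of_int (e k))))" for t :: real
  have ei: "e i \<ge> 1"
  proof -
    have "(\<Sum>l\<in>UNIV. \<Delta> $ i $ l * c l) = \<Delta> $ i $ j * (1 + S) + (\<Sum>l\<in>UNIV - {j}. \<Delta> $ i $ l * c l)"
      by (subst sum.remove[of _ j]) (auto simp: c_def)
    also have "(\<Sum>l\<in>UNIV - {j}. \<Delta> $ i $ l * c l) \<le> S"
    proof -
      have "(\<Sum>l\<in>UNIV - {j}. \<Delta> $ i $ l * c l) \<le> (\<Sum>l\<in>UNIV - {j}. \<bar>\<Delta> $ i $ l\<bar>)"
        by (intro sum_mono) (auto simp: c_def)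
      also have "\<dots> \<le> S" unfolding S_def by (intro sum_mono2) auto
      finally show ?thesis .
    qed
    also have "\<Delta> $ i $ j * (1 + S) \<le> (-1) * (1 + S)"
      using neg S0 by (intro mult_right_mono) (auto simp: \<Delta>_def)
    finally show ?thesis by (simp add: e_def)
  qed
  have zU: "z t \<in> monomial_region B" if t: "t > 0" for t
  proof -
    have "(\<Prod>k\<in>UNIV. cmod (z t $ k) powi (B $ m $ k)) < 1" for m
    proof -
      have "(\<Prod>k\<in>UNIV. cmod (z t $ k) powi (B $ m $ k)) = exp (\<Sum>k\<in>UNIV. of_int (B $ m $ k) * (t * of_int (e k)))"
        by (simp add: z_def exp_powi exp_sum)
      also have "(\<Sum>k\<in>UNIV. of_int (B $ m $ k) * (t * of_int (e k))) = t * of_int (\<Sum>k\<in>UNIV. B $ m $ k * e k)"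
        by (simp add: sum_distrib_left mult_ac)
      also have "(\<Sum>k\<in>UNIV. B $ m $ k * e k) = - (\<Sum>l\<in>UNIV. (\<Sum>k\<in>UNIV. B $ m $ k * \<Delta> $ k $ l) * c l)"
        unfolding e_def sum_distrib_left sum_distrib_right sum_negf[symmetric]
        by (subst sum.swap) (simp add: sum_negf[symmetric] sum_distrib_left mult_ac)
      also have "\<dots> = - (\<Sum>l\<in>UNIV. if m = l then det B * c m else 0)"
        unfolding \<Delta>_def matrix_adjugate_entry by (intro arg_cong[where f=uminus] sum.cong) auto
      also have "\<dots> = - (det B * c m)" by simp
      finally show ?thesis using t det cpos[of m] by (simp add: mult_pos_pos)
    qed
    then show ?thesis by (simp add: monomial_region_def) (simp add: z_def)
  qed
  obtain b where b: "\<And>w. w \<in> monomial_region B \<Longrightarrow> norm w \<le> b"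
    using bd by (auto simp: bounded_iff)
  define t where "t = \<bar>b\<bar> + 1"
  have t: "t > 0" by (simp add: t_def)
  have "1 + t * 1 \<le> 1 + t * of_int (e i)" using t ei by (intro add_left_mono mult_left_mono) auto
  also have "\<dots> \<le> exp (t * of_int (e i))" by (rule exp_ge_add_one_self)
  also have "\<dots> = norm (z t $ i)" by (simp add: z_def)
  also have "\<dots> \<le> norm (z t)" by (rule Finite_Cartesian_Product.norm_nth_le)
  also have "\<dots> \<le> b" by (rule b[OF zU[OF t]])
  finally show False by (simp add: t_def)
qed

lemma adjugate_column:
  fixes B :: "int ^ 'n ^ 'n::finite"
  assumes det: "det B > 0"
  shows "adjugate B $ i $ j = primitive_column B j $ i * Gcd (range (\<lambda>l. adjugate B $ l $ j))"
    and "Gcd (range (\<lambda>l. adjugate B $ l $ j)) > 0"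
proof -
  let ?g = "Gcd (range (\<lambda>l. adjugate B $ l $ j))"
  have "?g dvd adjugate B $ i $ j" by (rule Gcd_dvd) auto
  then show "adjugate B $ i $ j = primitive_column B j $ i * ?g"
    by (simp add: primitive_column_def)
  have "?g \<noteq> 0"
  proof
    assume "?g = 0"
    then have "adjugate B $ l $ j = 0" for l by (auto simp: Gcd_0_iff)
    then have "(\<Sum>k\<in>UNIV. B $ j $ k * adjugate B $ k $ j) = 0" by simp
    with det show False by (simp add: matrix_adjugate_entry)
  qed
  moreover have "?g \<ge> 0" by (rule Gcd_int_greater_eq_0)
  ultimately show "?g > 0" by (simp only: order.strict_iff_order not_False_eq_True simp_thms eq_commute[of 0])
qed

text \<open>
  The assumption \<open>p > p_star B\<close> enters through \<open>2 s\<^sub>j < p (s\<^sub>j + 1)\<close>, which is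
  \<open>(s\<^sub>j - 1) (2 - p) < 2 (p - 1)\<close>; and \<open>p > 1\<close> holds because \<open>s\<^sub>j \<ge> 1\<close>.
\<close>
theorem proposition1p5:
  fixes B :: "int ^ 'n ^ 'n::finite"
  assumes "monomial_polyhedron B"
    and "monomial_region B \<noteq> unit_polydisc"
    and "det B > 0"
  shows "\<forall>p. p_star B < p \<and> p \<le> 2 \<longrightarrow>
           restricted_type p (lebesgue_on (monomial_region B))
             (abs_bergman_defined_at (monomial_region B)) (abs_bergman (monomial_region B))"
proof (intro allI impI)
  fix p :: real assume p: "p_star B < p \<and> p \<le> 2"
  have bd: "bounded (monomial_region B)" and op: "open (monomial_region B)"
    using assms(1) by (auto simp: monomial_polyhedron_def domain_Cn_def)
  define A :: "int ^ 'n ^ 'n" where "A = (\<chi> i j. primitive_column B j $ i)"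
  define g where "g j = Gcd (range (\<lambda>l. adjugate B $ l $ j))" for j
  define d where "d j = (\<Sum>k\<in>UNIV. B $ j $ k * A $ k $ j)" for j
  have g: "g j > 0" and Ag: "adjugate B $ i $ j = A $ i $ j * g j" for i j
    using adjugate_column(1)[OF assms(3), of i j] adjugate_column(2)[OF assms(3), of j] by (simp_all add: g_def A_def)
  have BA: "(\<Sum>k\<in>UNIV. B $ i $ k * A $ k $ j) * g j = (if i = j then det B else 0)" for i j
    using matrix_adjugate_entry[of B i j] by (simp add: Ag sum_distrib_right mult.assoc)
  interpret monomial_domain B A d
  proof
    show "d j > 0" for j
      using BA[of j j] g[of j] assms(3) by (simp add: d_def) (metis zero_less_mult_pos2)
    show "A $ i $ j \<ge> 0" for i j
      using adjugate_nonneg[OF bd assms(3), of i j] g[of j] unfolding Ag by (simp add: zero_le_mult_iff)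
    have "(\<Sum>k\<in>UNIV. B $ i $ k * A $ k $ j) = (if i = j then d i else 0)" for i j
      using BA[of i j] g[of j] by (auto simp: d_def)
    then show "B ** A = (\<chi> i j. if i = j then d i else 0)"
      by (simp add: matrix_matrix_mult_def vec_eq_iff)
  qed (rule op)
  have ps: "2 * of_int (column_sum j) / (of_int (column_sum j) + 1) < p" for j
  proof -
    have "2 * of_int (column_sum j) / (of_int (column_sum j) + 1) \<le> p_star B"
    proof -
      have "column_sum j = (\<Sum>i\<in>UNIV. primitive_column B j $ i)"
        unfolding column_sum_def by (simp add: A_def)
      then show ?thesis unfolding p_star_def Let_def by (intro Max_ge) (auto simp del: of_int_sum)
    qed
    then show ?thesis using p by linarith
  qed
  have cs: "of_int (column_sum j) \<ge> (1::real)" for j using column_sum_pos[of j] by simp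
  show "restricted_type p (lebesgue_on (monomial_region B))
             (abs_bergman_defined_at (monomial_region B)) (abs_bergman (monomial_region B))"
  proof (rule restricted_type_abs_bergman)
    fix j
    have lt: "2 * of_int (column_sum j) < p * (of_int (column_sum j) + 1)"
      using ps[of j] cs[of j] by (simp add: field_simps)
    then show "(of_int (column_sum j) - 1) * (2 - p) < 2 * (p - 1)" by (simp add: algebra_simps)
    have "1 * (of_int (column_sum j) + 1) \<le> 2 * (of_int (column_sum j) :: real)" using cs[of j] by simp
    from le_less_trans[OF this lt] have "1 * (of_int (column_sum j) + 1) < p * (of_int (column_sum j) + 1)" .
    then show "1 < p" using cs[of j] by (subst (asm) mult_less_cancel_right) auto
  qed (use p in auto)
qed
end
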